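(* In the standing setting described in the context, define $\psi\in L^2(\mathbb{R}^d)$ by $$\psi=\sum_{\vec n\in\mathbb{Z}^d}(-1)^{\vec q_A\circ\vec n}\,\overline{h_{\vec\ell_A-\vec n}}\,D_AT_{\vec n}\varphi,$$ i.e. $\psi(\vec t)=\sqrt2\sum_{\vec n\in\mathbb{Z}^d}(-1)^{\vec q_A\circ\vec n}\overline{h_{\vec\ell_A-\vec n}}\,\varphi(A\vec t-\vec n)$. Then $\{D_A^nT_{\vec\ell}\psi: n\in\mathbb{Z},\vec\ell\in\mathbb{Z}^d\}$ is a Parseval's frame (normalized tight frame) for $L^2(\mathbb{R}^d)$, i.e. $\sum_{n\in\mathbb{Z}}\sum_{\vec\ell\in\mathbb{Z}^d}|\langle f,D_A^nT_{\vec\ell}\psi\rangle|^2=\|f\|^2$ for all $f\in L^2(\mathbb{R}^d)$.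
   Context: Notation: $\vec x\circ\vec y=\sum_j x_j\overline{y_j}$ for $\vec x,\vec y\in\mathbb{C}^d$; $A^\tau$ is the transpose; a matrix is expansive if all its eigenvalues have modulus $>1$. $(T_{\vec\ell}f)(\vec t)=f(\vec t-\vec\ell)$ and $(D_Af)(\vec t)=\sqrt2 f(A\vec t)$ on $L^2(\mathbb{R}^d)$, with $\langle f,g\rangle=\int f\overline g$. Fourier transform: $\hat f(\vec s)=(\mathcal F f)(\vec s)=(2\pi)^{-d/2}\int_{\mathbb{R}^d}e^{-i\vec s\circ\vec t}f(\vec t)\,d\vec t$ on $L^1\cap L^2$, extended to a unitary on $L^2(\mathbb{R}^d)$. Standing setting: $A$ is a $d\times d$ expansive integral matrix with $|\det A|=2$ such that $A\mathbb{Z}^d=A^\tau\mathbb{Z}^d$, and $\vec\ell_A,\vec q_A\in\mathbb{Z}^d$ satisfy: $\mathbb{Z}^d=(\vec\ell_A+A\mathbb{Z}^d)\dot\cup A\mathbb{Z}^d$; $\vec q_A\circ A\mathbb{Z}^d\subseteq2\mathbb{Z}$ and $\vec q_A\circ(\vec\ell_A+A\mathbb{Z}^d)\subseteq2\mathbb{Z}+1$; for $\vec m\in A\mathbb{Z}^d$ and $\vec n\in\mathbb{Z}^d$, $\mathbb{Z}^d=(\vec n-A\mathbb{Z}^d)\dot\cup(\vec\ell_A-\vec m-\vec n+A\mathbb{Z}^d)$; for $\vec m\in\vec\ell_A+A\mathbb{Z}^d$ and $\vec n\in\mathbb{Z}^d$, $\vec n-A\mathbb{Z}^d=\vec\ell_A-\vec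 m-\vec n+A\mathbb{Z}^d$. The complex numbers $\{h_{\vec n}\}_{\vec n\in\mathbb{Z}^d}$ satisfy $\sum_{\vec n}h_{\vec n}\overline{h_{\vec n+\vec k}}=\delta_{\vec0,\vec k}$ for all $\vec k\in A\mathbb{Z}^d$ and $\sum_{\vec n}h_{\vec n}=\sqrt2$, and $h_{\vec n}=0$ for $\vec n\notin\Lambda_0=\mathbb{Z}^d\cap[-N_0,N_0]^d$ for some $N_0\in\mathbb{N}$. Let $m_0(\vec t)=\frac1{\sqrt2}\sum_{\vec n\in\Lambda_0}h_{\vec n}e^{-i\vec n\circ\vec t}$ ($\vec t\in\mathbb{C}^d$), $g(\vec\xi)=(2\pi)^{-d/2}\prod_{j=1}^\infty m_0((A^\tau)^{-j}\vec\xi)$ for $\vec\xi\in\mathbb{R}^d$, and $\varphi=\mathcal F^{-1}g$ (which lies in $L^2(\mathbb{R}^d)$). *)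

theory Defs
  imports "HOL-Analysis.Analysis"
begin

definition dotz :: "int^'d \<Rightarrow> int^'d \<Rightarrow> int" where
  "dotz x y = (\<Sum>j\<in>UNIV. x$j * y$j)"

definition rvec :: "int^'d \<Rightarrow> real^'d" where
  "rvec n = (\<chi> j. real_of_int (n$j))"

definition rmat :: "int^'d^'d \<Rightarrow> real^'d^'d" where
  "rmat A = (\<chi> i j. real_of_int (A$i$j))"

definition cmat :: "int^'d^'d \<Rightarrow> complex^'d^'d" where
  "cmat A = (\<chi> i j. complex_of_int (A$i$j))"

definition latt :: "int^'d^'d \<Rightarrow> (int^'d) set" where
  "latt A = range (\<lambda>k. A *v k)"

definition expansive :: "int^'d^'d \<Rightarrow> bool" where
  "expansive A \<longleftrightarrow> (\<forall>c::complex. (\<exists>v::complex^'d. v \<noteq> 0 \<and> cmat A *v v = c *s v) \<longrightarrow> cmod c > 1)"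

definition sq_int :: "(real^'d \<Rightarrow> complex) \<Rightarrow> bool" where
  "sq_int f \<longleftrightarrow> f \<in> borel_measurable lborel \<and> integrable lborel (\<lambda>t. (cmod (f t))^2)"

definition L2_norm :: "(real^'d \<Rightarrow> complex) \<Rightarrow> real" where
  "L2_norm f = sqrt (LINT t|lborel. (cmod (f t))^2)"

definition L2_inner :: "(real^'d \<Rightarrow> complex) \<Rightarrow> (real^'d \<Rightarrow> complex) \<Rightarrow> complex" where
  "L2_inner f g = (LINT t|lborel. f t * cnj (g t))"

definition fourier1 :: "(real^'d \<Rightarrow> complex) \<Rightarrow> real^'d \<Rightarrow> complex" where
  "fourier1 f s = complex_of_real ((2*pi) powr (- real CARD('d) / 2)) *
      (LINT t|lborel. cis (- (s \<bullet> t)) * f t)"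

text \<open>Unitary extension of the Fourier transform to L^2 (by density of L^1 \<inter> L^2):
  F is the Fourier transform of f \<in> L^2.\<close>
definition fourier_L2 :: "(real^'d \<Rightarrow> complex) \<Rightarrow> (real^'d \<Rightarrow> complex) \<Rightarrow> bool" where
  "fourier_L2 f F \<longleftrightarrow> sq_int f \<and> sq_int F \<and>
     (\<exists>u :: nat \<Rightarrow> real^'d \<Rightarrow> complex.
        (\<forall>k. integrable lborel (u k) \<and> sq_int (u k)) \<and>
        (\<lambda>k. L2_norm (\<lambda>t. u k t - f t)) \<longlonglongrightarrow> 0 \<and>
        (\<lambda>k. L2_norm (\<lambda>t. fourier1 (u k) t - F t)) \<longlonglongrightarrow> 0)"

definition transl :: "int^'d \<Rightarrow> (real^'d \<Rightarrow> complex) \<Rightarrow> real^'d \<Rightarrow> complex" where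
  "transl l f t = f (t - rvec l)"

definition dil :: "int^'d^'d \<Rightarrow> (real^'d \<Rightarrow> complex) \<Rightarrow> real^'d \<Rightarrow> complex" where
  "dil A f t = complex_of_real (sqrt 2) * f (rmat A *v t)"

definition dil_inv :: "int^'d^'d \<Rightarrow> (real^'d \<Rightarrow> complex) \<Rightarrow> real^'d \<Rightarrow> complex" where
  "dil_inv A f t = f (matrix_inv (rmat A) *v t) / complex_of_real (sqrt 2)"

definition dil_pow :: "int^'d^'d \<Rightarrow> int \<Rightarrow> (real^'d \<Rightarrow> complex) \<Rightarrow> real^'d \<Rightarrow> complex" where
  "dil_pow A n = (if 0 \<le> n then dil A ^^ nat n else dil_inv A ^^ nat (- n))"

definition mask0 :: "(int^'d \<Rightarrow> complex) \<Rightarrow> nat \<Rightarrow> real^'d \<Rightarrow> complex" where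
  "mask0 h N0 t = (1 / complex_of_real (sqrt 2)) *
     (\<Sum>n\<in>{n::int^'d. \<forall>j. \<bar>n$j\<bar> \<le> int N0}. h n * cis (- (rvec n \<bullet> t)))"

definition gfun :: "int^'d^'d \<Rightarrow> (int^'d \<Rightarrow> complex) \<Rightarrow> nat \<Rightarrow> real^'d \<Rightarrow> complex" where
  "gfun A h N0 \<xi> = complex_of_real ((2*pi) powr (- real CARD('d) / 2)) *
     prodinf (\<lambda>j. mask0 h N0 (((\<lambda>x. matrix_inv (transpose (rmat A)) *v x) ^^ Suc j) \<xi>))"

end

theory Submission
  imports Defs "HOL-Probability.Probability" "HOL-Computational_Algebra.Fundamental_Theorem_Algebra"
begin

text \<open>
  Let \<open>V f = (\<Sum>n. h n * D T\<^sub>n f)\<close> and let \<open>\<phi>\<^sub>n = V\<^sup>n \<chi>\<close> with \<open>\<chi>\<close> the indicator function of the unit cube.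
  The integer translates of every \<open>\<phi>\<^sub>n\<close> are orthonormal, all \<open>\<phi>\<^sub>n\<close> live on one fixed ball and have
  integral 1, and their Fourier transforms converge boundedly and pointwise to the infinite product
  \<open>g\<close>. Testing against Fourier transforms of integrable functions, which are dense in \<open>L\<^sup>2\<close>, shows that
  \<open>\<phi>\<^sub>n\<close> converges weakly to \<open>\<phi>\<close>. Hence \<open>E f = (\<Sum>l. |\<langle>f, T\<^sub>l \<phi>\<rangle>|\<^sup>2) \<le> \<parallel>f\<parallel>\<^sup>2\<close>, and \<open>\<phi>\<close> satisfies the refinement
  equation weakly. The conditions on \<open>h\<close> and \<open>q\<^sub>A\<close> say that the two-channel filter bank is unitary, so
  \<open>(\<Sum>l. |\<langle>f, T\<^sub>l \<psi>\<rangle>|\<^sup>2) = E (D\<^sup>-\<^sup>1 f) - E f\<close>. Summing over dilations telescopes, and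
  \<open>E (D\<^sup>-\<^sup>J f)\<close> tends to \<open>\<parallel>f\<parallel>\<^sup>2\<close> and \<open>E (D\<^sup>J f)\<close> to 0 as \<open>J\<close> grows.
\<close>

subsection \<open>Square-integrable functions\<close>

text \<open>The translates of \<phi> need not be orthonormal and the cascade need not converge in
  norm, so everything about \<phi> is extracted from weak limits. Only what survives such a limit is
  used: Bessel's inequality, a finite linear identity tested against \<open>f\<close>, and estimates
  for single coefficients. Bessel bounds \<open>E\<close> from above. The bound from below rests on
  the integral 1 and the common support ball: they make the coefficient of a slowly varying function
  close to its value on the corresponding lattice cube.

  Plancherel's theorem is replaced by three facts: the multiplication formula, the bound of the L2
  norm of a transform by that of the function, and the density of Gaussian mollifications, which are
  transforms by construction.

  The inverse dilation need not shrink the Euclidean norm, so all estimates use bounds C r^j with r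
  < 1 for its iterates. The Jacobian 1/2 is read off from the two cosets of the lattice.\<close>

lemma sq_int_measurable: "sq_int f \<Longrightarrow> f \<in> borel_measurable borel"
  by (simp add: sq_int_def)

lemma sq_int_integrable_norm2: "sq_int f \<Longrightarrow> integrable lborel (\<lambda>t. (cmod (f t))\<^sup>2)"
  by (simp add: sq_int_def)

lemma sq_int_zero [simp]: "sq_int (\<lambda>t. 0)"
  by (simp add: sq_int_def)

lemma sq_int_bound:
  assumes "integrable lborel g" "f \<in> borel_measurable borel" "\<And>t. (cmod (f t))\<^sup>2 \<le> g t"
  shows "sq_int f"
  unfolding sq_int_def
proof (intro conjI)
  note assms(2)[measurable]
  show "f \<in> borel_measurable lborel" by simp
  show "integrable lborel (\<lambda>t. (cmod (f t))\<^sup>2)"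
    by (rule Bochner_Integration.integrable_bound[OF assms(1)])
       (use assms(3) in \<open>auto intro!: AE_I2 order_trans[OF _ abs_ge_self]\<close>)
qed

lemma sq_int_add:
  assumes "sq_int f" "sq_int g"
  shows "sq_int (\<lambda>t. f t + g t)"
proof (rule sq_int_bound[where g="\<lambda>t. 2 * (cmod (f t))\<^sup>2 + 2 * (cmod (g t))\<^sup>2"])
  show "integrable lborel (\<lambda>t. 2 * (cmod (f t))\<^sup>2 + 2 * (cmod (g t))\<^sup>2)"
    using assms by (intro Bochner_Integration.integrable_add integrable_mult_right)
      (auto simp: sq_int_def)
  show "(\<lambda>t. f t + g t) \<in> borel_measurable borel"
    using assms by (intro borel_measurable_add sq_int_measurable)
  fix t
  have "(cmod (f t + g t))\<^sup>2 \<le> (cmod (f t) + cmod (g t))\<^sup>2"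
    by (intro power_mono norm_triangle_ineq) auto
  also have "\<dots> \<le> 2 * (cmod (f t))\<^sup>2 + 2 * (cmod (g t))\<^sup>2"
    using sum_squares_bound[of "cmod (f t)" "cmod (g t)"] by (simp add: power2_sum)
  finally show "(cmod (f t + g t))\<^sup>2 \<le> \<dots>" .
qed

lemma sq_int_cmult:
  assumes "sq_int f"
  shows "sq_int (\<lambda>t. c * f t)"
  using assms by (auto simp: sq_int_def norm_mult power_mult_distrib)

lemma sq_int_diff:
  assumes "sq_int f" "sq_int g"
  shows "sq_int (\<lambda>t. f t - g t)"
  using sq_int_add[OF assms(1) sq_int_cmult[OF assms(2), of "-1"]] by simp

lemma sq_int_sum:
  assumes "\<And>i. i \<in> I \<Longrightarrow> sq_int (f i)"
  shows "sq_int (\<lambda>t. \<Sum>i\<in>I. f i t)"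
  using assms by (induction I rule: infinite_finite_induct) (auto intro: sq_int_add)

lemma borel_measurable_cnj [measurable (raw)]:
  "f \<in> borel_measurable M \<Longrightarrow> (\<lambda>x. cnj (f x)) \<in> borel_measurable M"
  by (rule borel_measurable_continuous_on[where f = cnj]) (auto intro: continuous_intros)

lemma sq_int_cnj: "sq_int f \<Longrightarrow> sq_int (\<lambda>t. cnj (f t))"
  by (auto simp: sq_int_def)

lemma sq_int_mult_indicator:
  assumes "sq_int f" "S \<in> sets borel"
  shows "sq_int (\<lambda>t. f t * indicator S t)"
proof (rule sq_int_bound[OF sq_int_integrable_norm2[OF assms(1)]])
  show "(\<lambda>t. f t * indicator S t) \<in> borel_measurable borel"
    using sq_int_measurable[OF assms(1)] assms(2) by measurable
qed (auto simp: indicator_def)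

lemma integrable_L2_inner:
  assumes "sq_int f" "sq_int g"
  shows "integrable lborel (\<lambda>t. f t * cnj (g t))"
proof (rule Bochner_Integration.integrable_bound)
  show "integrable lborel (\<lambda>t. (cmod (f t))\<^sup>2 + (cmod (g t))\<^sup>2)"
    using assms by (auto simp: sq_int_def)
  have [measurable]: "f \<in> borel_measurable borel" "g \<in> borel_measurable borel"
    using assms by (auto simp: sq_int_def)
  show "(\<lambda>t. f t * cnj (g t)) \<in> borel_measurable lborel"
    by measurable
  show "AE t in lborel. norm (f t * cnj (g t)) \<le> norm ((cmod (f t))\<^sup>2 + (cmod (g t))\<^sup>2)"
  proof (rule AE_I2)
    fix t
    have "2 * (cmod (f t) * cmod (g t)) \<le> (cmod (f t))\<^sup>2 + (cmod (g t))\<^sup>2"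
      using sum_squares_bound[of "cmod (f t)" "cmod (g t)"] by simp
    moreover have "0 \<le> cmod (f t) * cmod (g t)" by simp
    ultimately show "norm (f t * cnj (g t)) \<le> norm ((cmod (f t))\<^sup>2 + (cmod (g t))\<^sup>2)"
      unfolding norm_mult real_norm_def complex_mod_cnj by linarith
  qed
qed

lemma L2_norm_nonneg [simp]: "0 \<le> L2_norm f"
  by (simp add: L2_norm_def)

lemma L2_norm_sq: "(L2_norm f)\<^sup>2 = (LINT t|lborel. (cmod (f t))\<^sup>2)"
  by (simp add: L2_norm_def)

lemma L2_norm_cnj: "L2_norm (\<lambda>t. cnj (f t)) = L2_norm f"
  by (simp add: L2_norm_def)

lemma L2_norm_minus_commute: "L2_norm (\<lambda>t. f t - g t) = L2_norm (\<lambda>t. g t - f t)"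
  by (simp add: L2_norm_def norm_minus_commute)

lemma L2_inner_self: "L2_inner f f = complex_of_real ((L2_norm f)\<^sup>2)"
  unfolding L2_inner_def L2_norm_sq complex_norm_square[symmetric] integral_complex_of_real[symmetric]
  by simp

lemma L2_inner_commute: "L2_inner g f = cnj (L2_inner f g)"
  unfolding L2_inner_def Bochner_Integration.integral_cnj[symmetric] by (simp add: mult.commute)

lemma L2_inner_diff_left:
  assumes "sq_int f" "sq_int g" "sq_int e"
  shows "L2_inner (\<lambda>t. f t - g t) e = L2_inner f e - L2_inner g e"
  unfolding L2_inner_def using assms
  by (subst Bochner_Integration.integral_diff[symmetric])
     (auto simp: algebra_simps intro: integrable_L2_inner)

lemma L2_inner_cmult_left: "L2_inner (\<lambda>t. c * f t) e = c * L2_inner f e"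
  unfolding L2_inner_def by (simp add: mult.assoc)

lemma L2_inner_cmult_right: "L2_inner f (\<lambda>t. c * e t) = cnj c * L2_inner f e"
  by (subst (1 2) L2_inner_commute) (simp add: L2_inner_cmult_left)

lemma L2_inner_diff_right:
  assumes "sq_int f" "sq_int g" "sq_int e"
  shows "L2_inner e (\<lambda>t. f t - g t) = L2_inner e f - L2_inner e g"
  by (subst (1 2 3) L2_inner_commute) (simp add: L2_inner_diff_left assms)

lemma L2_inner_sum_left:
  assumes "\<And>i. i \<in> I \<Longrightarrow> sq_int (f i)" "sq_int e"
  shows "L2_inner (\<lambda>t. \<Sum>i\<in>I. f i t) e = (\<Sum>i\<in>I. L2_inner (f i) e)"
proof -
  have "L2_inner (\<lambda>t. \<Sum>i\<in>I. f i t) e = (LINT t|lborel. (\<Sum>i\<in>I. f i t * cnj (e t)))"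
    by (simp add: L2_inner_def sum_distrib_right)
  also have "\<dots> = (\<Sum>i\<in>I. L2_inner (f i) e)"
    unfolding L2_inner_def
    by (rule Bochner_Integration.integral_sum) (use assms in \<open>auto intro: integrable_L2_inner\<close>)
  finally show ?thesis .
qed

lemma L2_inner_sum_right:
  assumes "\<And>i. i \<in> I \<Longrightarrow> sq_int (f i)" "sq_int e"
  shows "L2_inner e (\<lambda>t. \<Sum>i\<in>I. f i t) = (\<Sum>i\<in>I. L2_inner e (f i))"
proof -
  have "L2_inner e (\<lambda>t. \<Sum>i\<in>I. f i t) = cnj (\<Sum>i\<in>I. L2_inner (f i) e)"
    by (subst L2_inner_commute) (simp add: L2_inner_sum_left assms)
  also have "\<dots> = (\<Sum>i\<in>I. L2_inner e (f i))"
    unfolding cnj_sum by (intro sum.cong refl L2_inner_commute[symmetric])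
  finally show ?thesis .
qed

text \<open>The moduli stay inside the integral because this form also controls the cross term in
  \<open>L2_norm_triangle\<close> and, against an indicator function, an L1 norm.\<close>

lemma L2_Cauchy_Schwarz_norm:
  assumes "sq_int f" "sq_int g"
  shows "(LINT t|lborel. cmod (f t) * cmod (g t)) \<le> L2_norm f * L2_norm g"
proof -
  have [measurable]: "f \<in> borel_measurable borel" "g \<in> borel_measurable borel"
    using assms by (auto simp: sq_int_def)
  have int: "integrable lborel (\<lambda>t. cmod (f t) * cmod (g t))"
    using integrable_norm[OF integrable_L2_inner[OF assms]] by (simp add: norm_mult)
  let ?I = "LINT t|lborel. cmod (f t) * cmod (g t)"
  have nn: "0 \<le> ?I" by (intro integral_nonneg_AE) auto
  have "(\<integral>\<^sup>+t. ennreal (cmod (f t)) * ennreal (cmod (g t)) \<partial>lborel)\<^sup>2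
      \<le> (\<integral>\<^sup>+t. (ennreal (cmod (f t)))\<^sup>2 \<partial>lborel) * (\<integral>\<^sup>+t. (ennreal (cmod (g t)))\<^sup>2 \<partial>lborel)"
    by (rule Cauchy_Schwarz_nn_integral) measurable
  moreover have "(\<integral>\<^sup>+t. ennreal (cmod (f t)) * ennreal (cmod (g t)) \<partial>lborel) = ennreal ?I"
    unfolding ennreal_mult[OF norm_ge_zero norm_ge_zero, symmetric]
    by (rule nn_integral_eq_integral[OF int]) auto
  moreover have "(\<integral>\<^sup>+t. (ennreal (cmod (k t)))\<^sup>2 \<partial>lborel) = ennreal ((L2_norm k)\<^sup>2)"
    if "sq_int k" for k :: "real^'a \<Rightarrow> complex"
    unfolding L2_norm_sq ennreal_power[OF norm_ge_zero] using that
    by (intro nn_integral_eq_integral) (auto simp: sq_int_def)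
  ultimately have "(ennreal ?I)\<^sup>2 \<le> ennreal ((L2_norm f)\<^sup>2) * ennreal ((L2_norm g)\<^sup>2)"
    using assms by simp
  then have "?I\<^sup>2 \<le> (L2_norm f * L2_norm g)\<^sup>2"
    using nn by (simp add: ennreal_power ennreal_mult[symmetric] power_mult_distrib)
  then show ?thesis by (rule power2_le_imp_le) simp
qed

lemma L2_Cauchy_Schwarz:
  assumes "sq_int f" "sq_int g"
  shows "cmod (L2_inner f g) \<le> L2_norm f * L2_norm g"
proof -
  have "cmod (L2_inner f g) \<le> (LINT t|lborel. cmod (f t * cnj (g t)))"
    unfolding L2_inner_def by (rule integral_norm_bound)
  also have "\<dots> \<le> L2_norm f * L2_norm g"
    using L2_Cauchy_Schwarz_norm[OF assms] by (simp add: norm_mult)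
  finally show ?thesis .
qed

lemma L2_norm_triangle:
  assumes "sq_int f" "sq_int g"
  shows "L2_norm (\<lambda>t. f t + g t) \<le> L2_norm f + L2_norm g"
proof (rule power2_le_imp_le)
  have [measurable]: "f \<in> borel_measurable borel" "g \<in> borel_measurable borel"
    using assms by (auto simp: sq_int_def)
  have int: "integrable lborel (\<lambda>t. cmod (f t) * cmod (g t))"
    using integrable_norm[OF integrable_L2_inner[OF assms]] by (simp add: norm_mult)
  note ints = sq_int_integrable_norm2[OF assms(1)] sq_int_integrable_norm2[OF assms(2)]
  have "(L2_norm (\<lambda>t. f t + g t))\<^sup>2
      \<le> (LINT t|lborel. (cmod (f t))\<^sup>2 + (cmod (g t))\<^sup>2 + 2 * (cmod (f t) * cmod (g t)))"
    unfolding L2_norm_sq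
  proof (rule integral_mono)
    show "integrable lborel (\<lambda>t. (cmod (f t))\<^sup>2 + (cmod (g t))\<^sup>2 + 2 * (cmod (f t) * cmod (g t)))"
      using ints int by auto
    fix t
    have "(cmod (f t + g t))\<^sup>2 \<le> (cmod (f t) + cmod (g t))\<^sup>2"
      by (intro power_mono norm_triangle_ineq) auto
    then show "(cmod (f t + g t))\<^sup>2 \<le> (cmod (f t))\<^sup>2 + (cmod (g t))\<^sup>2 + 2 * (cmod (f t) * cmod (g t))"
      by (simp add: power2_sum algebra_simps)
  qed (rule sq_int_integrable_norm2[OF sq_int_add[OF assms]])
  also have "\<dots> = (L2_norm f)\<^sup>2 + (L2_norm g)\<^sup>2 + 2 * (LINT t|lborel. cmod (f t) * cmod (g t))"
    unfolding L2_norm_sq using ints int by simp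
  also have "\<dots> \<le> (L2_norm f + L2_norm g)\<^sup>2"
    using L2_Cauchy_Schwarz_norm[OF assms] by (simp add: power2_sum)
  finally show "(L2_norm (\<lambda>t. f t + g t))\<^sup>2 \<le> (L2_norm f + L2_norm g)\<^sup>2" .
qed simp

lemma L2_norm_triangle_diff:
  assumes "sq_int f" "sq_int g"
  shows "L2_norm f \<le> L2_norm g + L2_norm (\<lambda>t. f t - g t)"
  using L2_norm_triangle[OF assms(2) sq_int_diff[OF assms]] by simp

lemma L2_inner_limit_right:
  assumes "sq_int g" "\<And>k. sq_int (u k)" "sq_int f" "(\<lambda>k. L2_norm (\<lambda>t. u k t - f t)) \<longlonglongrightarrow> 0"
  shows "(\<lambda>k. L2_inner g (u k)) \<longlonglongrightarrow> L2_inner g f"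
proof (rule LIM_zero_cancel, rule Lim_null_comparison)
  show "(\<lambda>k. L2_norm g * L2_norm (\<lambda>t. u k t - f t)) \<longlonglongrightarrow> 0"
    using tendsto_mult_right_zero[OF assms(4)] by simp
  have "cmod (L2_inner g (u k) - L2_inner g f) \<le> L2_norm g * L2_norm (\<lambda>t. u k t - f t)" for k
    using L2_Cauchy_Schwarz[OF assms(1) sq_int_diff[OF assms(2,3)]]
    by (simp add: L2_inner_diff_right assms)
  then show "\<forall>\<^sub>F k in sequentially. norm (L2_inner g (u k) - L2_inner g f)
      \<le> L2_norm g * L2_norm (\<lambda>t. u k t - f t)"
    by simp
qed

lemma L2_inner_limit_left:
  assumes "sq_int g" "\<And>k. sq_int (u k)" "sq_int f" "(\<lambda>k. L2_norm (\<lambda>t. u k t - f t)) \<longlonglongrightarrow> 0"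
  shows "(\<lambda>k. L2_inner (u k) g) \<longlonglongrightarrow> L2_inner f g"
  by (subst (1 2) L2_inner_commute) (intro tendsto_cnj L2_inner_limit_right assms)

text \<open>The squared distance from \<open>f\<close> to its projection \<open>s\<close> is
  nonnegative. Finite index sets suffice: weak limits commute with finite sums, and sums of squares
  are suprema over finite sets.\<close>

lemma L2_Bessel_finite:
  assumes f: "sq_int f" and "finite I" and e: "\<And>i. i \<in> I \<Longrightarrow> sq_int (e i)"
    and on: "\<And>i j. i \<in> I \<Longrightarrow> j \<in> I \<Longrightarrow> L2_inner (e i) (e j) = (if i = j then 1 else 0)"
  shows "(\<Sum>i\<in>I. (cmod (L2_inner f (e i)))\<^sup>2) \<le> (L2_norm f)\<^sup>2"
proof -
  define c where "c i = L2_inner f (e i)" for i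
  define s where "s = (\<lambda>t. \<Sum>i\<in>I. c i * e i t)"
  define S where "S = (\<Sum>i\<in>I. (cmod (c i))\<^sup>2)"
  have s: "sq_int s"
    unfolding s_def by (intro sq_int_sum sq_int_cmult e)
  have fs: "L2_inner f s = complex_of_real S"
    unfolding s_def S_def
    by (subst L2_inner_sum_right)
       (simp_all add: e f sq_int_cmult L2_inner_cmult_right complex_norm_square mult.commute
             flip: c_def del: of_real_power)
  have es: "L2_inner (e i) s = cnj (c i)" if "i \<in> I" for i
  proof -
    have "L2_inner (e i) s = (\<Sum>j\<in>I. cnj (c j) * L2_inner (e i) (e j))"
      unfolding s_def using that
      by (subst L2_inner_sum_right) (auto simp: e sq_int_cmult L2_inner_cmult_right)
    also have "\<dots> = (\<Sum>j\<in>I. if j = i then cnj (c j) else 0)"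
      using that by (intro sum.cong) (auto simp: on)
    finally show ?thesis using that \<open>finite I\<close> by simp
  qed
  have "L2_inner s s = (\<Sum>i\<in>I. c i * L2_inner (e i) s)"
    by (subst (1) s_def) (subst L2_inner_sum_left, auto simp: e s sq_int_cmult L2_inner_cmult_left)
  also have "\<dots> = complex_of_real S"
    by (simp add: es S_def complex_norm_square del: of_real_power)
  finally have ss: "L2_inner s s = complex_of_real S" .
  have "complex_of_real ((L2_norm (\<lambda>t. f t - s t))\<^sup>2)
      = L2_inner f f - L2_inner f s - (L2_inner s f - L2_inner s s)"
    unfolding L2_inner_self[symmetric]
    by (subst L2_inner_diff_left) (auto simp: f s sq_int_diff L2_inner_diff_right)
  also have "\<dots> = complex_of_real ((L2_norm f)\<^sup>2 - S)"
    using L2_inner_commute[of s f] L2_inner_self[of f] by (simp add: fs ss)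
  finally have "(L2_norm (\<lambda>t. f t - s t))\<^sup>2 = (L2_norm f)\<^sup>2 - S"
    by (simp only: of_real_eq_iff)
  then have "S \<le> (L2_norm f)\<^sup>2"
    using zero_le_power2[of "L2_norm (\<lambda>t. f t - s t)"] by linarith
  then show ?thesis by (simp add: S_def c_def)
qed

subsection \<open>Linear change of variables and expansive matrices\<close>

lemma matrix_inv_mult_vec:
  fixes M :: "'a::field^'n^'n"
  assumes "invertible M"
  shows "matrix_inv M *v (M *v x) = x" "M *v (matrix_inv M *v x) = x"
  using someI_ex[OF assms[unfolded invertible_def]]
  by (simp_all add: matrix_vector_mul_assoc matrix_inv_def)

lemma rvec_add: "rvec (m + n) = rvec m + rvec n"
  by (simp add: rvec_def vec_eq_iff)

lemma rvec_diff: "rvec (m - n) = rvec m - rvec n"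
  by (simp add: rvec_def vec_eq_iff)

lemma rvec_uminus: "rvec (- n) = - rvec n"
  by (simp add: rvec_def vec_eq_iff)

lemma rvec_zero [simp]: "rvec 0 = 0"
  by (simp add: rvec_def vec_eq_iff)

lemma rvec_inject [simp]: "rvec m = rvec n \<longleftrightarrow> m = n"
  by (simp add: rvec_def vec_eq_iff)

lemma rvec_matrix: "rvec (A *v k) = rmat A *v rvec k"
  by (simp add: rvec_def rmat_def matrix_vector_mult_def vec_eq_iff)

lemma borel_measurable_matrix_vector_mult [measurable]:
  fixes M :: "real^'n^'m"
  shows "(\<lambda>x. M *v x) \<in> borel \<rightarrow>\<^sub>M borel"
  by (intro borel_measurable_continuous_onI matrix_vector_mult_linear_continuous_on)

text \<open>Half open, so that the integer translates tile space without overlap.\<close>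

definition ucube :: "(real^'d) set" where
  "ucube = {x. \<forall>j. 0 \<le> x$j \<and> x$j < 1}"

lemma ucube_measurable [measurable]: "ucube \<in> sets (borel :: (real^'d) measure)"
proof -
  have "ucube = (\<Inter>j. {x::real^'d. 0 \<le> x$j} \<inter> {x. x$j < 1})"
    by (auto simp: ucube_def)
  moreover have "{x::real^'d. 0 \<le> x$j} \<in> sets borel" for j
    by (intro borel_closed closed_Collect_le continuous_intros)
  moreover have "{x::real^'d. x$j < 1} \<in> sets borel" for j
    by (intro borel_open open_Collect_less continuous_intros)
  ultimately show ?thesis
    by (metis (no_types, lifting) sets.finite_INT finite UNIV_not_empty sets.Int)
qed

lemma emeasure_ucube [simp]: "emeasure lborel (ucube :: (real^'d) set) = 1"
proof (rule antisym)
  have 1: "emeasure lborel (cbox 0 (1::real^'d)) = 1" "emeasure lborel (box 0 (1::real^'d)) = 1"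
    by (auto simp: emeasure_lborel_cbox_eq emeasure_lborel_box_eq Basis_vec_def inner_axis intro!: prod.neutral)
  have "ucube \<subseteq> cbox 0 (1::real^'d)"
    by (auto simp: ucube_def mem_box_cart less_imp_le)
  then show "emeasure lborel (ucube :: (real^'d) set) \<le> 1"
    using emeasure_mono[of ucube "cbox 0 (1::real^'d)" lborel] 1 by simp
  have "box 0 (1::real^'d) \<subseteq> ucube"
    by (auto simp: ucube_def mem_box_cart less_imp_le)
  then show "1 \<le> emeasure lborel (ucube :: (real^'d) set)"
    using emeasure_mono[of "box 0 (1::real^'d)" ucube lborel] 1 by simp
qed

lemma ucube_translate_iff: "y + rvec n \<in> ucube \<longleftrightarrow> n = (\<chi> j. - \<lfloor>y$j\<rfloor>)"
proof -
  have "0 \<le> y$j + of_int (n$j) \<and> y$j + of_int (n$j) < 1 \<longleftrightarrow> n$j = - \<lfloor>y$j\<rfloor>" for j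
    by linarith
  then show ?thesis
    by (simp add: ucube_def rvec_def vec_eq_iff)
qed

lemma norm_ucube_le:
  fixes x :: "real^'d"
  assumes "x \<in> ucube" shows "norm x \<le> real CARD('d)"
proof -
  have "norm x \<le> (\<Sum>i\<in>UNIV. \<bar>x$i\<bar>)" by (rule norm_le_l1_cart)
  also have "\<dots> \<le> (\<Sum>i\<in>(UNIV::'d set). 1)"
    using assms by (intro sum_mono) (auto simp: ucube_def less_imp_le)
  finally show ?thesis by simp
qed

lemma nn_integral_lborel_translate:
  fixes F :: "'a::euclidean_space \<Rightarrow> ennreal"
  assumes [measurable]: "F \<in> borel_measurable borel"
  shows "(\<integral>\<^sup>+x. F (x + c) \<partial>lborel) = (\<integral>\<^sup>+x. F x \<partial>lborel)"
proof -
  have "(\<integral>\<^sup>+x. F x \<partial>lborel) = (\<integral>\<^sup>+x. F x \<partial>(distr lborel borel ((+) c)))"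
    by (simp add: lborel_distr_plus)
  also have "\<dots> = (\<integral>\<^sup>+x. F (x + c) \<partial>lborel)"
    by (subst nn_integral_distr) (auto simp: add.commute)
  finally show ?thesis ..
qed

lemma integral_lborel_translate:
  fixes F :: "'a::euclidean_space \<Rightarrow> 'b::{banach, second_countable_topology}"
  assumes [measurable]: "F \<in> borel_measurable borel"
  shows "(LINT x|lborel. F (x + c)) = (LINT x|lborel. F x)"
    and "integrable lborel (\<lambda>x. F (x + c)) \<longleftrightarrow> integrable lborel F"
proof -
  have "(LINT x|lborel. F x) = (LINT x|(distr lborel borel ((+) c)). F x)"
    by (simp add: lborel_distr_plus)
  also have "\<dots> = (LINT x|lborel. F (x + c))"
    by (subst integral_distr) (auto simp: add.commute)
  finally show "(LINT x|lborel. F (x + c)) = (LINT x|lborel. F x)" ..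
  have "integrable lborel F \<longleftrightarrow> integrable (distr lborel borel ((+) c)) F"
    by (simp add: lborel_distr_plus)
  also have "\<dots> \<longleftrightarrow> integrable lborel (\<lambda>x. F (x + c))"
    by (subst integrable_distr_eq) (auto simp: add.commute)
  finally show "integrable lborel (\<lambda>x. F (x + c)) \<longleftrightarrow> integrable lborel F" ..
qed

lemma nn_integral_count_singleton:
  "(\<integral>\<^sup>+n. (if n = a then c else 0) \<partial>count_space UNIV) = (c::ennreal)"
proof -
  have "(\<integral>\<^sup>+n. (if n = a then c else 0) \<partial>count_space UNIV)
      = (\<integral>\<^sup>+n. c * indicator {a} n \<partial>count_space UNIV)"
    by (intro nn_integral_cong) auto
  then show ?thesis by (simp add: nn_integral_cmult_indicator)
qed

text \<open>Tonelli, with lattice sums written as integrals for the counting measure so that no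
  summability has to be shown.\<close>

lemma nn_integral_count_space_swap:
  fixes F :: "'i::countable \<Rightarrow> 'a::euclidean_space \<Rightarrow> ennreal"
  assumes "\<And>i. F i \<in> borel_measurable borel"
  shows "(\<integral>\<^sup>+i. (\<integral>\<^sup>+x. F i x \<partial>lborel) \<partial>count_space UNIV)
       = (\<integral>\<^sup>+x. (\<integral>\<^sup>+i. F i x \<partial>count_space UNIV) \<partial>lborel)"
proof -
  interpret C: sigma_finite_measure "count_space (UNIV :: 'i set)"
    by (rule sigma_finite_measure_count_space)
  interpret pair_sigma_finite "count_space (UNIV :: 'i set)" "lborel :: 'a measure" ..
  have "case_prod F \<in> borel_measurable (count_space UNIV \<Otimes>\<^sub>M (lborel :: 'a measure))"
    by (rule measurable_pair_measure_countable1) (auto simp: assms)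
  from Fubini'[OF this] show ?thesis by simp
qed

text \<open>Each point lies in exactly one translate of the cube, so the factor 1 can be inserted as
  a sum of translated indicators; each summand is then moved back to the cube.\<close>

lemma nn_integral_periodize:
  fixes F :: "real^'d \<Rightarrow> ennreal"
  assumes [measurable]: "F \<in> borel_measurable borel"
  shows "(\<integral>\<^sup>+x. F x \<partial>lborel)
       = (\<integral>\<^sup>+x. indicator ucube x * (\<integral>\<^sup>+n. F (x + rvec n) \<partial>count_space UNIV) \<partial>lborel)"
proof -
  have "F x = (\<integral>\<^sup>+n. F x * indicator ucube (x - rvec n) \<partial>count_space UNIV)" for x
  proof -
    define m where "m = - (\<chi> j. - \<lfloor>x$j\<rfloor>)"
    have "x - rvec n \<in> ucube \<longleftrightarrow> n = m" for n
      using ucube_translate_iff[of x "- n"] unfolding m_def rvec_uminus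
      by (metis add.inverse_inverse add_uminus_conv_diff)
    then have "(\<integral>\<^sup>+n. F x * indicator ucube (x - rvec n) \<partial>count_space UNIV)
             = (\<integral>\<^sup>+n. (if n = m then F x else 0) \<partial>count_space UNIV)"
      by (intro nn_integral_cong) (auto simp: indicator_def)
    then show ?thesis by (simp add: nn_integral_count_singleton)
  qed
  then have "(\<integral>\<^sup>+x. F x \<partial>lborel)
      = (\<integral>\<^sup>+x. (\<integral>\<^sup>+n. F x * indicator ucube (x - rvec n) \<partial>count_space UNIV) \<partial>lborel)"
    by simp
  also have "\<dots> = (\<integral>\<^sup>+n. (\<integral>\<^sup>+x. F x * indicator ucube (x - rvec n) \<partial>lborel) \<partial>count_space UNIV)"
    by (rule nn_integral_count_space_swap[symmetric]) measurable
  also have "\<dots> = (\<integral>\<^sup>+n. (\<integral>\<^sup>+x. F (x + rvec n) * indicator ucube x \<partial>lborel) \<partial>count_space UNIV)"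
  proof (rule nn_integral_cong)
    fix n :: "int^'d"
    show "(\<integral>\<^sup>+x. F x * indicator ucube (x - rvec n) \<partial>lborel)
        = (\<integral>\<^sup>+x. F (x + rvec n) * indicator ucube x \<partial>lborel)"
      by (subst nn_integral_lborel_translate[where c="rvec n", symmetric]) auto
  qed
  also have "\<dots> = (\<integral>\<^sup>+x. (\<integral>\<^sup>+n. F (x + rvec n) * indicator ucube x \<partial>count_space UNIV) \<partial>lborel)"
    by (rule nn_integral_count_space_swap) measurable
  finally show ?thesis
    by (simp add: nn_integral_cmult mult.commute)
qed

text \<open>Uniqueness of Haar measure: the two orders of integration of
  \<open>g y * F (M x + y)\<close>, with \<open>g\<close> the indicator of the unit cube.\<close>

lemma nn_integral_linear_scale:
  fixes M :: "real^'d^'d"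
  assumes "invertible M"
  obtains c where "\<And>F. F \<in> borel_measurable borel \<Longrightarrow>
    (\<integral>\<^sup>+x. F (M *v x) \<partial>lborel) = c * (\<integral>\<^sup>+x. F x \<partial>lborel)"
proof
  define g :: "real^'d \<Rightarrow> ennreal" where "g = indicator ucube"
  define c where "c = (\<integral>\<^sup>+x. g (- (M *v x)) \<partial>lborel)"
  have g [measurable]: "g \<in> borel_measurable borel" by (simp add: g_def)
  have inv: "M *v (matrix_inv M *v y) = y" for y
    using assms by (simp add: matrix_inv_mult_vec)
  fix F :: "real^'d \<Rightarrow> ennreal"
  assume F [measurable]: "F \<in> borel_measurable borel"
  have "(\<integral>\<^sup>+x. F (M *v x) \<partial>lborel) = (\<integral>\<^sup>+y. g y * (\<integral>\<^sup>+x. F (M *v x) \<partial>lborel) \<partial>lborel)"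
    by (subst nn_integral_multc) (auto simp: g_def)
  also have "\<dots> = (\<integral>\<^sup>+y. (\<integral>\<^sup>+x. g y * F (M *v x + y) \<partial>lborel) \<partial>lborel)"
  proof (rule nn_integral_cong)
    fix y
    have "(\<integral>\<^sup>+x. F (M *v x + y) \<partial>lborel) = (\<integral>\<^sup>+x. F (M *v (x + matrix_inv M *v y)) \<partial>lborel)"
      by (simp add: inv matrix_vector_right_distrib)
    also have "\<dots> = (\<integral>\<^sup>+x. F (M *v x) \<partial>lborel)"
      by (rule nn_integral_lborel_translate[where F="\<lambda>x. F (M *v x)"]) measurable
    finally show "g y * (\<integral>\<^sup>+x. F (M *v x) \<partial>lborel) = (\<integral>\<^sup>+x. g y * F (M *v x + y) \<partial>lborel)"
      by (subst nn_integral_cmult) auto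
  qed
  also have "\<dots> = (\<integral>\<^sup>+x. (\<integral>\<^sup>+y. g y * F (M *v x + y) \<partial>lborel) \<partial>lborel)"
    by (rule lborel_pair.Fubini') measurable
  also have "\<dots> = (\<integral>\<^sup>+x. (\<integral>\<^sup>+y. g (y - M *v x) * F y \<partial>lborel) \<partial>lborel)"
  proof (rule nn_integral_cong)
    fix x
    show "(\<integral>\<^sup>+y. g y * F (M *v x + y) \<partial>lborel) = (\<integral>\<^sup>+y. g (y - M *v x) * F y \<partial>lborel)"
      by (subst (2) nn_integral_lborel_translate[where c="M *v x", symmetric])
         (auto simp: add.commute)
  qed
  also have "\<dots> = (\<integral>\<^sup>+y. (\<integral>\<^sup>+x. g (y - M *v x) * F y \<partial>lborel) \<partial>lborel)"
    by (rule lborel_pair.Fubini') measurable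
  also have "\<dots> = (\<integral>\<^sup>+y. c * F y \<partial>lborel)"
  proof (rule nn_integral_cong)
    fix y
    have "(\<integral>\<^sup>+x. g (y - M *v x) \<partial>lborel) = (\<integral>\<^sup>+x. g (- (M *v (x + - (matrix_inv M *v y)))) \<partial>lborel)"
      by (simp add: inv matrix_vector_right_distrib matrix_vector_mult_diff_distrib)
    also have "\<dots> = c"
      unfolding c_def
      by (rule nn_integral_lborel_translate[where F="\<lambda>x. g (- (M *v x))"]) measurable
    finally show "(\<integral>\<^sup>+x. g (y - M *v x) * F y \<partial>lborel) = c * F y"
      by (subst nn_integral_multc) auto
  qed
  finally show "(\<integral>\<^sup>+x. F (M *v x) \<partial>lborel) = c * (\<integral>\<^sup>+x. F x \<partial>lborel)"
    by (simp add: nn_integral_cmult)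
qed

lemma latt_uminus: "k \<in> latt A \<Longrightarrow> - k \<in> latt A"
  unfolding latt_def by (auto intro!: image_eqI[where x="- _"] simp: matrix_vector_mult_def vec_eq_iff sum_negf)

lemma latt_zero: "0 \<in> latt A"
  unfolding latt_def by (auto intro!: image_eqI[where x=0])

text \<open>\<open>part\<close> and \<open>disj\<close> give the lattice exactly two cosets; this
  index fixes the Jacobian in \<open>nn_integral_dilate\<close>.\<close>

locale dilation_lattice =
  fixes A :: "int^'d^'d" and lA :: "int^'d"
  assumes expA: "expansive A"
    and part: "UNIV = ((\<lambda>k. lA + k) ` latt A) \<union> latt A"
    and disj: "((\<lambda>k. lA + k) ` latt A) \<inter> latt A = {}"
begin

abbreviation "R \<equiv> rmat A"
abbreviation "Ri \<equiv> matrix_inv (rmat A)"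

lemma cmat_inject:
  assumes "cmat A *v v = 0" shows "v = 0"
proof (rule ccontr)
  assume "v \<noteq> 0"
  with assms expA have "cmod 0 > 1"
    unfolding expansive_def by (metis vector_smult_lzero)
  then show False by simp
qed

lemma invertible_cmat: "invertible (cmat A)"
  using cmat_inject matrix_left_invertible_ker invertible_left_inverse by blast

lemma cmat_of_real: "cmat A *v (\<chi> i. complex_of_real (x$i)) = (\<chi> i. complex_of_real ((R *v x)$i))"
  by (simp add: vec_eq_iff cmat_def rmat_def matrix_vector_mult_def)

lemma invertible_R: "invertible R"
proof -
  have "x = 0" if "R *v x = 0" for x
  proof -
    have "(\<chi> i. complex_of_real (x$i)) = 0"
      by (rule cmat_inject, subst cmat_of_real) (simp add: that vec_eq_iff)
    then show ?thesis by (simp add: vec_eq_iff)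
  qed
  then show ?thesis
    using matrix_left_invertible_ker invertible_left_inverse by blast
qed

lemma R_Ri [simp]: "R *v (Ri *v x) = x" and Ri_R [simp]: "Ri *v (R *v x) = x"
  using invertible_R by (simp_all add: matrix_inv_mult_vec)

lemma A_inject [simp]: "A *v k = A *v l \<longleftrightarrow> k = l"
  by (metis Ri_R rvec_inject rvec_matrix)

text \<open>Index two: the nontrivial coset is closed under negation, and adding \<open>lA\<close>
  exchanges the two cosets.\<close>

lemma latt_dichotomy: "n + lA \<in> latt A \<longleftrightarrow> n \<notin> latt A"
proof
  assume "n + lA \<in> latt A"
  then have "- n \<in> (\<lambda>k. lA + k) ` latt A"
    by (intro image_eqI[where x="- (n + lA)"]) (auto dest: latt_uminus)
  then show "n \<notin> latt A" using disj latt_uminus by blast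
next
  assume "n \<notin> latt A"
  then have "- n \<notin> latt A" using latt_uminus by fastforce
  then have "- n \<in> (\<lambda>k. lA + k) ` latt A" using part by blast
  then obtain k where "k \<in> latt A" "- n = lA + k" by blast
  moreover from this have "n + lA = - k" by (simp add: algebra_simps minus_equation_iff[of n])
  ultimately show "n + lA \<in> latt A" using latt_uminus by simp
qed

text \<open>Uniqueness of Haar measure leaves one unknown factor \<open>c\<close>. It is found on
  the sum of \<open>q (R *v x)\<close> and \<open>q (R *v x - rvec lA)\<close>, whose periodization
  is identically 1 by the coset partition; hence \<open>c + c = 1\<close>.\<close>

lemma nn_integral_dilate:
  fixes F :: "real^'d \<Rightarrow> ennreal"
  assumes F: "F \<in> borel_measurable borel"
  shows "(\<integral>\<^sup>+x. F (R *v x) \<partial>lborel) = ennreal (1/2) * (\<integral>\<^sup>+x. F x \<partial>lborel)"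
proof -
  obtain c where c: "\<And>F. F \<in> borel_measurable borel \<Longrightarrow>
    (\<integral>\<^sup>+x. F (R *v x) \<partial>lborel) = c * (\<integral>\<^sup>+x. F x \<partial>lborel)"
    using nn_integral_linear_scale[OF invertible_R] by blast
  define q :: "real^'d \<Rightarrow> ennreal" where "q = indicator ucube"
  have [measurable]: "q \<in> borel_measurable borel" by (simp add: q_def)
  \<comment> \<open>Exactly one integer vector \<open>n\<close> moves \<open>y\<close> into the
    cube, and it has exactly one of the forms \<open>A *v k\<close> and \<open>A *v k - lA\<close>,
    for exactly one \<open>k\<close>.\<close>
  have key: "(\<integral>\<^sup>+k. q (y + rvec (A *v k)) + q (y + rvec (A *v k - lA)) \<partial>count_space UNIV) = 1" for y
  proof -
    define n :: "int^'d" where "n = (\<chi> j. - \<lfloor>y$j\<rfloor>)"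
    have q: "q (y + rvec m) = (if m = n then 1 else 0)" for m
      by (simp add: q_def indicator_def ucube_translate_iff n_def)
    have "\<exists>k. \<forall>l. (A *v l = n \<longleftrightarrow> l = k \<and> n \<in> latt A) \<and> (A *v l - lA = n \<longleftrightarrow> l = k \<and> n \<notin> latt A)"
    proof (cases "n \<in> latt A")
      case True
      then obtain k where k: "n = A *v k" by (auto simp: latt_def)
      have "A *v l - lA \<noteq> n" for l
        using latt_dichotomy[of n] True by (metis diff_add_cancel latt_def rangeI)
      with k True show ?thesis by auto
    next
      case False
      then obtain k where k: "n + lA = A *v k"
        using latt_dichotomy[of n] by (auto simp: latt_def)
      have "A *v l \<noteq> n" for l
        using False by (auto simp: latt_def)
      moreover have "A *v l - lA = n \<longleftrightarrow> l = k" for l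
        using k by (metis A_inject add_diff_cancel_right' diff_add_cancel)
      ultimately show ?thesis using False by auto
    qed
    then obtain k where k: "\<And>l. A *v l = n \<longleftrightarrow> l = k \<and> n \<in> latt A"
      "\<And>l. A *v l - lA = n \<longleftrightarrow> l = k \<and> n \<notin> latt A" by blast
    have "(\<integral>\<^sup>+k. q (y + rvec (A *v k)) + q (y + rvec (A *v k - lA)) \<partial>count_space UNIV)
        = (\<integral>\<^sup>+l. (if l = k then 1 else 0) \<partial>count_space UNIV)"
      by (intro nn_integral_cong) (auto simp: q k)
    then show ?thesis by (simp add: nn_integral_count_singleton)
  qed
  have "(\<integral>\<^sup>+x. q (R *v x) + q (R *v x - rvec lA) \<partial>lborel)
      = (\<integral>\<^sup>+x. indicator ucube x * (\<integral>\<^sup>+n. q (R *v (x + rvec n)) + q (R *v (x + rvec n) - rvec lA)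
          \<partial>count_space UNIV) \<partial>lborel)"
    by (rule nn_integral_periodize) measurable
  also have "\<dots> = (\<integral>\<^sup>+x. indicator (ucube :: (real^'d) set) x * 1 \<partial>lborel)"
  proof (rule nn_integral_cong)
    fix x
    show "indicator ucube x * (\<integral>\<^sup>+n. q (R *v (x + rvec n)) + q (R *v (x + rvec n) - rvec lA)
          \<partial>count_space UNIV) = indicator ucube x * 1"
      using key[of "R *v x"] by (simp add: matrix_vector_right_distrib rvec_matrix rvec_diff add_diff_eq)
  qed
  also have "\<dots> = 1" by simp
  finally have "(\<integral>\<^sup>+x. q (R *v x) + q (R *v x - rvec lA) \<partial>lborel) = 1" .
  moreover have "(\<integral>\<^sup>+x. q (R *v x) + q (R *v x - rvec lA) \<partial>lborel)
      = c * (\<integral>\<^sup>+x. q x \<partial>lborel) + c * (\<integral>\<^sup>+x. q (x - rvec lA) \<partial>lborel)"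
    by (subst nn_integral_add) (auto simp: c[of q] c[of "\<lambda>x. q (x - rvec lA)"])
  moreover have "(\<integral>\<^sup>+x. q (x - rvec lA) \<partial>lborel) = (\<integral>\<^sup>+x. q x \<partial>lborel)"
    using nn_integral_lborel_translate[of q "- rvec lA"] by simp
  moreover have "(\<integral>\<^sup>+x. q x \<partial>lborel) = 1" by (simp add: q_def)
  ultimately have "c + c = 1" by simp
  then have "c = ennreal (1/2)"
  proof (cases c)
    case (real r)
    then have "ennreal (r + r) = ennreal 1"
      using \<open>c + c = 1\<close> ennreal_plus[of r r] by (simp only: ennreal_1)
    then have "r + r = 1" using real(1) ennreal_inj[of "r + r" 1] by linarith
    then have "r = 1/2" by simp
    then show ?thesis using real(2) by (simp only:)
  qed simp
  then show ?thesis using c[OF F] by simp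
qed

text \<open>As an equality of measures the Jacobian also serves Bochner integrals and
  integrability.\<close>

lemma distr_dilate: "distr lborel borel (\<lambda>x. R *v x) = density lborel (\<lambda>_. ennreal (1/2))"
proof (rule measure_eqI)
  fix S assume "S \<in> sets (distr lborel borel (\<lambda>x. R *v x))"
  then have [measurable]: "S \<in> sets borel" by simp
  have "emeasure (distr lborel borel (\<lambda>x. R *v x)) S
      = (\<integral>\<^sup>+x. indicator S x \<partial>(distr lborel borel (\<lambda>x. R *v x)))"
    by simp
  also have "\<dots> = (\<integral>\<^sup>+x. indicator S (R *v x) \<partial>lborel)"
    by (subst nn_integral_distr) auto
  also have "\<dots> = ennreal (1/2) * emeasure lborel S"
    by (subst nn_integral_dilate) auto
  also have "\<dots> = emeasure (density lborel (\<lambda>_. ennreal (1/2))) S"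
    by (simp add: emeasure_density nn_integral_cmult_indicator)
  finally show "emeasure (distr lborel borel (\<lambda>x. R *v x)) S
      = emeasure (density lborel (\<lambda>_. ennreal (1/2))) S" .
qed simp

lemma integral_dilate:
  fixes F :: "real^'d \<Rightarrow> 'b::{banach, second_countable_topology}"
  assumes [measurable]: "F \<in> borel_measurable borel"
  shows "(LINT x|lborel. F (R *v x)) = (1/2) *\<^sub>R (LINT x|lborel. F x)"
    and "integrable lborel (\<lambda>x. F (R *v x)) \<longleftrightarrow> integrable lborel F"
proof -
  have "(LINT x|lborel. F (R *v x)) = (LINT x|distr lborel borel (\<lambda>x. R *v x). F x)"
    by (subst integral_distr) auto
  also have "\<dots> = (1/2) *\<^sub>R (LINT x|lborel. F x)"
    unfolding distr_dilate by (subst integral_density) auto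
  finally show "(LINT x|lborel. F (R *v x)) = (1/2) *\<^sub>R (LINT x|lborel. F x)" .
  have "integrable lborel (\<lambda>x. F (R *v x)) \<longleftrightarrow> integrable (distr lborel borel (\<lambda>x. R *v x)) F"
    by (subst integrable_distr_eq) auto
  also have "\<dots> \<longleftrightarrow> integrable lborel F"
    unfolding distr_dilate
    using integrable_scaleR_right[of 2 lborel "\<lambda>x. (1/2) *\<^sub>R F x"]
    by (subst integrable_density) auto
  finally show "integrable lborel (\<lambda>x. F (R *v x)) \<longleftrightarrow> integrable lborel F" .
qed

lemma integral_dilate_inv:
  fixes F :: "real^'d \<Rightarrow> 'b::{banach, second_countable_topology}"
  assumes [measurable]: "F \<in> borel_measurable borel"
  shows "(LINT x|lborel. F (Ri *v x)) = 2 *\<^sub>R (LINT x|lborel. F x)"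
    and "integrable lborel (\<lambda>x. F (Ri *v x)) \<longleftrightarrow> integrable lborel F"
  using integral_dilate[of "\<lambda>x. F (Ri *v x)"] by (simp_all add: field_simps)

end

section \<open>Annihilating polynomials and geometric decay of matrix iterates\<close>

text \<open>This is p(M) v. It is built from iterates on one vector because a polynomial killing
  that single vector is enough, and the iterates are what the decay estimate bounds.\<close>

definition poly_apply :: "complex^'d^'d \<Rightarrow> complex poly \<Rightarrow> complex^'d \<Rightarrow> complex^'d" where
  "poly_apply M p v = (\<Sum>i\<le>degree p. coeff p i *s (((*v) M) ^^ i) v)"

lemma poly_apply_eq:
  assumes "degree p \<le> n"
  shows "poly_apply M p v = (\<Sum>i\<le>n. coeff p i *s (((*v) M) ^^ i) v)"
  unfolding poly_apply_def using assms
  by (intro sum.mono_neutral_left) (auto simp: coeff_eq_0)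

lemma poly_apply_add: "poly_apply M (p + q) v = poly_apply M p v + poly_apply M q v"
proof -
  let ?n = "max (degree p) (degree q)"
  show ?thesis
    by (subst (1 2 3) poly_apply_eq[where n = ?n])
       (auto simp: degree_add_le vec.scale_left_distrib sum.distrib)
qed

lemma poly_apply_smult: "poly_apply M (smult c p) v = c *s poly_apply M p v"
  by (subst (1 2) poly_apply_eq[where n = "degree p"])
     (auto simp: degree_smult_le vec.scale_sum_right)

lemma poly_apply_pCons_0: "poly_apply M (pCons 0 p) v = poly_apply M p (M *v v)"
proof -
  have "poly_apply M (pCons 0 p) v = (\<Sum>i\<le>Suc (degree p). coeff (pCons 0 p) i *s (((*v) M) ^^ i) v)"
    by (rule poly_apply_eq) (simp add: degree_pCons_le)
  also have "\<dots> = (\<Sum>i\<le>degree p. coeff p i *s (((*v) M) ^^ Suc i) v)"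
    by (subst sum.atMost_Suc_shift) simp
  finally show ?thesis
    by (simp add: poly_apply_def funpow_swap1 del: funpow.simps(2)) (simp add: funpow_swap1)
qed

lemma funpow_matrix_add: "(((*v) M) ^^ i) (v + w) = (((*v) M) ^^ i) v + (((*v) M) ^^ i) w"
  for M :: "'a::field^'d^'d"
  by (induction i) (auto simp: matrix_vector_right_distrib)

lemma funpow_matrix_diff: "(((*v) M) ^^ i) (v - w) = (((*v) M) ^^ i) v - (((*v) M) ^^ i) w"
  for M :: "'a::field^'d^'d"
  by (induction i) (auto simp: matrix_vector_mult_diff_distrib)

lemma funpow_matrix_scale: "(((*v) M) ^^ i) (c *s v) = c *s (((*v) M) ^^ i) v"
  for M :: "'a::field^'d^'d"
  by (induction i) (auto simp: vector_scalar_commute)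

lemma poly_apply_diff_vec: "poly_apply M p (v - w) = poly_apply M p v - poly_apply M p w"
  by (simp add: poly_apply_def funpow_matrix_diff vec.scale_right_diff_distrib sum_subtractf)

lemma poly_apply_scale_vec: "poly_apply M p (c *s v) = c *s poly_apply M p v"
  unfolding poly_apply_def funpow_matrix_scale vec.scale_sum_right
  by (intro sum.cong refl) (simp add: mult.commute)

lemma matrix_vector_mult_sum:
  fixes M :: "'a::field^'n^'m"
  shows "M *v (\<Sum>i\<in>I. f i) = (\<Sum>i\<in>I. M *v f i)"
  by (induction I rule: infinite_finite_induct) (auto simp: matrix_vector_right_distrib)

lemma poly_apply_mult_vec: "poly_apply M p (M *v v) = M *v poly_apply M p v"
  by (simp add: poly_apply_def funpow_swap1[symmetric] matrix_vector_mult_sum vector_scalar_commute)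

text \<open>Shifts a root onto the vector, which lowers the degree in the induction of
  \<open>poly_apply_zero_imp_decay\<close>.\<close>

lemma poly_apply_linear_factor:
  "poly_apply M ([:- c, 1:] * q) v = poly_apply M q (M *v v - c *s v)"
proof -
  have "[:- c, 1:] * q = smult (- c) q + pCons 0 q" by simp
  then show ?thesis
    by (simp only: poly_apply_add poly_apply_smult poly_apply_pCons_0 poly_apply_diff_vec
      poly_apply_scale_vec) simp
qed

text \<open>The d + 1 vectors v, M v, ..., M^d v live in dimension d; a linear relation between them
  is a polynomial.\<close>

lemma ex_annihilating_poly:
  fixes M :: "complex^'d^'d"
  shows "\<exists>p. p \<noteq> 0 \<and> poly_apply M p v = 0"
proof -
  define n where "n = CARD('d)"
  define f where "f i = (((*v) M) ^^ i) v" for i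
  have mk: "\<exists>p. p \<noteq> 0 \<and> poly_apply M p v = 0"
    if "(\<Sum>i\<le>n. a i *s f i) = 0" "i0 \<le> n" "a i0 \<noteq> 0" for a i0
  proof (intro exI conjI)
    let ?p = "\<Sum>i\<le>n. monom (a i) i"
    have co: "coeff ?p i = (if i \<le> n then a i else 0)" for i
      by (simp add: coeff_sum)
    show "?p \<noteq> 0" using co[of i0] that by auto
    have "degree ?p \<le> n" by (intro degree_le) (auto simp: co)
    then show "poly_apply M ?p v = 0"
      using that(1) by (subst poly_apply_eq) (auto simp: co f_def)
  qed
  show ?thesis
  proof (cases "inj_on f {..n}")
    case True
    have "vec.dim (f ` {..n}) \<le> n" "card (f ` {..n}) = Suc n"
      using vec.dim_subset_UNIV[of "f ` {..n}"] True
      by (simp_all add: n_def vec.dimension_def card_cart_basis card_image)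
    then have "vec.dependent (f ` {..n})"
      by (intro vec.dependent_biggerset_general) simp
    then obtain u w where u: "w \<in> f ` {..n}" "u w \<noteq> 0" "(\<Sum>w\<in>f ` {..n}. u w *s w) = 0"
      by (auto simp: vec.dependent_finite)
    from u(3) have "(\<Sum>i\<le>n. u (f i) *s f i) = 0"
      by (simp add: sum.reindex[OF True])
    with u(1,2) mk[of "\<lambda>i. u (f i)"] show ?thesis by blast
  next
    \<comment> \<open>A repeated iterate makes the set of iterates too small for the dimension
      count; the relation \<open>f i = f j\<close> is then used directly.\<close>
    case False
    then obtain i j where ij: "i \<le> n" "j \<le> n" "i \<noteq> j" "f i = f j"
      by (auto simp: inj_on_def)
    have "(\<Sum>k\<le>n. (if k = i then 1 else if k = j then -1 else 0) *s f k)
        = (\<Sum>k\<le>n. (if k = i then f i else 0) - (if k = j then f j else 0))"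
      using ij by (intro sum.cong) auto
    also have "\<dots> = 0" using ij by (simp add: sum_subtractf)
    finally show ?thesis
      by (rule mk[OF _ ij(1)]) simp
  qed
qed

text \<open>Induction on the degree of an annihilating polynomial of \<open>v\<close>: a factor whose root is not an
  eigenvalue can be cancelled, and a root \<open>c\<close> with \<open>cmod c < 1\<close> gives the recursion
  \<open>M ^ Suc j v = c M ^ j v + M ^ j (M v - c v)\<close>.\<close>

lemma poly_apply_zero_imp_decay:
  fixes M :: "complex^'d^'d"
  assumes ev: "\<And>c v. v \<noteq> 0 \<Longrightarrow> M *v v = c *s v \<Longrightarrow> cmod c < 1"
  assumes "p \<noteq> 0" "poly_apply M p v = 0"
  shows "\<exists>C r. 0 < r \<and> r < 1 \<and> (\<forall>j. norm ((((*v) M) ^^ j) v) \<le> C * r ^ j)"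
  using assms(2,3)
proof (induction "degree p" arbitrary: p v)
  case 0
  then obtain a where "p = [:a:]" "a \<noteq> 0"
    by (metis degree_eq_zeroE pCons_0_0)
  with 0 have "v = 0" by (simp add: poly_apply_def)
  then have "(((*v) M) ^^ j) v = 0" for j by (induction j) auto
  then show ?case by (intro exI[of _ 0] exI[of _ "1/2"]) auto
next
  case (Suc n)
  have "\<not> constant (poly p)"
    using Suc.hyps(2) by (simp add: constant_degree)
  then obtain c where "poly p c = 0"
    using fundamental_theorem_of_algebra by blast
  then obtain q where q: "p = [:- c, 1:] * q"
    by (metis poly_eq_0_iff_dvd dvdE)
  with Suc.prems have "q \<noteq> 0" by auto
  then have dq: "n = degree q" using Suc.hyps(2) degree_mult_eq[of "[:- c, 1:]" q] unfolding q by simp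
  define w where "w = M *v v - c *s v"
  have qw: "poly_apply M q w = 0"
    using Suc.prems(2) unfolding q poly_apply_linear_factor w_def .
  show ?case
  proof (cases "cmod c < 1")
    case False
    \<comment> \<open>The vector q(M) v is zero or an eigenvector for \<open>c\<close>, and the
      modulus of \<open>c\<close> excludes the latter.\<close>
    have "M *v poly_apply M q v = c *s poly_apply M q v"
      using qw by (simp add: w_def poly_apply_diff_vec poly_apply_scale_vec poly_apply_mult_vec)
    with ev False have "poly_apply M q v = 0" by blast
    from Suc.hyps(1)[OF dq \<open>q \<noteq> 0\<close> this] show ?thesis .
  next
    case True
    from Suc.hyps(1)[OF dq \<open>q \<noteq> 0\<close> qw] obtain C r where
      r: "0 < r" "r < 1" and Cr: "\<And>j. norm ((((*v) M) ^^ j) w) \<le> C * r ^ j" by blast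
    have C: "0 \<le> C" using Cr[of 0] by (auto intro: order_trans[OF norm_ge_zero])
    \<comment> \<open>The rate \<open>s\<close> lies strictly between \<open>cmod c\<close> and 1
      and is at least \<open>r\<close>. \<open>D\<close> is large enough for the start
      \<open>j = 0\<close> and for \<open>cmod c * D + C\<close> to be at most \<open>s * D\<close>,
      which closes the recursion.\<close>
    define s where "s = (max r (cmod c) + 1) / 2"
    define D where "D = norm v + C / (s - cmod c)"
    have s: "0 < s" "s < 1" "r \<le> s" "cmod c < s"
      using r True by (auto simp: s_def max_def)
    have "norm ((((*v) M) ^^ j) v) \<le> D * s ^ j" for j
    proof (induction j)
      case 0
      then show ?case using C s by (simp add: D_def)
    next
      case (Suc j)
      have "(((*v) M) ^^ Suc j) v = (((*v) M) ^^ j) (c *s v + w)"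
        by (simp add: w_def funpow_swap1)
      then have "norm ((((*v) M) ^^ Suc j) v) \<le> norm (c *s (((*v) M) ^^ j) v) + norm ((((*v) M) ^^ j) w)"
        by (simp only: funpow_matrix_add funpow_matrix_scale norm_triangle_ineq)
      also have "\<dots> \<le> cmod c * (D * s ^ j) + C * s ^ j"
      proof (intro add_mono)
        have "norm (c *s (((*v) M) ^^ j) v) = cmod c * norm ((((*v) M) ^^ j) v)"
          by (simp add: norm_vec_def L2_set_def norm_mult power_mult_distrib
              sum_distrib_left[symmetric] real_sqrt_mult)
        then show "norm (c *s (((*v) M) ^^ j) v) \<le> cmod c * (D * s ^ j)"
          using Suc by (simp add: mult_left_mono)
        show "norm ((((*v) M) ^^ j) w) \<le> C * s ^ j"
          using Cr[of j] power_mono[OF s(3), of j] r C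
          by (meson mult_left_mono order_trans less_imp_le)
      qed
      also have "\<dots> = (cmod c * D + C) * s ^ j" by (simp add: algebra_simps)
      also have "\<dots> \<le> (s * D) * s ^ j"
      proof (intro mult_right_mono)
        have "(s - cmod c) * D = (s - cmod c) * norm v + C"
          using s by (simp add: D_def field_simps)
        moreover have "0 \<le> (s - cmod c) * norm v" using s by simp
        ultimately show "cmod c * D + C \<le> s * D" by (simp add: algebra_simps)
      qed (use s in auto)
      finally show ?case by (simp add: mult_ac)
    qed
    with s show ?thesis by blast
  qed
qed

context dilation_lattice
begin

text \<open>Eigenvalues of the inverse of \<open>cmat A\<close> are reciprocals of eigenvalues of
  \<open>cmat A\<close>, hence of modulus below 1. The norm-preserving embedding \<open>cv\<close>
  carries the complex decay back to real vectors.\<close>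

lemma Ri_decay_pointwise:
  "\<exists>C r. 0 < r \<and> r < 1 \<and> (\<forall>j. norm ((((*v) Ri) ^^ j) x) \<le> C * r ^ j)"
proof -
  let ?M = "matrix_inv (cmat A)"
  define cv where "cv x = (\<chi> i. complex_of_real (x$i))" for x :: "real^'d"
  have M: "cmat A *v (?M *v v) = v" "?M *v (cmat A *v v) = v" for v
    using matrix_inv_mult_vec[OF invertible_cmat] by auto
  have ev: "cmod c < 1" if v: "v \<noteq> 0" "?M *v v = c *s v" for c v
  proof -
    have "v = c *s (cmat A *v v)"
      using M(1)[of v] v(2) by (simp add: vector_scalar_commute)
    moreover from this have "c \<noteq> 0" using v(1) by auto
    ultimately have "cmat A *v v = (1/c) *s v"
      by (metis divide_inverse mult.left_neutral mult.commute right_inverse vector_smult_assoc vector_smult_lid)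
    then have "1 < cmod (1/c)" using expA v(1) unfolding expansive_def by blast
    then show ?thesis using \<open>c \<noteq> 0\<close> by (simp add: norm_divide field_simps)
  qed
  have it: "(((*v) ?M) ^^ j) (cv x) = cv ((((*v) Ri) ^^ j) x)" for j
  proof (induction j)
    case (Suc j)
    have "?M *v cv y = cv (Ri *v y)" for y
      using M(2)[of "cv (Ri *v y)"] cmat_of_real[of "Ri *v y"] by (simp add: cv_def)
    with Suc show ?case by simp
  qed simp
  have nrm: "norm (cv y) = norm y" for y
    by (simp add: cv_def norm_vec_def L2_set_def)
  obtain p where "p \<noteq> 0" "poly_apply ?M p (cv x) = 0"
    using ex_annihilating_poly by blast
  from poly_apply_zero_imp_decay[OF ev this] show ?thesis
    by (simp add: it nrm)
qed

text \<open>By linearity the pointwise bounds on the unit vectors suffice: the largest of their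
  rates serves for all, and their constants add up.\<close>

lemma Ri_decay:
  obtains C r where "0 \<le> C" "0 < r" "r < 1" "\<And>j x. norm ((((*v) Ri) ^^ j) x) \<le> C * r ^ j * norm x"
proof -
  from Ri_decay_pointwise obtain C r where Cr: "\<And>x. 0 < r x" "\<And>x. r x < 1"
    "\<And>x j. norm ((((*v) Ri) ^^ j) x) \<le> C x * r x ^ j"
    by metis
  define s where "s = Max (range (\<lambda>i. r (axis i 1)))"
  define D where "D = (\<Sum>i\<in>UNIV. C (axis i 1))"
  have s: "0 < s" "s < 1" "\<And>i. r (axis i 1) \<le> s"
    using Cr by (auto simp: s_def Max_gr_iff)
  have Cn: "0 \<le> C x" for x using Cr(3)[of 0 x] by (auto intro: order_trans[OF norm_ge_zero])
  have lin: "linear (((*v) Ri) ^^ j)" for j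
  proof (induction j)
    case (Suc j)
    then show ?case using linear_compose[OF Suc matrix_vector_mul_linear] by (simp add: o_def)
  qed (simp add: linear_id[unfolded id_def] id_def)
  have "norm ((((*v) Ri) ^^ j) x) \<le> D * s ^ j * norm x" for j x
  proof -
    have "(((*v) Ri) ^^ j) x = (((*v) Ri) ^^ j) (\<Sum>i\<in>UNIV. x$i *\<^sub>R axis i 1)"
      using basis_expansion[of x] by (simp add: scalar_mult_eq_scaleR)
    also have "\<dots> = (\<Sum>i\<in>UNIV. x$i *\<^sub>R (((*v) Ri) ^^ j) (axis i 1))"
      by (simp add: linear_sum[OF lin] linear_scale[OF lin])
    also have "norm \<dots> \<le> (\<Sum>i\<in>UNIV. norm x * (C (axis i 1) * s ^ j))"
    proof (rule sum_norm_le)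
      fix i
      have "norm ((((*v) Ri) ^^ j) (axis i 1)) \<le> C (axis i 1) * s ^ j"
        using Cr(3)[of j "axis i 1"] power_mono[OF s(3)[of i] less_imp_le[OF Cr(1)], of j] Cn
        by (meson mult_left_mono order_trans)
      then show "norm (x$i *\<^sub>R (((*v) Ri) ^^ j) (axis i 1)) \<le> norm x * (C (axis i 1) * s ^ j)"
        using component_le_norm_cart[of x i] by (simp add: mult_mono)
    qed
    also have "\<dots> = D * s ^ j * norm x"
      by (simp add: D_def sum_distrib_left sum_distrib_right mult_ac)
    finally show ?thesis .
  qed
  moreover have "0 \<le> D" using Cn by (simp add: D_def sum_nonneg)
  ultimately show ?thesis using that s by blast
qed

lemma inner_transpose_inv: "(matrix_inv (transpose R) *v x) \<bullet> y = x \<bullet> (Ri *v y)"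
proof -
  have inv: "invertible (transpose R)"
    using invertible_R by (rule transpose_invertible)
  have "(matrix_inv (transpose R) *v x) \<bullet> y = (matrix_inv (transpose R) *v x) \<bullet> (R *v (Ri *v y))"
    by simp
  also have "\<dots> = (transpose R *v (matrix_inv (transpose R) *v x)) \<bullet> (Ri *v y)"
    by (simp only: dot_lmul_matrix transpose_matrix_vector)
  also have "\<dots> = x \<bullet> (Ri *v y)"
    using matrix_inv_mult_vec(2)[OF inv] by simp
  finally show ?thesis .
qed

lemma inner_funpow_transpose_inv:
  "((((*v) (matrix_inv (transpose R))) ^^ j) x) \<bullet> y = x \<bullet> ((((*v) Ri) ^^ j) y)"
proof (induction j arbitrary: y)
  case (Suc j)
  have "(((*v) Ri) ^^ Suc j) y = (((*v) Ri) ^^ j) (Ri *v y)" by (simp add: funpow_swap1)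
  with Suc show ?case by (simp add: inner_transpose_inv)
qed simp

text \<open>An adjoint obeys the same bound: the square of the norm of \<open>?z\<close> is the
  inner product of \<open>x\<close> with the \<open>j\<close>-th iterate of \<open>Ri\<close> at
  \<open>?z\<close>.\<close>

lemma transpose_inv_decay:
  obtains C r where "0 \<le> C" "0 < r" "r < 1"
    "\<And>j x. norm ((((*v) (matrix_inv (transpose R))) ^^ j) x) \<le> C * r ^ j * norm x"
proof -
  obtain C r where C: "0 \<le> C" "0 < r" "r < 1"
    "\<And>j x. norm ((((*v) Ri) ^^ j) x) \<le> C * r ^ j * norm x" using Ri_decay by blast
  have "norm ((((*v) (matrix_inv (transpose R))) ^^ j) x) \<le> C * r ^ j * norm x" for j x
  proof -
    let ?z = "(((*v) (matrix_inv (transpose R))) ^^ j) x"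
    have "norm ?z * norm ?z = ?z \<bullet> ?z" by (simp add: dot_square_norm power2_eq_square)
    also have "\<dots> = x \<bullet> ((((*v) Ri) ^^ j) ?z)" by (rule inner_funpow_transpose_inv)
    also have "\<dots> \<le> norm x * norm ((((*v) Ri) ^^ j) ?z)" by (rule norm_cauchy_schwarz)
    also have "\<dots> \<le> norm x * (C * r ^ j * norm ?z)" by (intro mult_left_mono C) auto
    finally have "norm ?z * norm ?z \<le> (C * r ^ j * norm x) * norm ?z" by (simp add: mult_ac)
    moreover have "0 \<le> C * r ^ j * norm x" using C by simp
    ultimately show ?thesis
      by (cases "norm ?z = 0") (auto dest: mult_right_le_imp_le)
  qed
  with that C show ?thesis by blast
qed

end

subsection \<open>Density of continuous functions and Gaussians\<close>

lemma sq_int_bounded_support: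
  fixes f :: "real^'d \<Rightarrow> complex"
  assumes "f \<in> borel_measurable borel" "\<And>x. cmod (f x) \<le> B" "\<And>x. \<rho> < norm x \<Longrightarrow> f x = 0"
  shows "sq_int f" "integrable lborel f"
proof -
  have fin: "emeasure lborel (cball (0::real^'d) \<rho>) < \<infinity>"
    by (rule emeasure_lborel_cball_finite)
  show "sq_int f"
  proof (rule sq_int_bound[where g="\<lambda>t. B\<^sup>2 * indicator (cball 0 \<rho>) t"])
    show "integrable lborel (\<lambda>t. B\<^sup>2 * indicator (cball (0::real^'d) \<rho>) t :: real)"
      using fin by (intro integrable_mult_right integrable_real_indicator) auto
    fix t show "(cmod (f t))\<^sup>2 \<le> B\<^sup>2 * indicator (cball 0 \<rho>) t"
      using assms(2,3)[of t] by (cases "norm t \<le> \<rho>") (auto intro: power_mono)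
  qed fact
  show "integrable lborel f"
  proof (rule Bochner_Integration.integrable_bound)
    show "integrable lborel (\<lambda>t. B * indicator (cball (0::real^'d) \<rho>) t :: real)"
      using fin by (intro integrable_mult_right integrable_real_indicator) auto
    show "f \<in> borel_measurable lborel" using assms(1) by simp
    show "AE x in lborel. norm (f x) \<le> norm (B * indicator (cball 0 \<rho>) x)"
    proof (rule AE_I2)
      fix x show "norm (f x) \<le> norm (B * indicator (cball 0 \<rho>) x)"
        using assms(2,3)[of x] by (cases "norm x \<le> \<rho>") auto
    qed
  qed
qed

lemma L2_truncation:
  fixes f :: "real^'d \<Rightarrow> complex"
  assumes f: "sq_int f"
  shows "(\<lambda>M. L2_norm (\<lambda>x. (if cmod (f x) \<le> real M \<and> norm x \<le> real M then f x else 0) - f x)) \<longlonglongrightarrow> 0"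
proof -
  let ?T = "\<lambda>M x. (if cmod (f x) \<le> real M \<and> norm x \<le> real M then f x else 0)"
  note [measurable] = sq_int_measurable[OF f]
  have "(\<lambda>M. LINT x|lborel. (cmod (?T M x - f x))\<^sup>2)
      \<longlonglongrightarrow> (LINT x|(lborel :: (real^'d) measure). (0::real))"
  proof (rule integral_dominated_convergence)
    show "integrable lborel (\<lambda>x. (cmod (f x))\<^sup>2)" by (rule sq_int_integrable_norm2[OF f])
    show "AE x in lborel. (\<lambda>M. (cmod (?T M x - f x))\<^sup>2) \<longlonglongrightarrow> 0"
    proof (intro AE_I2 tendsto_eventually)
      fix x
      obtain M0 :: nat where "max (cmod (f x)) (norm x) \<le> real M0" using real_arch_simple by blast
      then show "\<forall>\<^sub>F M in sequentially. (cmod (?T M x - f x))\<^sup>2 = 0"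
        by (intro eventually_sequentiallyI[of M0]) auto
    qed
  qed auto
  then have "(\<lambda>M. sqrt (LINT x|lborel. (cmod (?T M x - f x))\<^sup>2))
      \<longlonglongrightarrow> sqrt (LINT x|(lborel :: (real^'d) measure). (0::real))"
    by (intro tendsto_real_sqrt)
  then show ?thesis by (simp add: L2_norm_def)
qed

text \<open>A measurable function is almost everywhere a limit of continuous ones. Clamping their
  values and cutting them off supplies a dominating function, which turns this into L2
  convergence.\<close>

lemma L2_bounded_approx_continuous:
  fixes f :: "real^'d \<Rightarrow> complex"
  assumes [measurable]: "f \<in> borel_measurable borel" and "0 \<le> M"
    and bd: "\<And>x. cmod (f x) \<le> M" and supp: "\<And>x. M < norm x \<Longrightarrow> f x = 0"
    and "0 < e"
  obtains g where "continuous_on UNIV g" "\<And>x. M + 1 < norm x \<Longrightarrow> g x = 0"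
    "L2_norm (\<lambda>x. g x - f x) < e"
proof -
  have "f \<in> borel_measurable lebesgue"
    by (rule measurable_completion) simp
  then have "f measurable_on UNIV"
    by (rule lebesgue_measurable_imp_measurable_on) simp
  then obtain N g where N: "negligible N" and g: "\<And>n. continuous_on UNIV (g n)"
    and lim: "\<And>x. x \<notin> N \<Longrightarrow> (\<lambda>n. g n x) \<longlonglongrightarrow> f x"
    unfolding measurable_on_def by auto
  \<comment> \<open>\<open>cl\<close> retracts the plane onto the disc of radius \<open>M\<close>
    and fixes the disc; \<open>cut\<close> is 1 up to radius \<open>M\<close> and 0 from
    \<open>M + 1\<close> on. Neither changes \<open>f\<close>.\<close>
  define cl where "cl = closest_point (cball (0::complex) M)"
  define cut where "cut x = max 0 (min 1 (M + 1 - norm x))" for x :: "real^'d"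
  define G where "G n x = of_real (cut x) * cl (g n x)" for n x
  have cl_cont: "continuous_on UNIV cl"
    unfolding cl_def using \<open>0 \<le> M\<close> by (intro continuous_on_closest_point) auto
  have cl_bd: "cmod (cl z) \<le> M" for z
    using closest_point_in_set[of "cball (0::complex) M" z] \<open>0 \<le> M\<close> by (auto simp: cl_def)
  have cl_self: "cl z = z" if "cmod z \<le> M" for z
    unfolding cl_def by (rule closest_point_self) (use that in auto)
  have cut_cont: "continuous_on UNIV cut"
    unfolding cut_def by (intro continuous_intros)
  have G_cont: "continuous_on UNIV (G n)" for n
    unfolding G_def
    by (intro continuous_intros cut_cont continuous_on_compose2[OF cl_cont g]) auto
  have [measurable]: "G n \<in> borel_measurable borel" for n
    by (rule borel_measurable_continuous_onI[OF G_cont])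
  have cut01: "0 \<le> cut x" "cut x \<le> 1" for x by (auto simp: cut_def)
  have G_bd: "cmod (G n x) \<le> M" for n x
    using mult_mono[OF cut01(2)[of x] cl_bd[of "g n x"]] cut01[of x] by (simp add: G_def norm_mult)
  have G_supp: "G n x = 0" if "M + 1 < norm x" for n x
    using that by (simp add: G_def cut_def)
  have "(\<lambda>n. LINT x|lborel. (cmod (G n x - f x))\<^sup>2) \<longlonglongrightarrow> (LINT x|(lborel :: (real^'d) measure). (0::real))"
  proof (rule integral_dominated_convergence)
    show "integrable lborel (\<lambda>t. (2*M)\<^sup>2 * indicator (cball (0::real^'d) (M+1)) t :: real)"
      using emeasure_lborel_cball_finite[of "0::real^'d" "M + 1"]
      by (intro integrable_mult_right integrable_real_indicator) auto
    have "AE x in lebesgue. x \<notin> N"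
      using N by (intro AE_not_in) (simp add: negligible_iff_null_sets)
    then have "AE x in lborel. x \<notin> N" by (simp add: AE_completion_iff)
    then show "AE x in lborel. (\<lambda>n. (cmod (G n x - f x))\<^sup>2) \<longlonglongrightarrow> 0"
    proof eventually_elim
      case (elim x)
      have "isCont cl (f x)" using cl_cont by (simp add: continuous_on_eq_continuous_at)
      then have "(\<lambda>n. cl (g n x)) \<longlonglongrightarrow> cl (f x)"
        using isCont_tendsto_compose lim[OF elim] by blast
      then have "(\<lambda>n. (cmod (G n x - f x))\<^sup>2) \<longlonglongrightarrow> (cmod (of_real (cut x) * cl (f x) - f x))\<^sup>2"
        unfolding G_def by (intro tendsto_intros)
      moreover have "of_real (cut x) * cl (f x) = f x"
        using bd[of x] supp[of x] by (cases "norm x \<le> M") (auto simp: cl_self cut_def)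
      ultimately show ?case by simp
    qed
    fix n
    show "AE x in lborel. norm ((cmod (G n x - f x))\<^sup>2) \<le> (2*M)\<^sup>2 * indicator (cball 0 (M+1)) x"
    proof (rule AE_I2)
      fix x
      have "cmod (G n x - f x) \<le> 2 * M"
        using norm_triangle_ineq4[of "G n x" "f x"] G_bd[of n x] bd[of x] by linarith
      then have "(cmod (G n x - f x))\<^sup>2 \<le> (2*M)\<^sup>2" by (intro power_mono) auto
      then show "norm ((cmod (G n x - f x))\<^sup>2) \<le> (2*M)\<^sup>2 * indicator (cball 0 (M+1)) x"
        using G_supp[of x n] supp[of x] by (cases "norm x \<le> M + 1") auto
    qed
  qed auto
  then have "(\<lambda>n. L2_norm (\<lambda>x. G n x - f x)) \<longlonglongrightarrow> sqrt 0"
    unfolding L2_norm_def by (intro tendsto_real_sqrt) simp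
  then have "\<forall>\<^sub>F n in sequentially. L2_norm (\<lambda>x. G n x - f x) < e"
    using \<open>0 < e\<close> by (intro order_tendstoD) simp_all
  then obtain n where "L2_norm (\<lambda>x. G n x - f x) < e"
    by (auto simp: eventually_sequentially)
  with that[of "G n"] G_cont G_supp show ?thesis by blast
qed

lemma continuous_compact_support_bounded:
  fixes g :: "'a::euclidean_space \<Rightarrow> 'b::real_normed_vector"
  assumes "continuous_on UNIV g" "\<And>x. \<rho> < norm x \<Longrightarrow> g x = 0"
  obtains B where "0 \<le> B" "\<And>x. norm (g x) \<le> B"
proof -
  have "bounded (g ` cball 0 \<rho>)"
    using assms(1) by (intro compact_imp_bounded compact_continuous_image) (auto intro: continuous_on_subset)
  then obtain B where B: "\<And>x. x \<in> cball 0 \<rho> \<Longrightarrow> norm (g x) \<le> B" unfolding bounded_iff by blast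
  have "norm (g x) \<le> max B 0" for x
    using B[of x] assms(2)[of x] by (cases "norm x \<le> \<rho>") auto
  with that[of "max B 0"] show ?thesis by simp
qed

lemma continuous_compact_support_sq_int:
  fixes g :: "real^'d \<Rightarrow> complex"
  assumes "continuous_on UNIV g" "\<And>x. \<rho> < norm x \<Longrightarrow> g x = 0"
  shows "sq_int g" "integrable lborel g"
proof -
  obtain B where "\<And>x. norm (g x) \<le> B"
    using continuous_compact_support_bounded[OF assms] by blast
  then show "sq_int g" "integrable lborel g"
    using sq_int_bounded_support[OF borel_measurable_continuous_onI[OF assms(1)] _ assms(2)] by blast+
qed

text \<open>Heine-Cantor on a ball one unit larger than the support ball. With \<delta> capped at 1,
  two close points lie both in the larger ball or both outside the support.\<close>

lemma continuous_compact_support_uniform: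
  fixes e :: "'a::euclidean_space \<Rightarrow> 'b::real_normed_vector"
  assumes cont: "continuous_on UNIV e" and supp: "\<And>x. \<rho> < norm x \<Longrightarrow> e x = 0" and "0 < \<omega>"
  obtains \<delta> where "0 < \<delta>" "\<And>x y. norm (x - y) < \<delta> \<Longrightarrow> norm (e x - e y) \<le> \<omega>"
proof -
  have "uniformly_continuous_on (cball 0 (\<rho> + 1)) e"
    by (rule compact_uniformly_continuous) (auto intro: continuous_on_subset[OF cont])
  then obtain \<delta> where \<delta>: "0 < \<delta>" "\<And>x y. x \<in> cball 0 (\<rho> + 1) \<Longrightarrow> y \<in> cball 0 (\<rho> + 1) \<Longrightarrow>
      dist y x < \<delta> \<Longrightarrow> dist (e y) (e x) < \<omega>"
    using \<open>0 < \<omega>\<close> unfolding uniformly_continuous_on_def by metis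
  have "norm (e x - e y) \<le> \<omega>" if "norm (x - y) < min \<delta> 1" for x y
  proof (cases "norm x \<le> \<rho> \<or> norm y \<le> \<rho>")
    case True
    then have "norm x \<le> \<rho> + 1" "norm y \<le> \<rho> + 1"
      using that norm_triangle_ineq3[of x y] by auto
    then have "x \<in> cball 0 (\<rho> + 1)" "y \<in> cball 0 (\<rho> + 1)" by (simp_all only: mem_cball_0)
    then have "dist (e x) (e y) < \<omega>" using that by (intro \<delta>(2)) (auto simp: dist_norm)
    then show ?thesis by (simp add: dist_norm)
  next
    case False
    then show ?thesis using supp[of x] supp[of y] \<open>0 < \<omega>\<close> by simp
  qed
  with that[of "min \<delta> 1"] \<delta>(1) show ?thesis by auto
qed

lemma L2_dense_continuous_compact_support:
  fixes f :: "real^'d \<Rightarrow> complex"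
  assumes f: "sq_int f" and "0 < e"
  obtains g \<rho> where "continuous_on UNIV g" "\<And>x. \<rho> < norm x \<Longrightarrow> g x = 0" "sq_int g"
    "L2_norm (\<lambda>x. f x - g x) < e"
proof -
  note [measurable] = sq_int_measurable[OF f]
  have "\<forall>\<^sub>F M in sequentially. L2_norm (\<lambda>x. (if cmod (f x) \<le> real M \<and> norm x \<le> real M then f x else 0) - f x) < e/2"
    by (rule order_tendstoD(2)[OF L2_truncation[OF f]]) (use \<open>0 < e\<close> in simp)
  then obtain M :: nat where M: "L2_norm (\<lambda>x. (if cmod (f x) \<le> real M \<and> norm x \<le> real M then f x else 0) - f x) < e/2"
    by (auto simp: eventually_sequentially)
  define fM where "fM x = (if cmod (f x) \<le> real M \<and> norm x \<le> real M then f x else 0)" for x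
  have [measurable]: "fM \<in> borel_measurable borel"
    unfolding fM_def by measurable
  have fM: "cmod (fM x) \<le> real M" "real M < norm x \<Longrightarrow> fM x = 0" for x
    by (auto simp: fM_def)
  obtain g where g: "continuous_on UNIV g" "\<And>x. real M + 1 < norm x \<Longrightarrow> g x = 0"
    "L2_norm (\<lambda>x. g x - fM x) < e/2"
    by (rule L2_bounded_approx_continuous[of fM "real M" "e/2"]) (use fM \<open>0 < e\<close> in auto)
  have sg: "sq_int g" using continuous_compact_support_sq_int[OF g(1,2)] by blast
  have sM: "sq_int fM" by (rule sq_int_bounded_support) (use fM in auto)
  have "L2_norm (\<lambda>x. (f x - fM x) + (fM x - g x)) \<le> L2_norm (\<lambda>x. f x - fM x) + L2_norm (\<lambda>x. fM x - g x)"
    by (intro L2_norm_triangle sq_int_diff f sM sg)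
  also have "\<dots> < e/2 + e/2"
    using M g(3) L2_norm_minus_commute[of f fM] L2_norm_minus_commute[of fM g]
    by (intro add_strict_mono) (simp_all add: fM_def)
  finally have "L2_norm (\<lambda>x. f x - g x) < e" by simp
  with that g sg show ?thesis by blast
qed

section \<open>Gaussian integrals in several variables\<close>

text \<open>Lebesgue measure on vectors is the image of a product measure indexed by
  \<open>Basis\<close>; \<open>k\<close> translates a basis vector into its coordinate
  index.\<close>

lemma integral_lborel_prod_vec:
  fixes f :: "'d::finite \<Rightarrow> real \<Rightarrow> 'b::{real_normed_field,banach,second_countable_topology}"
  assumes int: "\<And>i. integrable lborel (f i)"
  shows "integrable lborel (\<lambda>x::real^'d. \<Prod>i\<in>UNIV. f i (x$i))"
    and "(LINT x|lborel. (\<Prod>i\<in>UNIV. f i ((x::real^'d)$i))) = (\<Prod>i\<in>UNIV. LINT t|lborel. f i t)"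
proof -
  interpret product_sigma_finite "\<lambda>_::real^'d. lborel :: real measure" ..
  define k where "k b = (THE i. b = axis i (1::real))" for b :: "real^'d"
  have k: "k (axis i 1) = i" for i
    unfolding k_def by (rule the_equality) (auto simp: axis_eq_axis)
  have bas: "(Basis :: (real^'d) set) = range (\<lambda>i. axis i 1)"
    by (auto simp: Basis_vec_def)
  have inj: "inj (\<lambda>i. axis i (1::real) :: real^'d)"
    by (auto simp: inj_on_def axis_eq_axis)
  have [measurable]: "f i \<in> borel_measurable borel" for i
    using borel_measurable_integrable[OF int[of i]] by simp
  have reidx: "(\<Prod>i\<in>UNIV. f i (x$i)) = (\<Prod>b\<in>Basis. f (k b) (x \<bullet> b))" for x :: "real^'d"
    unfolding bas by (subst prod.reindex[OF inj]) (simp add: k inner_axis)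
  have coord: "((\<Sum>b\<in>Basis. y b *\<^sub>R b) :: real^'d) \<bullet> b' = y b'" if "b' \<in> Basis" for y b'
    using that by simp
  have [measurable]: "(\<lambda>y. \<Sum>b\<in>Basis. y b *\<^sub>R b) \<in> Pi\<^sub>M Basis (\<lambda>_. lborel) \<rightarrow>\<^sub>M (borel :: (real^'d) measure)"
    by measurable
  have meas [measurable]: "(\<lambda>x::real^'d. \<Prod>b\<in>Basis. f (k b) (x \<bullet> b)) \<in> borel_measurable borel"
    by measurable
  have cong: "(\<Prod>b\<in>Basis. f (k b) (((\<Sum>b\<in>Basis. y b *\<^sub>R b) :: real^'d) \<bullet> b))
      = (\<Prod>b\<in>Basis. f (k b) (y b))" for y
    by (intro prod.cong refl) (simp add: coord)
  have "integrable (Pi\<^sub>M Basis (\<lambda>_. lborel)) (\<lambda>y. \<Prod>b\<in>Basis. f (k b) (y b))"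
    by (rule product_integrable_prod) (auto simp: int)
  then show "integrable lborel (\<lambda>x::real^'d. \<Prod>i\<in>UNIV. f i (x$i))"
    unfolding reidx by (subst lborel_eq) (simp add: integrable_distr_eq cong)
  have "(LINT x|lborel. (\<Prod>i\<in>UNIV. f i ((x::real^'d)$i)))
      = (LINT y|Pi\<^sub>M Basis (\<lambda>_. lborel). (\<Prod>b\<in>Basis. f (k b) (y b)))"
    unfolding reidx by (subst lborel_eq) (simp add: integral_distr cong)
  also have "\<dots> = (\<Prod>b\<in>Basis. LINT t|lborel. f (k b) t)"
    by (rule product_integral_prod) (auto simp: int)
  also have "\<dots> = (\<Prod>i\<in>UNIV. LINT t|lborel. f i t)"
    unfolding bas by (subst prod.reindex[OF inj]) (simp add: k)
  finally show "(LINT x|lborel. (\<Prod>i\<in>UNIV. f i ((x::real^'d)$i))) = (\<Prod>i\<in>UNIV. LINT t|lborel. f i t)" .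
qed

lemma gaussian_integrable:
  assumes "0 < \<sigma>"
  shows "integrable lborel (\<lambda>s::real. exp (- (\<sigma>\<^sup>2 * s\<^sup>2 / 2)))"
proof -
  have "exp (- (\<sigma>\<^sup>2 * s\<^sup>2 / 2)) = (sqrt (2 * pi) / \<sigma>) * normal_density 0 (1/\<sigma>) s" for s
    using assms by (simp add: normal_density_def real_sqrt_mult real_sqrt_divide field_simps power2_eq_square)
  then show ?thesis
    using assms by (simp only:) (intro integrable_mult_right integrable_normal_density, simp)
qed

text \<open>The characteristic function of the standard normal distribution after the substitution x
  = \<sigma> s.\<close>

lemma gaussian_fourier:
  assumes "0 < \<sigma>"
  shows "(LINT s|lborel. cis (- (s * w)) * of_real (exp (- (\<sigma>\<^sup>2 * s\<^sup>2 / 2))))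
    = of_real (2 * pi * normal_density 0 \<sigma> w)"
proof -
  let ?I = "(LINT s|lborel. cis (- (s * w)) * of_real (exp (- (\<sigma>\<^sup>2 * s\<^sup>2 / 2))))"
  let ?F = "\<lambda>x. of_real (std_normal_density x) * cis (- (w/\<sigma>) * x)"
  have "complex_of_real (exp (- (w/\<sigma>)\<^sup>2 / 2)) = char std_normal_distribution (- (w/\<sigma>))"
    by (simp add: char_std_normal_distribution)
  also have "\<dots> = (LINT x|lborel. ?F x)"
    unfolding char_def by (subst integral_density) (auto simp: cis_conv_exp scaleR_conv_of_real)
  also have "\<dots> = \<bar>\<sigma>\<bar> *\<^sub>R (LINT s|lborel. ?F (0 + \<sigma> * s))"
    by (rule lborel_integral_real_affine) (use assms in simp)
  also have "(\<lambda>s. ?F (0 + \<sigma> * s)) = (\<lambda>s. of_real (1 / sqrt (2*pi)) * (cis (- (s * w)) * of_real (exp (- (\<sigma>\<^sup>2 * s\<^sup>2 / 2)))))"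
    using assms by (auto simp: std_normal_density_def power_mult_distrib mult_ac)
  finally have eq: "complex_of_real (exp (- (w/\<sigma>)\<^sup>2 / 2))
      = of_real (\<sigma> / sqrt (2*pi)) * ?I"
    using assms by (simp add: scaleR_conv_of_real)
  have "?I
     = of_real (sqrt (2*pi) / \<sigma>) * (of_real (\<sigma> / sqrt (2*pi)) * ?I)"
    using assms by (simp add: mult.assoc[symmetric] of_real_mult[symmetric] del: of_real_mult of_real_divide)
  also have "\<dots> = of_real (sqrt (2*pi) / \<sigma>) * of_real (exp (- (w/\<sigma>)\<^sup>2 / 2))"
    by (simp only: eq)
  also have "\<dots> = of_real (sqrt (2*pi) / \<sigma> * exp (- (w/\<sigma>)\<^sup>2 / 2))"
    by simp
  also have "sqrt (2*pi) / \<sigma> * exp (- (w/\<sigma>)\<^sup>2 / 2) = 2 * pi * normal_density 0 \<sigma> w"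
  proof -
    have "2 * pi / (sqrt (2*pi) * \<sigma>) = sqrt (2*pi) / \<sigma>"
      using real_div_sqrt[of "2 * pi"] by (simp add: divide_divide_eq_left[symmetric])
    moreover have "sqrt (2 * pi * \<sigma>\<^sup>2) = sqrt (2*pi) * \<sigma>" using assms by (simp add: real_sqrt_mult)
    moreover have "- (w/\<sigma>)\<^sup>2 / 2 = - (w - 0)\<^sup>2 / (2 * \<sigma>\<^sup>2)" by (simp add: power_divide)
    ultimately show ?thesis
      unfolding normal_density_def by (metis mult.assoc mult.right_neutral times_divide_eq_right)
  qed
  finally show ?thesis .
qed

text \<open>The weight is exp (-\<sigma>^2 |s|^2 / 2), and the kernel below is the centred normal
  density of standard deviation \<sigma> in each coordinate. Both are written as products so that
  \<open>integral_lborel_prod_vec\<close> applies.\<close>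

definition gauss_weight :: "real \<Rightarrow> real^'d \<Rightarrow> real" where
  "gauss_weight \<sigma> s = (\<Prod>i\<in>UNIV. exp (- (\<sigma>\<^sup>2 * (s$i)\<^sup>2 / 2)))"

definition gauss_kernel :: "real \<Rightarrow> real^'d \<Rightarrow> real" where
  "gauss_kernel \<sigma> x = (\<Prod>i\<in>UNIV. normal_density 0 \<sigma> (x$i))"

lemma borel_measurable_vec_component [measurable]: "(\<lambda>x::real^'d. x $ i) \<in> borel_measurable borel"
  by (intro borel_measurable_continuous_onI continuous_intros)

lemma gauss_weight_measurable [measurable]: "gauss_weight \<sigma> \<in> borel_measurable borel"
  unfolding gauss_weight_def by measurable

lemma gauss_kernel_measurable [measurable]: "gauss_kernel \<sigma> \<in> borel_measurable borel"
  unfolding gauss_kernel_def by measurable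

lemma gauss_weight_bounds: "0 \<le> gauss_weight \<sigma> s" "gauss_weight \<sigma> s \<le> 1"
  unfolding gauss_weight_def by (auto intro!: prod_nonneg prod_le_1)

lemma gauss_kernel_nonneg: "0 \<le> gauss_kernel \<sigma> x"
  unfolding gauss_kernel_def by (intro prod_nonneg) auto

lemma gauss_kernel_minus: "gauss_kernel \<sigma> (- x) = gauss_kernel \<sigma> x"
  by (simp add: gauss_kernel_def normal_density_def)

lemma gauss_weight_integrable: "0 < \<sigma> \<Longrightarrow> integrable lborel (gauss_weight \<sigma> :: real^'d \<Rightarrow> real)"
  unfolding gauss_weight_def by (intro integral_lborel_prod_vec gaussian_integrable)

lemma gauss_kernel_integrable: "0 < \<sigma> \<Longrightarrow> integrable lborel (gauss_kernel \<sigma> :: real^'d \<Rightarrow> real)"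
  unfolding gauss_kernel_def by (intro integral_lborel_prod_vec) auto

lemma gauss_kernel_integral:
  assumes "0 < \<sigma>"
  shows "(LINT x|lborel. gauss_kernel \<sigma> (x::real^'d)) = 1"
  unfolding gauss_kernel_def using assms
  by (subst integral_lborel_prod_vec) (auto simp: integral_normal_density)

text \<open>The one moment needed later: \<open>L2_modulus_le\<close> bounds the modulus of
  continuity by a constant plus a multiple of the squared norm.\<close>

lemma gauss_kernel_second_moment:
  assumes "0 < \<sigma>"
  shows "integrable lborel (\<lambda>x::real^'d. gauss_kernel \<sigma> x * (norm x)\<^sup>2)"
    and "(LINT x|lborel. gauss_kernel \<sigma> x * (norm (x::real^'d))\<^sup>2) = real CARD('d) * \<sigma>\<^sup>2"
proof -
  \<comment> \<open>Only factor \<open>i\<close> is changed, so each coordinate's share of the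
    squared norm, times the kernel, is again a product over coordinates.\<close>
  define f where "f i j t = (if j = i then normal_density 0 \<sigma> t * (t - 0) ^ (2 * 1) else normal_density 0 \<sigma> t)"
    for i j :: 'd and t
  have f: "integrable lborel (f i j)" for i j
    unfolding f_def using integrable_normal_moment[OF assms, of 0 "2 * 1"] integrable_normal_density[OF assms, of 0]
    by (cases "j = i") auto
  have fi: "(LINT t|lborel. f i j t) = (if j = i then \<sigma>\<^sup>2 else 1)" for i j
    unfolding f_def using integral_normal_moment_even[OF assms, of 0 1] assms
    by (cases "j = i") (auto simp: integral_normal_density)
  have eq: "gauss_kernel \<sigma> x * (norm x)\<^sup>2 = (\<Sum>i\<in>UNIV. \<Prod>j\<in>UNIV. f i j (x$j))" for x :: "real^'d"
  proof -
    have "(\<Prod>j\<in>UNIV. f i j (x$j)) = gauss_kernel \<sigma> x * (x$i)\<^sup>2" for i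
      unfolding gauss_kernel_def f_def
      by (subst (1 2) prod.remove[of _ i]) (auto intro!: prod.cong)
    then show ?thesis
      by (simp add: norm_vec_def L2_set_def sum_nonneg sum_distrib_left)
  qed
  show "integrable lborel (\<lambda>x::real^'d. gauss_kernel \<sigma> x * (norm x)\<^sup>2)"
    unfolding eq by (intro Bochner_Integration.integrable_sum integral_lborel_prod_vec f)
  have "(LINT x|lborel. gauss_kernel \<sigma> x * (norm (x::real^'d))\<^sup>2)
      = (\<Sum>i\<in>UNIV. \<Prod>j\<in>UNIV. LINT t|lborel. f (i::'d) j t)"
    unfolding eq
    by (subst Bochner_Integration.integral_sum) (auto intro!: sum.cong integral_lborel_prod_vec f)
  also have "\<dots> = real CARD('d) * \<sigma>\<^sup>2"
    by (simp add: fi prod.If_cases)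
  finally show "(LINT x|lborel. gauss_kernel \<sigma> x * (norm (x::real^'d))\<^sup>2) = real CARD('d) * \<sigma>\<^sup>2" .
qed

lemma cis_sum: "cis (\<Sum>i\<in>I. f i) = (\<Prod>i\<in>I. cis (f i))"
  by (induction I rule: infinite_finite_induct) (auto simp: cis_mult[symmetric])

lemma gauss_weight_fourier:
  fixes w :: "real^'d"
  assumes "0 < \<sigma>"
  shows "(LINT s|lborel. cis (- (s \<bullet> w)) * of_real (gauss_weight \<sigma> s))
    = of_real ((2 * pi) ^ CARD('d) * gauss_kernel \<sigma> w)"
proof -
  have int: "integrable lborel (\<lambda>s. cis (- (s * t)) * of_real (exp (- (\<sigma>\<^sup>2 * s\<^sup>2 / 2))))" for t :: real
    by (rule Bochner_Integration.integrable_bound[OF gaussian_integrable[OF assms]])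
       (auto simp: norm_mult cis_conv_exp)
  have "cis (- (s \<bullet> w)) * of_real (gauss_weight \<sigma> s)
      = (\<Prod>i\<in>UNIV. cis (- (s$i * w$i)) * of_real (exp (- (\<sigma>\<^sup>2 * (s$i)\<^sup>2 / 2))))" for s :: "real^'d"
    by (simp add: inner_vec_def gauss_weight_def prod.distrib cis_sum sum_negf[symmetric])
  then have "(LINT s|lborel. cis (- (s \<bullet> w)) * of_real (gauss_weight \<sigma> s))
      = (\<Prod>i\<in>UNIV. LINT t|lborel. cis (- (t * w$i)) * of_real (exp (- (\<sigma>\<^sup>2 * t\<^sup>2 / 2))))"
    using integral_lborel_prod_vec(2)[of "\<lambda>i t. cis (- (t * w$i)) * of_real (exp (- (\<sigma>\<^sup>2 * t\<^sup>2 / 2)))", OF int]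
    by simp
  also have "\<dots> = of_real ((2 * pi) ^ CARD('d) * gauss_kernel \<sigma> w)"
    by (simp only: gaussian_fourier[OF assms]) (simp add: gauss_kernel_def prod.distrib)
  finally show ?thesis .
qed

subsection \<open>Weak convergence from pointwise convergence of Fourier transforms\<close>

lemma borel_measurable_cis [measurable (raw)]:
  "f \<in> borel_measurable M \<Longrightarrow> (\<lambda>x. cis (f x)) \<in> borel_measurable M"
  by (rule borel_measurable_continuous_on[where f = cis]) (auto intro: continuous_intros)

lemma integrable_pair_bound:
  fixes F :: "'a::euclidean_space \<times> 'b::euclidean_space \<Rightarrow> complex"
  assumes F [measurable]: "F \<in> borel_measurable (lborel \<Otimes>\<^sub>M lborel)"
    and f: "integrable lborel (f :: 'a \<Rightarrow> real)" and g: "integrable lborel (g :: 'b \<Rightarrow> real)"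
    and bd: "\<And>x y. cmod (F (x, y)) \<le> f x * g y"
  shows "integrable (lborel \<Otimes>\<^sub>M lborel) F"
proof -
  have [measurable]: "f \<in> borel_measurable borel" "g \<in> borel_measurable borel"
    using borel_measurable_integrable[OF f] borel_measurable_integrable[OF g] by simp_all
  have "integrable (lborel \<Otimes>\<^sub>M lborel) (\<lambda>(x, y). f x * g y)"
  proof (rule lborel_pair.Fubini_integrable)
    show "integrable lborel (\<lambda>x. LINT y|lborel. norm (case (x, y) of (x, y) \<Rightarrow> f x * g y))"
      using f g by (simp add: abs_mult)
    show "AE x in lborel. integrable lborel (\<lambda>y. case (x, y) of (x, y) \<Rightarrow> f x * g y)"
      using g by simp
  qed measurable
  then show ?thesis
  proof (rule Bochner_Integration.integrable_bound)
    show "AE p in lborel \<Otimes>\<^sub>M lborel. norm (F p) \<le> norm (case p of (x, y) \<Rightarrow> f x * g y)"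
      using bd by (auto intro!: AE_I2 order_trans[OF bd abs_ge_self])
  qed measurable
qed

lemma fourier1_measurable [measurable]:
  fixes u :: "real^'d \<Rightarrow> complex"
  assumes [measurable]: "u \<in> borel_measurable borel"
  shows "fourier1 u \<in> borel_measurable borel"
  unfolding fourier1_def by measurable

lemma integrable_cis_mult:
  fixes u :: "'a::euclidean_space \<Rightarrow> complex"
  assumes u: "integrable lborel u" and [measurable]: "f \<in> borel_measurable borel"
  shows "integrable lborel (\<lambda>t. cis (f t) * u t)"
proof -
  have [measurable]: "u \<in> borel_measurable borel"
    using borel_measurable_integrable[OF u] by simp
  show ?thesis
    by (rule Bochner_Integration.integrable_bound[OF u]) (auto simp: norm_mult)
qed

lemma fourier1_bound:
  fixes u :: "real^'d \<Rightarrow> complex"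
  assumes "integrable lborel u"
  shows "cmod (fourier1 u s) \<le> (2*pi) powr (- real CARD('d) / 2) * (LINT t|lborel. cmod (u t))"
proof -
  have "cmod (LINT t|lborel. cis (- (s \<bullet> t)) * u t) \<le> (LINT t|lborel. cmod (cis (- (s \<bullet> t)) * u t))"
    by (rule integral_norm_bound)
  then show ?thesis by (simp add: fourier1_def norm_mult mult_left_mono)
qed

text \<open>Fubini for a symmetric kernel. It turns pairings with transforms into pairings of
  transforms, which is how pointwise limits of transforms become weak limits.\<close>

lemma fourier1_multiplication:
  fixes u v :: "real^'d \<Rightarrow> complex"
  assumes u: "integrable lborel u" and v: "integrable lborel v"
  shows "(LINT s|lborel. fourier1 u s * v s) = (LINT t|lborel. u t * fourier1 v t)"
proof -
  define c where "c = complex_of_real ((2*pi) powr (- real CARD('d) / 2))"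
  have [measurable]: "u \<in> borel_measurable borel" "v \<in> borel_measurable borel"
    using borel_measurable_integrable[OF u] borel_measurable_integrable[OF v] by simp_all
  have int: "integrable (lborel \<Otimes>\<^sub>M lborel) (\<lambda>(t, s). cis (- (s \<bullet> t)) * u t * v s)"
    by (rule integrable_pair_bound[OF _ integrable_norm[OF u] integrable_norm[OF v]])
       (auto simp: norm_mult)
  have "(LINT s|lborel. fourier1 u s * v s) = (LINT s|lborel. c * (LINT t|lborel. cis (- (s \<bullet> t)) * u t * v s))"
  proof (rule Bochner_Integration.integral_cong[OF refl])
    fix s
    show "fourier1 u s * v s = c * (LINT t|lborel. cis (- (s \<bullet> t)) * u t * v s)"
      unfolding fourier1_def c_def by (subst integral_mult_left_zero) (simp add: mult.assoc)
  qed
  also have "\<dots> = c * (LINT s|lborel. (LINT t|lborel. cis (- (s \<bullet> t)) * u t * v s))"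
    by (rule integral_mult_right_zero)
  also have "\<dots> = c * (LINT t|lborel. (LINT s|lborel. cis (- (s \<bullet> t)) * u t * v s))"
    by (subst lborel_pair.Fubini_integral[OF int]) simp
  also have "\<dots> = (LINT t|lborel. c * (LINT s|lborel. cis (- (s \<bullet> t)) * u t * v s))"
    by (rule integral_mult_right_zero[symmetric])
  also have "\<dots> = (LINT t|lborel. u t * fourier1 v t)"
  proof (rule Bochner_Integration.integral_cong[OF refl])
    fix t
    have "(LINT s|lborel. cis (- (s \<bullet> t)) * u t * v s) = u t * (LINT s|lborel. cis (- (t \<bullet> s)) * v s)"
      by (subst integral_mult_right_zero[symmetric]) (simp add: mult_ac inner_commute)
    then show "c * (LINT s|lborel. cis (- (s \<bullet> t)) * u t * v s) = u t * fourier1 v t"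
      by (simp add: fourier1_def c_def mult_ac)
  qed
  finally show ?thesis .
qed

section \<open>Gaussian mollification, square integrability of transforms, density\<close>

definition mollify :: "real \<Rightarrow> (real^'d \<Rightarrow> complex) \<Rightarrow> real^'d \<Rightarrow> complex" where
  "mollify \<sigma> e x = (LINT y|lborel. e y * of_real (gauss_kernel \<sigma> (x - y)))"

lemma mollify_measurable [measurable]:
  assumes [measurable]: "e \<in> borel_measurable borel"
  shows "mollify \<sigma> e \<in> borel_measurable borel"
  unfolding mollify_def by measurable

text \<open>Conjugating the transform of the conjugate gives the inverse transform of
  \<open>e\<close>. The Gaussian weight makes it integrable, and Fubini turns the weight into the
  kernel when transforming back. Mollifications are thus transforms without an inversion
  theorem.\<close>

lemma mollify_eq_fourier1:
  fixes e :: "real^'d \<Rightarrow> complex"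
  assumes e: "integrable lborel e" and "0 < \<sigma>"
  defines "\<theta> \<equiv> \<lambda>s. cnj (fourier1 (\<lambda>y. cnj (e y)) s) * of_real (gauss_weight \<sigma> s)"
  shows "integrable lborel \<theta>" "sq_int \<theta>" "fourier1 \<theta> = mollify \<sigma> e"
proof -
  define cr where "cr = (2*pi) powr (- real CARD('d) / 2)"
  define c where "c = complex_of_real cr"
  define E where "E s = (LINT y|lborel. cis (s \<bullet> y) * e y)" for s
  have \<theta>_eq: "\<theta> s = c * E s * of_real (gauss_weight \<sigma> s)" for s
    by (simp add: \<theta>_def fourier1_def c_def cr_def E_def cis_cnj Bochner_Integration.integral_cnj[symmetric] del: Bochner_Integration.integral_cnj)
  define B where "B = cr * (LINT y|lborel. cmod (e y))"
  have [measurable]: "e \<in> borel_measurable borel"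
    using borel_measurable_integrable[OF e] by simp
  have [measurable]: "E \<in> borel_measurable borel"
    unfolding E_def by measurable
  have [measurable]: "\<theta> \<in> borel_measurable borel"
    unfolding \<theta>_eq[abs_def] by measurable
  have cr: "0 \<le> cr" by (simp add: cr_def)
  have "cmod (E s) \<le> (LINT y|lborel. cmod (cis (s \<bullet> y) * e y))" for s
    unfolding E_def by (rule integral_norm_bound)
  then have E: "cmod (c * E s) \<le> B" for s
    using cr by (simp add: norm_mult B_def c_def mult_left_mono)
  have \<theta>bd: "cmod (\<theta> s) \<le> B * gauss_weight \<sigma> s" for s
    using mult_right_mono[OF E gauss_weight_bounds(1)] gauss_weight_bounds(1)[of \<sigma> s]
    by (simp add: \<theta>_eq norm_mult)
  have B: "0 \<le> B" using E[of 0] by (rule order_trans[OF norm_ge_zero])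
  note gi = gauss_weight_integrable[OF \<open>0 < \<sigma>\<close>, where 'd='d]
  show "integrable lborel \<theta>"
    by (rule Bochner_Integration.integrable_bound[OF integrable_mult_right[of B, OF gi]])
       (use \<theta>bd in \<open>auto intro!: AE_I2 order_trans[OF \<theta>bd abs_ge_self]\<close>)
  show "sq_int \<theta>"
  proof (rule sq_int_bound[OF integrable_mult_right[of "B\<^sup>2", OF gi]])
    fix s
    have "(cmod (\<theta> s))\<^sup>2 \<le> (B * gauss_weight \<sigma> s)\<^sup>2"
      using \<theta>bd by (intro power_mono) auto
    also have "\<dots> \<le> B\<^sup>2 * gauss_weight \<sigma> s"
      using gauss_weight_bounds[of \<sigma> s]
      by (simp add: power_mult_distrib power2_eq_square[of "gauss_weight _ _"] mult_left_mono mult_left_le)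
    finally show "(cmod (\<theta> s))\<^sup>2 \<le> B\<^sup>2 * gauss_weight \<sigma> s" .
  qed simp
  have "fourier1 \<theta> x = mollify \<sigma> e x" for x
  proof -
    \<comment> \<open>The two normalizing factors cancel the power of 2 pi produced by
      \<open>gauss_weight_fourier\<close>.\<close>
    have cc: "cr * cr * (2 * pi) ^ CARD('d) = 1"
    proof -
      have "cr * cr = (2*pi) powr (- real CARD('d))"
        unfolding cr_def by (subst powr_add[symmetric]) simp
      then have "cr * cr = inverse ((2*pi) ^ CARD('d))"
        by (subst (asm) powr_minus, subst (asm) powr_realpow) auto
      then show ?thesis by (simp only:) (rule left_inverse, simp)
    qed
    have I: "integrable (lborel \<Otimes>\<^sub>M lborel) (\<lambda>(y, s). cis (- (s \<bullet> (x - y))) * of_real (gauss_weight \<sigma> s) * e y)"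
      by (rule integrable_pair_bound[OF _ integrable_norm[OF e] gi])
         (auto simp: norm_mult gauss_weight_bounds)
    have "fourier1 \<theta> x = c * (LINT s|lborel. c * (LINT y|lborel. cis (- (s \<bullet> (x - y))) * of_real (gauss_weight \<sigma> s) * e y))"
    proof -
      have "cis (- (x \<bullet> s)) * \<theta> s = c * (LINT y|lborel. cis (- (s \<bullet> (x - y))) * of_real (gauss_weight \<sigma> s) * e y)" for s
      proof -
        have "cis (- (s \<bullet> (x - y))) = cis (- (x \<bullet> s)) * cis (s \<bullet> y)" for y
          by (simp add: cis_mult inner_diff_right inner_commute)
        then have "(LINT y|lborel. cis (- (s \<bullet> (x - y))) * of_real (gauss_weight \<sigma> s) * e y)
          = (LINT y|lborel. cis (- (x \<bullet> s)) * of_real (gauss_weight \<sigma> s) * (cis (s \<bullet> y) * e y))"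
          by (intro Bochner_Integration.integral_cong) (simp_all add: mult_ac)
        also have "\<dots> = cis (- (x \<bullet> s)) * of_real (gauss_weight \<sigma> s) * E s"
          unfolding E_def by (rule integral_mult_right_zero)
        finally show ?thesis by (simp add: \<theta>_eq)
      qed
      then show ?thesis by (simp add: fourier1_def c_def cr_def)
    qed
    also have "\<dots> = c * c * (LINT s|lborel. (LINT y|lborel. cis (- (s \<bullet> (x - y))) * of_real (gauss_weight \<sigma> s) * e y))"
      by (subst integral_mult_right_zero) simp
    also have "\<dots> = c * c * (LINT y|lborel. (LINT s|lborel. cis (- (s \<bullet> (x - y))) * of_real (gauss_weight \<sigma> s) * e y))"
      by (subst lborel_pair.Fubini_integral[OF I]) simp
    also have "\<dots> = c * c * (LINT y|lborel. of_real ((2 * pi) ^ CARD('d)) * (e y * of_real (gauss_kernel \<sigma> (x - y))))"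
    proof (intro arg_cong2[where f="(*)"] refl Bochner_Integration.integral_cong)
      fix y
      have "(LINT s|lborel. cis (- (s \<bullet> (x - y))) * of_real (gauss_weight \<sigma> s) * e y)
        = of_real ((2 * pi) ^ CARD('d) * gauss_kernel \<sigma> (x - y)) * e y"
        unfolding gauss_weight_fourier[OF \<open>0 < \<sigma>\<close>, symmetric] by (rule integral_mult_left_zero)
      then show "(LINT s|lborel. cis (- (s \<bullet> (x - y))) * of_real (gauss_weight \<sigma> s) * e y)
        = of_real ((2 * pi) ^ CARD('d)) * (e y * of_real (gauss_kernel \<sigma> (x - y)))"
        by (simp add: mult_ac)
    qed
    also have "\<dots> = of_real (cr * cr * (2 * pi) ^ CARD('d)) * mollify \<sigma> e x"
      unfolding integral_mult_right_zero mollify_def c_def by (simp add: mult_ac)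
    finally show ?thesis by (simp only: cc) simp
  qed
  then show "fourier1 \<theta> = mollify \<sigma> e" by blast
qed

lemma nn_integral_gauss_kernel_shift:
  assumes "0 < \<sigma>"
  shows "(\<integral>\<^sup>+y. ennreal (gauss_kernel \<sigma> (x - y)) \<partial>lborel) = 1"
    and "(\<integral>\<^sup>+y. ennreal (gauss_kernel \<sigma> (y - x)) \<partial>lborel) = 1"
proof -
  have "(\<integral>\<^sup>+y. ennreal (gauss_kernel \<sigma> (y + - x)) \<partial>lborel) = (\<integral>\<^sup>+y. ennreal (gauss_kernel \<sigma> (y::real^'a)) \<partial>lborel)"
    by (rule nn_integral_lborel_translate) measurable
  also have "\<dots> = ennreal 1"
    unfolding gauss_kernel_integral[OF assms, where 'd='a, symmetric]
    by (rule nn_integral_eq_integral[OF gauss_kernel_integrable[OF assms]]) (simp add: gauss_kernel_nonneg)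
  finally show *: "(\<integral>\<^sup>+y. ennreal (gauss_kernel \<sigma> (y - x)) \<partial>lborel) = 1" by simp
  have "(\<integral>\<^sup>+y. ennreal (gauss_kernel \<sigma> (x - y)) \<partial>lborel) = (\<integral>\<^sup>+y. ennreal (gauss_kernel \<sigma> (y - x)) \<partial>lborel)"
  proof (rule nn_integral_cong)
    fix y show "ennreal (gauss_kernel \<sigma> (x - y)) = ennreal (gauss_kernel \<sigma> (y - x))"
      using gauss_kernel_minus[of \<sigma> "x - y"] by simp
  qed
  with * show "(\<integral>\<^sup>+y. ennreal (gauss_kernel \<sigma> (x - y)) \<partial>lborel) = 1" by (simp only:)
qed

text \<open>The multiplication formula is applied to \<open>u\<close> and the weighted conjugate of
  its own transform, which turns the left side into the pairing of \<open>u\<close> with the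
  mollified conjugate of \<open>u\<close>. Since the kernel has mass 1 in either variable, 2ab \<le>
  a^2 + b^2 bounds that pairing.\<close>

lemma fourier1_weighted_norm_le:
  fixes u :: "real^'d \<Rightarrow> complex"
  assumes u: "integrable lborel u" "sq_int u" and "0 < \<sigma>"
  shows "(\<integral>\<^sup>+s. ennreal ((cmod (fourier1 u s))\<^sup>2 * gauss_weight \<sigma> s) \<partial>lborel) \<le> ennreal ((L2_norm u)\<^sup>2)"
proof -
  let ?v = "mollify \<sigma> (\<lambda>y. cnj (u y))"
  let ?n = "\<lambda>x. ennreal ((cmod (u x))\<^sup>2)"
  have [measurable]: "u \<in> borel_measurable borel" by (rule sq_int_measurable[OF u(2)])
  define \<theta> where "\<theta> s = cnj (fourier1 u s) * of_real (gauss_weight \<sigma> s)" for s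
  note \<theta> = mollify_eq_fourier1[OF integrable_cnj[OF u(1)] \<open>0 < \<sigma>\<close>, simplified, folded \<theta>_def]
  have [measurable]: "\<theta> \<in> borel_measurable borel" by (rule sq_int_measurable[OF \<theta>(2)])
  have eq: "fourier1 u s * \<theta> s = of_real ((cmod (fourier1 u s))\<^sup>2 * gauss_weight \<sigma> s)" for s
    by (simp add: \<theta>_def complex_norm_square del: of_real_power)
  define C where "C = (2*pi) powr (- real CARD('d) / 2) * (LINT t|lborel. cmod (u t))"
  have int: "integrable lborel (\<lambda>s. fourier1 u s * \<theta> s)"
  proof (rule Bochner_Integration.integrable_bound)
    show "integrable lborel (\<lambda>s. C * cmod (\<theta> s))" using \<theta>(1) by simp
    show "AE s in lborel. norm (fourier1 u s * \<theta> s) \<le> norm (C * cmod (\<theta> s))"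
      using fourier1_bound[OF u(1), folded C_def]
      by (intro AE_I2) (auto simp: norm_mult abs_mult intro!: mult_right_mono order_trans[OF _ abs_ge_self])
  qed measurable
  then have int': "integrable lborel (\<lambda>s. (cmod (fourier1 u s))\<^sup>2 * gauss_weight \<sigma> s)"
    unfolding eq complex_of_real_integrable_eq .
  define I where "I = (LINT s|lborel. (cmod (fourier1 u s))\<^sup>2 * gauss_weight \<sigma> s)"
  have "complex_of_real I = (LINT s|lborel. fourier1 u s * \<theta> s)"
    unfolding eq I_def by (rule integral_complex_of_real[symmetric])
  also have "\<dots> = (LINT t|lborel. u t * ?v t)"
    using fourier1_multiplication[OF u(1) \<theta>(1)] by (simp add: \<theta>(3))
  finally have I: "complex_of_real I = (LINT t|lborel. u t * ?v t)" .
  have I0: "0 \<le> I" unfolding I_def by (intro integral_nonneg_AE AE_I2) (simp add: gauss_weight_bounds)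
  let ?K = "\<lambda>x y. ennreal (gauss_kernel \<sigma> (x - y))"
  have "ennreal I = ennreal (norm (LINT t|lborel. u t * ?v t))"
    using I0 by (simp flip: I)
  also have "\<dots> \<le> (\<integral>\<^sup>+x. ennreal (norm (u x * ?v x)) \<partial>lborel)"
  \<comment> \<open>A nonintegrable function has Bochner integral 0, so the estimate holds in that
    case as well.\<close>
  proof (cases "integrable lborel (\<lambda>t. u t * ?v t)")
    case True then show ?thesis by (rule integral_norm_bound_ennreal)
  qed (simp add: not_integrable_integral_eq)
  also have "\<dots> \<le> (\<integral>\<^sup>+x. (\<integral>\<^sup>+y. ennreal (1/2) * (?n x * ?K x y) + ennreal (1/2) * (?n y * ?K x y) \<partial>lborel) \<partial>lborel)"
  proof (rule nn_integral_mono)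
    fix x
    have K0: "0 \<le> gauss_kernel \<sigma> w" for w :: "real^'d" by (rule gauss_kernel_nonneg)
    have "ennreal (norm (?v x)) \<le> (\<integral>\<^sup>+y. ennreal (norm (cnj (u y) * of_real (gauss_kernel \<sigma> (x - y)))) \<partial>lborel)"
      unfolding mollify_def
    proof (cases "integrable lborel (\<lambda>y. cnj (u y) * of_real (gauss_kernel \<sigma> (x - y)))")
      case True then show "ennreal (norm (LINT y|lborel. cnj (u y) * of_real (gauss_kernel \<sigma> (x - y)))) \<le> (\<integral>\<^sup>+y. ennreal (norm (cnj (u y) * of_real (gauss_kernel \<sigma> (x - y)))) \<partial>lborel)"
        by (rule integral_norm_bound_ennreal)
    qed (simp add: not_integrable_integral_eq)
    then have "ennreal (norm (u x * ?v x))
      \<le> ennreal (cmod (u x)) * (\<integral>\<^sup>+y. ennreal (cmod (u y) * gauss_kernel \<sigma> (x - y)) \<partial>lborel)"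
      by (simp add: norm_mult ennreal_mult K0 mult_left_mono)
    also have "\<dots> = (\<integral>\<^sup>+y. ennreal (cmod (u x)) * ennreal (cmod (u y) * gauss_kernel \<sigma> (x - y)) \<partial>lborel)"
      by (rule nn_integral_cmult[symmetric]) measurable
    also have "\<dots> \<le> (\<integral>\<^sup>+y. ennreal (1/2) * (?n x * ?K x y) + ennreal (1/2) * (?n y * ?K x y) \<partial>lborel)"
    proof (rule nn_integral_mono)
      fix y
      let ?k = "gauss_kernel \<sigma> (x - y)"
      have "cmod (u x) * (cmod (u y) * ?k) \<le> 1/2 * ((cmod (u x))\<^sup>2 * ?k) + 1/2 * ((cmod (u y))\<^sup>2 * ?k)"
        using mult_right_mono[OF sum_squares_bound[of "cmod (u x)" "cmod (u y)"] K0[of "x - y"]]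
        by (simp add: algebra_simps)
      then have "ennreal (cmod (u x) * (cmod (u y) * ?k)) \<le> ennreal (1/2 * ((cmod (u x))\<^sup>2 * ?k) + 1/2 * ((cmod (u y))\<^sup>2 * ?k))"
        by (rule ennreal_leI)
      moreover have "ennreal (1/2 * ((cmod (u x))\<^sup>2 * ?k) + 1/2 * ((cmod (u y))\<^sup>2 * ?k))
        = ennreal (1/2) * (?n x * ?K x y) + ennreal (1/2) * (?n y * ?K x y)"
        using K0[of "x - y"] by (simp only: ennreal_plus ennreal_mult mult_nonneg_nonneg zero_le_power2 divide_nonneg_nonneg zero_le_one zero_le_numeral)
      ultimately show "ennreal (cmod (u x)) * ennreal (cmod (u y) * ?k)
        \<le> ennreal (1/2) * (?n x * ?K x y) + ennreal (1/2) * (?n y * ?K x y)"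
        using K0[of "x - y"] by (simp add: ennreal_mult)
    qed
    finally show "ennreal (norm (u x * ?v x)) \<le> \<dots>" .
  qed
  also have "\<dots> = ennreal (1/2) * (\<integral>\<^sup>+x. (\<integral>\<^sup>+y. ?n x * ?K x y \<partial>lborel) \<partial>lborel)
      + ennreal (1/2) * (\<integral>\<^sup>+x. (\<integral>\<^sup>+y. ?n y * ?K x y \<partial>lborel) \<partial>lborel)"
    by (simp add: nn_integral_add nn_integral_cmult del: ennreal_half)
  also have "(\<integral>\<^sup>+x. (\<integral>\<^sup>+y. ?n y * ?K x y \<partial>lborel) \<partial>lborel)
      = (\<integral>\<^sup>+y. (\<integral>\<^sup>+x. ?n y * ?K x y \<partial>lborel) \<partial>lborel)"
    by (rule lborel_pair.Fubini') measurable
  also have "\<dots> = (\<integral>\<^sup>+y. ?n y \<partial>lborel)"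
    by (simp add: nn_integral_cmult nn_integral_gauss_kernel_shift[OF \<open>0 < \<sigma>\<close>])
  also have "(\<integral>\<^sup>+x. (\<integral>\<^sup>+y. ?n x * ?K x y \<partial>lborel) \<partial>lborel) = (\<integral>\<^sup>+y. ?n y \<partial>lborel)"
    by (simp add: nn_integral_cmult nn_integral_gauss_kernel_shift[OF \<open>0 < \<sigma>\<close>])
  also have "(\<integral>\<^sup>+y. ?n y \<partial>lborel) = ennreal ((L2_norm u)\<^sup>2)"
    unfolding L2_norm_sq by (rule nn_integral_eq_integral[OF sq_int_integrable_norm2[OF u(2)]]) simp
  also have "ennreal (1/2) * ennreal ((L2_norm u)\<^sup>2) + ennreal (1/2) * ennreal ((L2_norm u)\<^sup>2) = ennreal ((L2_norm u)\<^sup>2)"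
  proof -
    have "ennreal (1/2) + ennreal (1/2) = 1" by (subst ennreal_plus[symmetric]) auto
    then show ?thesis by (simp only: distrib_right[symmetric] mult_1)
  qed
  finally have "ennreal I \<le> ennreal ((L2_norm u)\<^sup>2)" .
  moreover have "(\<integral>\<^sup>+s. ennreal ((cmod (fourier1 u s))\<^sup>2 * gauss_weight \<sigma> s) \<partial>lborel) = ennreal I"
    unfolding I_def by (rule nn_integral_eq_integral[OF int']) (simp add: gauss_weight_bounds)
  ultimately show ?thesis by simp
qed

text \<open>Fatou's lemma, as the Gaussian weight tends to 1. \<open>fourier_L2\<close> does not
  assert that its approximants have square-integrable transforms, and \<open>L2_norm\<close> is 0
  when the square is not integrable; its convergence clause becomes usable only with this
  fact.\<close>

lemma fourier1_sq_int:
  fixes u :: "real^'d \<Rightarrow> complex"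
  assumes u: "integrable lborel u" "sq_int u"
  shows "sq_int (fourier1 u)"
proof -
  have [measurable]: "u \<in> borel_measurable borel" by (rule sq_int_measurable[OF u(2)])
  let ?F = "\<lambda>n s. ennreal ((cmod (fourier1 u s))\<^sup>2 * gauss_weight (1 / real (Suc n)) s)"
  have "(\<integral>\<^sup>+s. ennreal ((cmod (fourier1 u s))\<^sup>2) \<partial>lborel) = (\<integral>\<^sup>+s. liminf (\<lambda>n. ?F n s) \<partial>lborel)"
  proof (rule nn_integral_cong)
    fix s
    have "(\<lambda>n. gauss_weight (1 / real (Suc n)) s) \<longlonglongrightarrow> (\<Prod>i\<in>(UNIV::'d set). exp (- (0\<^sup>2 * (s$i)\<^sup>2 / 2)))"
      unfolding gauss_weight_def
      by (intro tendsto_intros LIMSEQ_Suc[OF lim_1_over_n]) auto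
    then have "(\<lambda>n. (cmod (fourier1 u s))\<^sup>2 * gauss_weight (1 / real (Suc n)) s) \<longlonglongrightarrow> (cmod (fourier1 u s))\<^sup>2 * 1"
      by (intro tendsto_mult tendsto_const) simp
    then have "(\<lambda>n. ?F n s) \<longlonglongrightarrow> ennreal ((cmod (fourier1 u s))\<^sup>2 * 1)"
      by (rule tendsto_ennrealI)
    then have "liminf (\<lambda>n. ?F n s) = ennreal ((cmod (fourier1 u s))\<^sup>2 * 1)"
      by (intro lim_imp_Liminf) simp
    then show "ennreal ((cmod (fourier1 u s))\<^sup>2) = liminf (\<lambda>n. ?F n s)" by simp
  qed
  also have "\<dots> \<le> liminf (\<lambda>n. \<integral>\<^sup>+s. ?F n s \<partial>lborel)"
    by (rule nn_integral_liminf) measurable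
  also have "\<dots> \<le> liminf (\<lambda>n. ennreal ((L2_norm u)\<^sup>2))"
    by (intro Liminf_mono always_eventually allI fourier1_weighted_norm_le u) simp
  also have "\<dots> = ennreal ((L2_norm u)\<^sup>2)" by (simp add: Liminf_const)
  finally have "(\<integral>\<^sup>+s. ennreal ((cmod (fourier1 u s))\<^sup>2) \<partial>lborel) < \<infinity>"
    by (simp add: le_less_trans)
  then have "integrable lborel (\<lambda>s. (cmod (fourier1 u s))\<^sup>2)"
    by (intro integrableI_bounded) auto
  then show ?thesis by (simp add: sq_int_def)
qed

text \<open>Jensen's inequality for the probability density \<open>K\<close> centred at
  \<open>x\<close>.\<close>

lemma mollify_diff_sq_le:
  fixes e :: "real^'d \<Rightarrow> complex"
  assumes [measurable]: "e \<in> borel_measurable borel" and B: "\<And>x. cmod (e x) \<le> B" and "0 < \<sigma>"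
  shows "ennreal ((cmod (mollify \<sigma> e x - e x))\<^sup>2)
    \<le> (\<integral>\<^sup>+y. ennreal ((cmod (e y - e x))\<^sup>2 * gauss_kernel \<sigma> (x - y)) \<partial>lborel)"
proof -
  define K where "K y = gauss_kernel \<sigma> (x - y)" for y
  have K_eq: "K y = gauss_kernel \<sigma> (y + - x)" for y
    using gauss_kernel_minus[of \<sigma> "x - y"] by (simp add: K_def)
  have K0: "0 \<le> K y" for y by (simp add: K_def gauss_kernel_nonneg)
  have [measurable]: "K \<in> borel_measurable borel" unfolding K_def by measurable
  have Ki: "integrable lborel K" and K1: "(LINT y|lborel. K y) = 1"
    unfolding K_eq using integral_lborel_translate[of "gauss_kernel \<sigma>" "- x"]
      gauss_kernel_integrable gauss_kernel_integral \<open>0 < \<sigma>\<close> by simp_all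
  have bdK: "integrable lborel (\<lambda>y. f y * K y)"
    if [measurable]: "f \<in> borel_measurable borel" and "\<And>y. \<bar>f y\<bar> \<le> D" for f :: "real^'d \<Rightarrow> real" and D
  proof (rule Bochner_Integration.integrable_bound[OF integrable_mult_right[of D, OF Ki]])
    show "AE y in lborel. norm (f y * K y) \<le> norm (D * K y)"
    proof (rule AE_I2)
      fix y show "norm (f y * K y) \<le> norm (D * K y)"
        using that(2)[of y] K0[of y] by (auto simp: abs_mult intro: mult_right_mono order_trans)
    qed
  qed measurable
  define g where "g y = cmod (e y - e x)" for y
  have [measurable]: "g \<in> borel_measurable borel" unfolding g_def by measurable
  have g: "0 \<le> g y" "g y \<le> 2 * B" for y
    using norm_triangle_ineq4[of "e y" "e x"] B[of x] B[of y] by (auto simp: g_def)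
  have gK: "integrable lborel (\<lambda>y. g y * K y)"
    by (rule bdK[where D="2 * B"]) (use g in auto)
  have g2K: "integrable lborel (\<lambda>y. (g y)\<^sup>2 * K y)"
    by (rule bdK[where D="(2 * B)\<^sup>2"]) (use power_mono[OF g(2) g(1), of _ 2] in auto)
  define m where "m = (LINT y|lborel. g y * K y)"
  have m0: "0 \<le> m" unfolding m_def by (intro integral_nonneg_AE AE_I2) (use g K0 in auto)
  \<comment> \<open>A variance is nonnegative, so the squared mean \<open>m\<close> is at most the
    mean square.\<close>
  have "0 \<le> (LINT y|lborel. (g y - m)\<^sup>2 * K y)"
    by (intro integral_nonneg_AE AE_I2) (use K0 in auto)
  also have "\<dots> = (LINT y|lborel. (g y)\<^sup>2 * K y - 2 * m * (g y * K y) + m\<^sup>2 * K y)"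
    by (intro Bochner_Integration.integral_cong) (auto simp: power2_eq_square algebra_simps)
  also have "\<dots> = (LINT y|lborel. (g y)\<^sup>2 * K y) - m\<^sup>2"
    using gK g2K Ki K1 by (simp add: m_def[symmetric] power2_eq_square)
  finally have m2: "m\<^sup>2 \<le> (LINT y|lborel. (g y)\<^sup>2 * K y)" by simp
  have eK: "integrable lborel (\<lambda>y. e y * of_real (K y))"
    by (rule Bochner_Integration.integrable_bound[OF integrable_mult_right[of B, OF Ki]])
       (use B K0 in \<open>auto intro!: AE_I2 mult_right_mono order_trans[OF B abs_ge_self] simp: norm_mult abs_mult\<close>)
  have "mollify \<sigma> e x - e x = (LINT y|lborel. e y * of_real (K y)) - (LINT y|lborel. e x * of_real (K y))"
    using K1 by (simp add: mollify_def K_def integral_complex_of_real)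
  also have "\<dots> = (LINT y|lborel. e y * of_real (K y) - e x * of_real (K y))"
    by (subst Bochner_Integration.integral_diff) (use eK Ki in auto)
  also have "cmod \<dots> \<le> (LINT y|lborel. cmod (e y * of_real (K y) - e x * of_real (K y)))"
    by (rule integral_norm_bound)
  also have "\<dots> = m"
    unfolding m_def g_def using K0
    by (intro Bochner_Integration.integral_cong refl) (simp add: left_diff_distrib[symmetric] norm_mult)
  finally have "(cmod (mollify \<sigma> e x - e x))\<^sup>2 \<le> m\<^sup>2" by (rule power_mono) simp
  also note m2
  finally have "ennreal ((cmod (mollify \<sigma> e x - e x))\<^sup>2) \<le> ennreal (LINT y|lborel. (g y)\<^sup>2 * K y)"
    by (rule ennreal_leI)
  also have "\<dots> = (\<integral>\<^sup>+y. ennreal ((g y)\<^sup>2 * K y) \<partial>lborel)"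
    by (rule nn_integral_eq_integral[symmetric, OF g2K]) (use K0 in auto)
  finally show ?thesis by (simp add: g_def K_def)
qed

text \<open>Uniform continuity handles small \<open>w\<close>. For larger \<open>w\<close> the
  trivial bound by four times the squared norm is absorbed into the quadratic term. Integration
  against a Gaussian then needs only its second moment and no tail estimate.\<close>

lemma L2_modulus_le:
  fixes e :: "real^'d \<Rightarrow> complex"
  assumes cont: "continuous_on UNIV e" and supp: "\<And>x. \<rho> < norm x \<Longrightarrow> e x = 0" and "0 < \<eta>"
  obtains C where "0 \<le> C"
    "\<And>w. (\<integral>\<^sup>+y. ennreal ((cmod (e y - e (w + y)))\<^sup>2) \<partial>lborel) \<le> ennreal (\<eta> + C * (norm w)\<^sup>2)"
proof -
  let ?D = "\<lambda>y w. ennreal ((cmod (e y - e (w + y)))\<^sup>2)"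
  have sq: "sq_int e" by (rule continuous_compact_support_sq_int[OF cont supp])
  have [measurable]: "e \<in> borel_measurable borel" by (rule sq_int_measurable[OF sq])
  define V where "V = measure lborel (cball (0::real^'d) (\<rho> + 1))"
  \<comment> \<open>\<open>V\<close> is the volume of the ball that carries the difference for small
    shifts, so a pointwise error \<eta>' costs at most \<eta>; the added 1 keeps the denominator
    positive.\<close>
  define \<eta>' where "\<eta>' = sqrt (\<eta> / (V + 1))"
  have V: "0 \<le> V" by (simp add: V_def)
  have \<eta>': "0 < \<eta>'" "\<eta>'\<^sup>2 * V \<le> \<eta>" using \<open>0 < \<eta>\<close> V by (auto simp: \<eta>'_def field_simps)
  obtain \<delta> where \<delta>: "0 < \<delta>" "\<And>x y. norm (x - y) < \<delta> \<Longrightarrow> cmod (e x - e y) \<le> \<eta>'"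
    by (rule continuous_compact_support_uniform[of e \<rho> \<eta>']) (use cont supp \<eta>'(1) in auto)
  define \<delta>' where "\<delta>' = min \<delta> 1"
  define N where "N = (L2_norm e)\<^sup>2"
  have \<delta>': "0 < \<delta>'" "\<delta>' \<le> 1" "\<delta>' \<le> \<delta>" using \<delta>(1) by (auto simp: \<delta>'_def)
  have nnN: "(\<integral>\<^sup>+y. ennreal ((cmod (e y))\<^sup>2) \<partial>lborel) = ennreal N"
    unfolding N_def L2_norm_sq by (rule nn_integral_eq_integral[OF sq_int_integrable_norm2[OF sq]]) simp
  have N: "0 \<le> N" by (simp add: N_def)
  have "(\<integral>\<^sup>+y. ?D y w \<partial>lborel)
      \<le> ennreal (\<eta> + (4 * N / \<delta>'\<^sup>2) * (norm w)\<^sup>2)" for w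
  proof (cases "norm w < \<delta>'")
    case True
    have "(\<integral>\<^sup>+y. ?D y w \<partial>lborel)
        \<le> (\<integral>\<^sup>+y. ennreal (\<eta>'\<^sup>2) * indicator (cball (0::real^'d) (\<rho> + 1)) y \<partial>lborel)"
    proof (rule nn_integral_mono)
      fix y
      show "?D y w \<le> ennreal (\<eta>'\<^sup>2) * indicator (cball 0 (\<rho> + 1)) y"
      proof (cases "norm y \<le> \<rho> + 1")
        case True
        have "cmod (e y - e (w + y)) \<le> \<eta>'"
          using \<open>norm w < \<delta>'\<close> \<delta>'(3) by (intro \<delta>(2)) simp
        then show ?thesis using True
          by (auto intro!: ennreal_leI power_mono)
      next
        case False
        have "norm y \<le> norm w + norm (w + y)"
          using norm_triangle_ineq4[of "w + y" w] by simp
        then have "\<rho> < norm (w + y)" using False \<open>norm w < \<delta>'\<close> \<delta>' by linarith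
        then show ?thesis using supp[of y] supp[of "w + y"] False by auto
      qed
    qed
    also have "\<dots> = ennreal (\<eta>'\<^sup>2 * V)"
      using emeasure_lborel_cball_finite[of "0::real^'d" "\<rho> + 1"]
      by (simp add: nn_integral_cmult_indicator V_def emeasure_eq_ennreal_measure ennreal_mult)
    also have "\<dots> \<le> ennreal (\<eta> + (4 * N / \<delta>'\<^sup>2) * (norm w)\<^sup>2)"
      using \<eta>'(2) N by (intro ennreal_leI) (simp add: add_increasing2)
    finally show ?thesis .
  next
    case False
    have "(\<integral>\<^sup>+y. ?D y w \<partial>lborel)
        \<le> (\<integral>\<^sup>+y. ennreal 2 * ennreal ((cmod (e y))\<^sup>2) + ennreal 2 * ennreal ((cmod (e (y + w)))\<^sup>2) \<partial>lborel)"
    proof (rule nn_integral_mono)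
      fix y
      have "(cmod (e y - e (w + y)))\<^sup>2 \<le> (cmod (e y) + cmod (e (w + y)))\<^sup>2"
        by (intro power_mono norm_triangle_ineq4) auto
      also have "\<dots> \<le> 2 * (cmod (e y))\<^sup>2 + 2 * (cmod (e (w + y)))\<^sup>2"
        using sum_squares_bound[of "cmod (e y)" "cmod (e (w + y))"] by (simp add: power2_sum)
      finally have "?D y w \<le> ennreal (2 * (cmod (e y))\<^sup>2 + 2 * (cmod (e (w + y)))\<^sup>2)"
        by (rule ennreal_leI)
      then show "?D y w
         \<le> ennreal 2 * ennreal ((cmod (e y))\<^sup>2) + ennreal 2 * ennreal ((cmod (e (y + w)))\<^sup>2)"
        by (simp add: ennreal_mult add.commute[of w])
    qed
    also have "\<dots> = ennreal 2 * ennreal N + ennreal 2 * ennreal N"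
      using nn_integral_lborel_translate[of "\<lambda>y. ennreal ((cmod (e y))\<^sup>2)" w] nnN
      by (subst nn_integral_add) (auto simp: nn_integral_cmult)
    also have "\<dots> = ennreal (4 * N)"
    proof -
      have "ennreal (4 * N) = ennreal (2 * N + 2 * N)" by simp
      also have "\<dots> = ennreal 2 * ennreal N + ennreal 2 * ennreal N"
        using N by (simp only: ennreal_plus ennreal_mult mult_nonneg_nonneg zero_le_numeral)
      finally show ?thesis ..
    qed
    also have "\<dots> \<le> ennreal (\<eta> + (4 * N / \<delta>'\<^sup>2) * (norm w)\<^sup>2)"
    proof (rule ennreal_leI)
      have "\<delta>'\<^sup>2 \<le> (norm w)\<^sup>2" using False \<delta>' by (intro power_mono) auto
      then have "4 * N * \<delta>'\<^sup>2 \<le> 4 * N * (norm w)\<^sup>2" using N by (intro mult_left_mono) auto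
      then have "4 * N \<le> (4 * N / \<delta>'\<^sup>2) * (norm w)\<^sup>2" using \<delta>' by (simp add: field_simps)
      then show "4 * N \<le> \<eta> + (4 * N / \<delta>'\<^sup>2) * (norm w)\<^sup>2" using \<open>0 < \<eta>\<close> by linarith
    qed
    finally show ?thesis .
  qed
  moreover have "0 \<le> 4 * N / \<delta>'\<^sup>2" using N by simp
  ultimately show ?thesis using that by blast
qed

text \<open>Jensen and Tonelli bound the squared error by the Gaussian average of the squared L2
  modulus of continuity, and the second moment makes its quadratic part small.\<close>

lemma mollify_L2_approx:
  fixes e :: "real^'d \<Rightarrow> complex"
  assumes cont: "continuous_on UNIV e" and supp: "\<And>x. \<rho> < norm x \<Longrightarrow> e x = 0" and "0 < \<epsilon>"
  obtains \<sigma> where "0 < \<sigma>" "sq_int (mollify \<sigma> e)" "L2_norm (\<lambda>x. mollify \<sigma> e x - e x) < \<epsilon>"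
proof -
  let ?D = "\<lambda>y w. ennreal ((cmod (e y - e (w + y)))\<^sup>2)"
  have sq: "sq_int e" by (rule continuous_compact_support_sq_int[OF cont supp])
  have [measurable]: "e \<in> borel_measurable borel" by (rule sq_int_measurable[OF sq])
  obtain B where B: "\<And>x. cmod (e x) \<le> B" using continuous_compact_support_bounded[OF cont supp] by blast
  obtain C where C: "0 \<le> C"
    "\<And>w. (\<integral>\<^sup>+y. ?D y w \<partial>lborel) \<le> ennreal (\<epsilon>\<^sup>2 / 3 + C * (norm w)\<^sup>2)"
    by (rule L2_modulus_le[of e \<rho> "\<epsilon>\<^sup>2 / 3"]) (use cont supp \<open>0 < \<epsilon>\<close> in auto)
  define D where "D = C * real CARD('d)"
  \<comment> \<open>Chosen so that the second-moment term is at most a third of \<epsilon>^2; with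
    the constant third the total stays strictly below \<epsilon>^2.\<close>
  define \<sigma> where "\<sigma> = sqrt (\<epsilon>\<^sup>2 / (3 * (D + 1)))"
  have D: "0 \<le> D" using C(1) by (simp add: D_def)
  have \<sigma>: "0 < \<sigma>" "D * \<sigma>\<^sup>2 \<le> \<epsilon>\<^sup>2 / 3"
    using D \<open>0 < \<epsilon>\<close> by (auto simp: \<sigma>_def field_simps)
  have K0: "0 \<le> gauss_kernel \<sigma> w" for w :: "real^'d" by (rule gauss_kernel_nonneg)
  have int: "integrable lborel (\<lambda>w::real^'d. gauss_kernel \<sigma> w * (\<epsilon>\<^sup>2 / 3 + C * (norm w)\<^sup>2))"
    and val: "(LINT w|lborel. gauss_kernel \<sigma> (w::real^'d) * (\<epsilon>\<^sup>2 / 3 + C * (norm w)\<^sup>2)) = \<epsilon>\<^sup>2 / 3 + D * \<sigma>\<^sup>2"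
  proof -
    have eq: "gauss_kernel \<sigma> w * (\<epsilon>\<^sup>2 / 3 + C * (norm w)\<^sup>2)
      = \<epsilon>\<^sup>2 / 3 * gauss_kernel \<sigma> w + C * (gauss_kernel \<sigma> w * (norm w)\<^sup>2)" for w :: "real^'d"
      by (simp add: algebra_simps)
    note I = gauss_kernel_integrable[OF \<sigma>(1), where 'd='d] gauss_kernel_second_moment[OF \<sigma>(1), where 'd='d]
      gauss_kernel_integral[OF \<sigma>(1), where 'd='d]
    show "integrable lborel (\<lambda>w::real^'d. gauss_kernel \<sigma> w * (\<epsilon>\<^sup>2 / 3 + C * (norm w)\<^sup>2))"
      unfolding eq using I by (intro Bochner_Integration.integrable_add integrable_mult_right) auto
    show "(LINT w|lborel. gauss_kernel \<sigma> (w::real^'d) * (\<epsilon>\<^sup>2 / 3 + C * (norm w)\<^sup>2)) = \<epsilon>\<^sup>2 / 3 + D * \<sigma>\<^sup>2"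
      unfolding eq using I by (subst Bochner_Integration.integral_add) (auto simp: D_def)
  qed
  have "(\<integral>\<^sup>+x. ennreal ((cmod (mollify \<sigma> e x - e x))\<^sup>2) \<partial>lborel)
     \<le> (\<integral>\<^sup>+x. (\<integral>\<^sup>+y. ennreal ((cmod (e y - e x))\<^sup>2 * gauss_kernel \<sigma> (x - y)) \<partial>lborel) \<partial>lborel)"
    by (rule nn_integral_mono, rule mollify_diff_sq_le[OF _ B \<sigma>(1)]) simp
  also have "\<dots> = (\<integral>\<^sup>+y. (\<integral>\<^sup>+x. ennreal ((cmod (e y - e x))\<^sup>2 * gauss_kernel \<sigma> (x - y)) \<partial>lborel) \<partial>lborel)"
    by (rule lborel_pair.Fubini') measurable
  also have "\<dots> = (\<integral>\<^sup>+y. (\<integral>\<^sup>+w. ennreal ((cmod (e y - e (w + y)))\<^sup>2 * gauss_kernel \<sigma> w) \<partial>lborel) \<partial>lborel)"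
  proof (rule nn_integral_cong)
    fix y
    show "(\<integral>\<^sup>+x. ennreal ((cmod (e y - e x))\<^sup>2 * gauss_kernel \<sigma> (x - y)) \<partial>lborel)
        = (\<integral>\<^sup>+w. ennreal ((cmod (e y - e (w + y)))\<^sup>2 * gauss_kernel \<sigma> w) \<partial>lborel)"
      by (subst nn_integral_lborel_translate[where c=y, symmetric]) auto
  qed
  also have "\<dots> = (\<integral>\<^sup>+w. (\<integral>\<^sup>+y. ennreal ((cmod (e y - e (w + y)))\<^sup>2 * gauss_kernel \<sigma> w) \<partial>lborel) \<partial>lborel)"
    by (rule lborel_pair.Fubini') measurable
  also have "\<dots> \<le> (\<integral>\<^sup>+w. ennreal (gauss_kernel \<sigma> (w::real^'d) * (\<epsilon>\<^sup>2 / 3 + C * (norm w)\<^sup>2)) \<partial>lborel)"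
  proof (rule nn_integral_mono)
    fix w
    have "(\<integral>\<^sup>+y. ennreal ((cmod (e y - e (w + y)))\<^sup>2 * gauss_kernel \<sigma> w) \<partial>lborel)
        = ennreal (gauss_kernel \<sigma> w) * (\<integral>\<^sup>+y. ?D y w \<partial>lborel)"
      by (subst nn_integral_cmult[symmetric]) (auto simp: ennreal_mult K0 mult.commute)
    also have "\<dots> \<le> ennreal (gauss_kernel \<sigma> w) * ennreal (\<epsilon>\<^sup>2 / 3 + C * (norm w)\<^sup>2)"
      by (intro mult_left_mono C) simp
    finally show "(\<integral>\<^sup>+y. ennreal ((cmod (e y - e (w + y)))\<^sup>2 * gauss_kernel \<sigma> w) \<partial>lborel)
        \<le> ennreal (gauss_kernel \<sigma> w * (\<epsilon>\<^sup>2 / 3 + C * (norm w)\<^sup>2))"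
      using C(1) K0 by (simp add: ennreal_mult)
  qed
  also have "\<dots> = ennreal (\<epsilon>\<^sup>2 / 3 + D * \<sigma>\<^sup>2)"
    unfolding val[symmetric] by (rule nn_integral_eq_integral[OF int]) (use C(1) K0 in auto)
  finally have bound: "(\<integral>\<^sup>+x. ennreal ((cmod (mollify \<sigma> e x - e x))\<^sup>2) \<partial>lborel) \<le> ennreal (\<epsilon>\<^sup>2 / 3 + D * \<sigma>\<^sup>2)" .
  have int2: "integrable lborel (\<lambda>x. (cmod (mollify \<sigma> e x - e x))\<^sup>2)"
  proof (rule integrableI_bounded)
    show "(\<integral>\<^sup>+x. ennreal (norm ((cmod (mollify \<sigma> e x - e x))\<^sup>2)) \<partial>lborel) < \<infinity>"
      using bound by (simp add: le_less_trans)
  qed measurable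
  then have sd: "sq_int (\<lambda>x. mollify \<sigma> e x - e x)"
    by (simp add: sq_int_def)
  have "ennreal ((L2_norm (\<lambda>x. mollify \<sigma> e x - e x))\<^sup>2) \<le> ennreal (\<epsilon>\<^sup>2 / 3 + D * \<sigma>\<^sup>2)"
    unfolding L2_norm_sq using bound nn_integral_eq_integral[OF int2] by simp
  then have "(L2_norm (\<lambda>x. mollify \<sigma> e x - e x))\<^sup>2 \<le> \<epsilon>\<^sup>2 / 3 + D * \<sigma>\<^sup>2"
    using D by (subst (asm) ennreal_le_iff) auto
  also have "\<dots> < \<epsilon>\<^sup>2" using \<sigma>(2) zero_less_power[OF \<open>0 < \<epsilon>\<close>, of 2] by linarith
  finally have "L2_norm (\<lambda>x. mollify \<sigma> e x - e x) < \<epsilon>"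
    using \<open>0 < \<epsilon>\<close> by (simp add: power2_less_imp_less)
  moreover have "sq_int (mollify \<sigma> e)" using sq_int_add[OF sd sq] by simp
  ultimately show ?thesis using that \<sigma>(1) by blast
qed

lemma L2_dense_fourier1:
  fixes f :: "real^'d \<Rightarrow> complex"
  assumes f: "sq_int f" and "0 < \<epsilon>"
  obtains \<theta> where "integrable lborel \<theta>" "sq_int \<theta>" "sq_int (fourier1 \<theta>)"
    "L2_norm (\<lambda>x. f x - fourier1 \<theta> x) < \<epsilon>"
proof -
  obtain e \<rho> where e: "continuous_on UNIV e" "\<And>x. \<rho> < norm x \<Longrightarrow> e x = 0" "sq_int e"
    "L2_norm (\<lambda>x. f x - e x) < \<epsilon>/2"
    using L2_dense_continuous_compact_support[OF f, of "\<epsilon>/2"] \<open>0 < \<epsilon>\<close> by auto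
  obtain \<sigma> where \<sigma>: "0 < \<sigma>" "sq_int (mollify \<sigma> e)" "L2_norm (\<lambda>x. mollify \<sigma> e x - e x) < \<epsilon>/2"
    by (rule mollify_L2_approx[of e \<rho> "\<epsilon>/2"]) (use e \<open>0 < \<epsilon>\<close> in auto)
  obtain \<theta> where \<theta>: "integrable lborel \<theta>" "sq_int \<theta>" "fourier1 \<theta> = mollify \<sigma> e"
    using mollify_eq_fourier1[OF continuous_compact_support_sq_int(2)[OF e(1,2)] \<sigma>(1)] by blast
  have "L2_norm (\<lambda>x. (f x - e x) + (e x - fourier1 \<theta> x))
      \<le> L2_norm (\<lambda>x. f x - e x) + L2_norm (\<lambda>x. e x - fourier1 \<theta> x)"
    unfolding \<theta>(3) by (intro L2_norm_triangle sq_int_diff f e \<sigma>)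
  also have "\<dots> < \<epsilon>/2 + \<epsilon>/2"
    using e(4) \<sigma>(3) L2_norm_minus_commute[of e] unfolding \<theta>(3) by (intro add_strict_mono) simp_all
  finally have "L2_norm (\<lambda>x. f x - fourier1 \<theta> x) < \<epsilon>" by simp
  with that \<theta> \<sigma> show ?thesis by simp
qed

text \<open>Against the conjugate of a transform of an integrable \<theta>, the pairing with
  \<open>v n\<close> is the integral of its transform times \<theta>, and the uniform bound
  \<open>B'\<close> allows dominated convergence. The norm bound \<open>B\<close> extends the limit
  from this dense class to all \<open>f\<close>.\<close>

lemma L2_weak_limit_of_fourier1_limit:
  fixes v :: "nat \<Rightarrow> real^'d \<Rightarrow> complex"
  assumes v: "\<And>n. integrable lborel (v n)" "\<And>n. sq_int (v n)" "\<And>n. L2_norm (v n) \<le> B"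
    and lim: "\<And>s. (\<lambda>n. fourier1 (v n) s) \<longlonglongrightarrow> g s"
    and bd: "\<And>n s. cmod (fourier1 (v n) s) \<le> B'"
    and phi: "fourier_L2 \<phi> g" and f: "sq_int f"
  shows "(\<lambda>n. L2_inner f (v n)) \<longlonglongrightarrow> L2_inner f \<phi>"
proof (rule LIMSEQ_I)
  fix \<epsilon> :: real assume "0 < \<epsilon>"
  from phi obtain u where sphi: "sq_int \<phi>" and sg: "sq_int g"
    and u: "\<And>k. integrable lborel (u k)" "\<And>k. sq_int (u k)"
    and ulim: "(\<lambda>k. L2_norm (\<lambda>t. u k t - \<phi> t)) \<longlonglongrightarrow> 0"
    and uhat: "(\<lambda>k. L2_norm (\<lambda>t. fourier1 (u k) t - g t)) \<longlonglongrightarrow> 0"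
    unfolding fourier_L2_def by blast
  have [measurable]: "v n \<in> borel_measurable borel" "u n \<in> borel_measurable borel"
    "g \<in> borel_measurable borel" for n
    using v(2) u(2) sg by (auto intro: sq_int_measurable)
  \<comment> \<open>\<open>D\<close> dominates the norms of \<open>v n\<close> and of \<phi>
    together, so an approximation error \<epsilon> / (2 D) costs at most \<epsilon> / 2; the added 1
    makes it positive.\<close>
  define D where "D = B + L2_norm \<phi> + 1"
  have B0: "0 \<le> B" using v(3)[of 0] L2_norm_nonneg order_trans by blast
  have D: "0 < D" using B0 L2_norm_nonneg[of \<phi>] by (simp add: D_def add_nonneg_pos)
  obtain \<theta> where \<theta>: "integrable lborel \<theta>" "sq_int \<theta>" "sq_int (fourier1 \<theta>)"
    "L2_norm (\<lambda>x. cnj (f x) - fourier1 \<theta> x) < \<epsilon> / (2 * D)"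
    using L2_dense_fourier1[OF sq_int_cnj[OF f], of "\<epsilon> / (2 * D)"] \<open>0 < \<epsilon>\<close> D by auto
  have [measurable]: "\<theta> \<in> borel_measurable borel" using \<theta>(2) by (rule sq_int_measurable)
  define e where "e x = cnj (fourier1 \<theta> x)" for x
  have se: "sq_int e" unfolding e_def by (rule sq_int_cnj[OF \<theta>(3)])
  have fe: "L2_norm (\<lambda>x. f x - e x) < \<epsilon> / (2 * D)"
  proof -
    have "L2_norm (\<lambda>x. f x - e x) = L2_norm (\<lambda>x. cnj (cnj (f x) - fourier1 \<theta> x))"
      by (simp add: e_def)
    then show ?thesis using \<theta>(4) by (simp only: L2_norm_cnj)
  qed
  have pair: "L2_inner w e = (LINT s|lborel. fourier1 w s * \<theta> s)" if "integrable lborel w" for w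
    unfolding L2_inner_def e_def using fourier1_multiplication[OF that \<theta>(1)] by simp
  have "(\<lambda>n. LINT s|lborel. fourier1 (v n) s * \<theta> s) \<longlonglongrightarrow> (LINT s|lborel. g s * \<theta> s)"
  proof (rule integral_dominated_convergence)
    show "integrable lborel (\<lambda>s. B' * cmod (\<theta> s))" using \<theta>(1) by simp
    show "AE s in lborel. (\<lambda>n. fourier1 (v n) s * \<theta> s) \<longlonglongrightarrow> g s * \<theta> s"
      by (intro AE_I2 tendsto_mult lim tendsto_const)
    show "AE s in lborel. norm (fourier1 (v n) s * \<theta> s) \<le> B' * cmod (\<theta> s)" for n
      by (intro AE_I2) (simp add: norm_mult bd mult_right_mono)
  qed measurable
  then have lim1: "(\<lambda>n. L2_inner (v n) e) \<longlonglongrightarrow> (LINT s|lborel. g s * \<theta> s)"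
    by (simp add: pair v(1))
  have "(\<lambda>k. L2_inner (u k) e) \<longlonglongrightarrow> L2_inner \<phi> e"
    by (rule L2_inner_limit_left[OF se u(2) sphi ulim])
  \<comment> \<open>The transform of \<phi> is given only as an L2 limit, so the pairing with \<phi>
    is evaluated through the integrable approximants \<open>u k\<close>.\<close>
  moreover have "(\<lambda>k. L2_inner (u k) e) \<longlonglongrightarrow> (LINT s|lborel. g s * \<theta> s)"
  proof -
    have "(\<lambda>k. L2_inner (fourier1 (u k)) (\<lambda>s. cnj (\<theta> s))) \<longlonglongrightarrow> L2_inner g (\<lambda>s. cnj (\<theta> s))"
      by (rule L2_inner_limit_left[OF sq_int_cnj[OF \<theta>(2)] fourier1_sq_int[OF u] sg uhat])
    then show ?thesis by (simp add: pair u(1)) (simp add: L2_inner_def)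
  qed
  ultimately have eq: "L2_inner \<phi> e = (LINT s|lborel. g s * \<theta> s)"
    by (rule LIMSEQ_unique)
  obtain n0 where n0: "\<And>n. n \<ge> n0 \<Longrightarrow> cmod (L2_inner (v n) e - L2_inner \<phi> e) < \<epsilon> / 2"
    using LIMSEQ_D[OF lim1, of "\<epsilon>/2"] \<open>0 < \<epsilon>\<close> unfolding eq by auto
  show "\<exists>n0. \<forall>n\<ge>n0. norm (L2_inner f (v n) - L2_inner f \<phi>) < \<epsilon>"
  proof (intro exI allI impI)
    fix n assume "n0 \<le> n"
    let ?d = "\<lambda>x. f x - e x"
    have sd: "sq_int ?d" by (intro sq_int_diff f se)
    have deq: "L2_inner f (v n) - L2_inner f \<phi>
        = (L2_inner e (v n) - L2_inner e \<phi>) + L2_inner ?d (v n) - L2_inner ?d \<phi>"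
      by (simp add: L2_inner_diff_left f se v(2) sphi)
    have tri: "norm (L2_inner f (v n) - L2_inner f \<phi>)
        \<le> norm (L2_inner e (v n) - L2_inner e \<phi>) + norm (L2_inner ?d (v n)) + norm (L2_inner ?d \<phi>)"
      unfolding deq
      using norm_triangle_ineq4[of "(L2_inner e (v n) - L2_inner e \<phi>) + L2_inner ?d (v n)" "L2_inner ?d \<phi>"]
        norm_triangle_ineq[of "L2_inner e (v n) - L2_inner e \<phi>" "L2_inner ?d (v n)"] by linarith
    have "L2_inner e (v n) - L2_inner e \<phi> = cnj (L2_inner (v n) e - L2_inner \<phi> e)"
      by (simp only: L2_inner_commute[of e "v n"] L2_inner_commute[of e \<phi>] complex_cnj_diff)
    then have "norm (L2_inner e (v n) - L2_inner e \<phi>) = cmod (L2_inner (v n) e - L2_inner \<phi> e)"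
      by (simp only: complex_mod_cnj)
    moreover have "norm (L2_inner ?d (v n)) \<le> L2_norm ?d * B"
      by (rule order_trans[OF L2_Cauchy_Schwarz[OF sd v(2)] mult_left_mono[OF v(3) L2_norm_nonneg]])
    moreover have "norm (L2_inner ?d \<phi>) \<le> L2_norm ?d * L2_norm \<phi>"
      by (rule L2_Cauchy_Schwarz[OF sd sphi])
    ultimately have "norm (L2_inner f (v n) - L2_inner f \<phi>)
        \<le> cmod (L2_inner (v n) e - L2_inner \<phi> e) + L2_norm ?d * (B + L2_norm \<phi>)"
      using tri by (simp only: distrib_left)
    also have "\<dots> < \<epsilon>/2 + \<epsilon>/2"
    proof (rule add_less_le_mono[OF n0[OF \<open>n0 \<le> n\<close>]])
      have "L2_norm ?d * (B + L2_norm \<phi>) \<le> \<epsilon> / (2 * D) * D"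
        using fe B0 D \<open>0 < \<epsilon>\<close> by (intro mult_mono) (auto simp: D_def)
      also have "\<dots> = \<epsilon> / 2" using D by simp
      finally show "L2_norm ?d * (B + L2_norm \<phi>) \<le> \<epsilon> / 2" .
    qed
    finally show "norm (L2_inner f (v n) - L2_inner f \<phi>) < \<epsilon>" by simp
  qed
qed

subsection \<open>The cascade algorithm\<close>

lemma transl_measurable [measurable]:
  assumes [measurable]: "f \<in> borel_measurable borel"
  shows "transl l f \<in> borel_measurable borel"
  unfolding transl_def by measurable

lemma dil_measurable [measurable]:
  assumes [measurable]: "f \<in> borel_measurable borel"
  shows "dil A f \<in> borel_measurable borel"
  unfolding dil_def by measurable

lemma dil_inv_measurable [measurable]:
  assumes [measurable]: "f \<in> borel_measurable borel"
  shows "dil_inv A f \<in> borel_measurable borel"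
  unfolding dil_inv_def by measurable

lemma transl_eq_shift: "transl l f = (\<lambda>t. f (t + - rvec l))"
  by (simp add: transl_def fun_eq_iff)

lemma transl_transl: "transl k (transl l f) = transl (k + l) f"
  by (simp add: transl_def fun_eq_iff rvec_add algebra_simps)

lemma transl_zero [simp]: "transl 0 f = f"
  by (simp add: transl_def fun_eq_iff)

lemma transl_dil: "transl l (dil A f) = dil A (transl (A *v l) f)"
  by (simp add: transl_def dil_def rvec_matrix matrix_vector_mult_diff_distrib fun_eq_iff)

lemma sq_int_transl:
  assumes "sq_int f" shows "sq_int (transl l f)"
proof -
  have [measurable]: "f \<in> borel_measurable borel" by (rule sq_int_measurable[OF assms])
  show ?thesis
    using sq_int_integrable_norm2[OF assms] integral_lborel_translate(2)[of "\<lambda>t. (cmod (f t))\<^sup>2" "- rvec l"]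
    by (simp add: sq_int_def transl_eq_shift)
qed

lemma integrable_transl:
  assumes "integrable lborel f" shows "integrable lborel (transl l f)"
proof -
  have "f \<in> borel_measurable borel" using borel_measurable_integrable[OF assms] by simp
  from integral_lborel_translate(2)[OF this, of "- rvec l"] assms show ?thesis
    by (simp add: transl_eq_shift)
qed

lemma L2_norm_transl:
  assumes "sq_int f" shows "L2_norm (transl l f) = L2_norm f"
proof -
  have [measurable]: "f \<in> borel_measurable borel" by (rule sq_int_measurable[OF assms])
  show ?thesis
    using integral_lborel_translate(1)[of "\<lambda>t. (cmod (f t))\<^sup>2" "- rvec l"]
    by (simp add: L2_norm_def transl_eq_shift)
qed

lemma L2_inner_transl:
  assumes "sq_int f" "sq_int g"
  shows "L2_inner f (transl l g) = L2_inner (transl (- l) f) g"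
proof -
  have [measurable]: "f \<in> borel_measurable borel" "g \<in> borel_measurable borel"
    using assms by (auto intro: sq_int_measurable)
  have "L2_inner (transl (- l) f) g = (LINT t|lborel. f (t + rvec l) * cnj (g (t + rvec l + - rvec l)))"
    by (simp add: L2_inner_def transl_eq_shift rvec_uminus)
  also have "\<dots> = L2_inner f (transl l g)"
    unfolding L2_inner_def transl_eq_shift
    by (rule integral_lborel_translate(1)[where F="\<lambda>t. f t * cnj (g (t + - rvec l))"]) measurable
  finally show ?thesis ..
qed

context dilation_lattice
begin

lemma dil_dil_inv [simp]: "dil A (dil_inv A f) = f" and dil_inv_dil [simp]: "dil_inv A (dil A f) = f"
  by (auto simp: dil_def dil_inv_def fun_eq_iff)

lemma sq_int_dil: assumes "sq_int f" shows "sq_int (dil A f)"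
proof -
  have [measurable]: "f \<in> borel_measurable borel" by (rule sq_int_measurable[OF assms])
  show ?thesis
    using sq_int_integrable_norm2[OF assms] integral_dilate(2)[of "\<lambda>t. (cmod (f t))\<^sup>2"]
    by (simp add: sq_int_def dil_def norm_mult power_mult_distrib)
qed

lemma sq_int_dil_inv: assumes "sq_int f" shows "sq_int (dil_inv A f)"
proof -
  have [measurable]: "f \<in> borel_measurable borel" by (rule sq_int_measurable[OF assms])
  show ?thesis
    using sq_int_integrable_norm2[OF assms] integral_dilate_inv(2)[of "\<lambda>t. (cmod (f t))\<^sup>2"]
    by (simp add: sq_int_def dil_inv_def norm_divide power_divide)
qed

lemma integrable_dil: assumes "integrable lborel f" shows "integrable lborel (dil A f)"
proof -
  have "f \<in> borel_measurable borel" using borel_measurable_integrable[OF assms] by simp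
  from integral_dilate(2)[OF this] assms show ?thesis
    by (simp add: dil_def[abs_def])
qed

lemma L2_inner_dil_dil:
  assumes "sq_int f" "sq_int g"
  shows "L2_inner (dil A f) (dil A g) = L2_inner f g"
proof -
  have [measurable]: "f \<in> borel_measurable borel" "g \<in> borel_measurable borel"
    using assms by (auto intro: sq_int_measurable)
  have "dil A f t * cnj (dil A g t) = 2 * (f (R *v t) * cnj (g (R *v t)))" for t
    by (simp add: dil_def mult_ac flip: of_real_mult)
  then have "L2_inner (dil A f) (dil A g) = 2 * (LINT t|lborel. f (R *v t) * cnj (g (R *v t)))"
    unfolding L2_inner_def by simp
  also have "\<dots> = L2_inner f g"
    using integral_dilate(1)[of "\<lambda>t. f t * cnj (g t)"] by (simp add: L2_inner_def scaleR_conv_of_real mult.commute[of 2])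
  finally show ?thesis .
qed

lemma L2_inner_dil:
  assumes "sq_int f" "sq_int g"
  shows "L2_inner f (dil A g) = L2_inner (dil_inv A f) g"
  using L2_inner_dil_dil[OF sq_int_dil_inv[OF assms(1)] assms(2)] by simp

lemma L2_inner_dil_inv:
  assumes "sq_int f" "sq_int g"
  shows "L2_inner f (dil_inv A g) = L2_inner (dil A f) g"
  using L2_inner_dil_dil[OF assms(1) sq_int_dil_inv[OF assms(2)]] by simp

lemma L2_norm_dil: assumes "sq_int f" shows "L2_norm (dil A f) = L2_norm f"
proof -
  have "complex_of_real ((L2_norm (dil A f))\<^sup>2) = complex_of_real ((L2_norm f)\<^sup>2)"
    using L2_inner_dil_dil[OF assms assms] by (simp only: L2_inner_self)
  then show ?thesis by (simp only: of_real_eq_iff power2_eq_iff_nonneg L2_norm_nonneg)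
qed

lemma L2_norm_dil_inv: assumes "sq_int f" shows "L2_norm (dil_inv A f) = L2_norm f"
  using L2_norm_dil[OF sq_int_dil_inv[OF assms]] by simp

end

section \<open>Finite filters, the refinement operator and its invariants\<close>

lemma finite_box_int: "finite {n::int^'d. \<forall>j. \<bar>n$j\<bar> \<le> int N}"
proof -
  have "{n::int^'d. \<forall>j. \<bar>n$j\<bar> \<le> int N} \<subseteq> vec_lambda ` (PiE UNIV (\<lambda>_. {- int N..int N}))"
  proof
    fix n :: "int^'d" assume "n \<in> {n. \<forall>j. \<bar>n$j\<bar> \<le> int N}"
    then show "n \<in> vec_lambda ` (PiE UNIV (\<lambda>_. {- int N..int N}))"
      by (intro image_eqI[where x="vec_nth n"]) (auto simp: PiE_def abs_le_iff minus_le_iff)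
  qed
  then show ?thesis by (rule finite_subset) (intro finite_imageI finite_PiE; simp)
qed

locale scaling_filter = dilation_lattice A lA
  for A :: "int^'d^'d" and lA :: "int^'d" +
  fixes h :: "int^'d \<Rightarrow> complex" and N0 :: nat
  assumes orth: "\<forall>k\<in>latt A. (\<Sum>\<^sub>\<infinity>n. h n * cnj (h (n + k))) = (if k = 0 then 1 else 0)"
    and hsum: "(\<Sum>\<^sub>\<infinity>n. h n) = complex_of_real (sqrt 2)"
    and hsupp: "\<forall>n. n \<notin> {n::int^'d. \<forall>j. \<bar>n$j\<bar> \<le> int N0} \<longrightarrow> h n = 0"
begin

definition supp_h :: "(int^'d) set" where
  "supp_h = {n. \<forall>j. \<bar>n$j\<bar> \<le> int N0}"

lemma finite_supp_h [simp]: "finite supp_h"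
  unfolding supp_h_def by (rule finite_box_int)

lemma h_outside: "n \<notin> supp_h \<Longrightarrow> h n = 0"
  using hsupp by (simp add: supp_h_def)

lemma infsum_h:
  fixes f :: "int^'d \<Rightarrow> complex"
  assumes "\<And>n. n \<notin> supp_h \<Longrightarrow> f n = 0"
  shows "(\<Sum>\<^sub>\<infinity>n. f n) = (\<Sum>n\<in>supp_h. f n)"
  using infsum_cong_neutral[of supp_h UNIV f f] assms by simp

lemma orth_sum:
  assumes "k \<in> latt A"
  shows "(\<Sum>n\<in>supp_h. h n * cnj (h (n + k))) = (if k = 0 then 1 else 0)"
  using orth assms infsum_h[of "\<lambda>n. h n * cnj (h (n + k))"] by (simp add: h_outside)

lemma h_sum: "(\<Sum>n\<in>supp_h. h n) = complex_of_real (sqrt 2)"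
  using hsum infsum_h[of h] by (simp add: h_outside)

text \<open>The operator V of the overview.\<close>

definition refine :: "(real^'d \<Rightarrow> complex) \<Rightarrow> real^'d \<Rightarrow> complex" where
  "refine f t = (\<Sum>n\<in>supp_h. h n * dil A (transl n f) t)"

lemma sq_int_refine: "sq_int f \<Longrightarrow> sq_int (refine f)"
  unfolding refine_def by (intro sq_int_sum sq_int_cmult sq_int_dil sq_int_transl)

lemma integrable_refine: "integrable lborel f \<Longrightarrow> integrable lborel (refine f)"
  unfolding refine_def
  by (intro Bochner_Integration.integrable_sum integrable_mult_right integrable_dil integrable_transl)

lemma transl_refine: "transl l (refine f) = (\<lambda>t. \<Sum>n\<in>supp_h. h n * dil A (transl (A *v l + n) f) t)"
proof
  fix t
  have "transl l (refine f) t = (\<Sum>n\<in>supp_h. h n * transl l (dil A (transl n f)) t)"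
    by (simp add: transl_def refine_def)
  then show "transl l (refine f) t = (\<Sum>n\<in>supp_h. h n * dil A (transl (A *v l + n) f) t)"
    by (simp add: transl_dil transl_transl)
qed

definition cascade :: "nat \<Rightarrow> real^'d \<Rightarrow> complex" where
  "cascade n = (refine ^^ n) (indicator ucube)"

lemma cascade_0: "cascade 0 = indicator ucube"
  by (simp add: cascade_def)

lemma cascade_Suc: "cascade (Suc n) = refine (cascade n)"
  by (simp add: cascade_def)

lemma sq_int_ucube: "sq_int (indicator (ucube :: (real^'d) set))"
  and integrable_ucube: "integrable lborel (indicator (ucube :: (real^'d) set) :: real^'d \<Rightarrow> complex)"
  by (rule sq_int_bounded_support[of _ 1 "real CARD('d)"];
      auto simp: indicator_def dest: norm_ucube_le)+

lemma sq_int_cascade: "sq_int (cascade n)"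
  by (induction n) (auto simp: cascade_0 cascade_Suc sq_int_ucube intro: sq_int_refine)

lemma integrable_cascade: "integrable lborel (cascade n)"
  by (induction n) (auto simp: cascade_0 cascade_Suc integrable_ucube intro: integrable_refine)

text \<open>Translating the image by \<open>k\<close> shifts the fine-scale indices by
  \<open>A *v k\<close>. Orthonormality at the fine scale then leaves one filter autocorrelation at
  a lattice point, which \<open>orth_sum\<close> evaluates.\<close>

lemma refine_orthonormal:
  assumes f: "sq_int f"
    and on: "\<And>k l. L2_inner (transl k f) (transl l f) = (if k = l then 1 else 0)"
  shows "L2_inner (transl k (refine f)) (transl l (refine f)) = (if k = l then 1 else 0)"
proof -
  have sq: "sq_int (\<lambda>t. h n * dil A (transl m f) t)" for n m
    by (intro sq_int_cmult sq_int_dil sq_int_transl f)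
  have "L2_inner (transl k (refine f)) (transl l (refine f))
      = (\<Sum>n\<in>supp_h. \<Sum>m\<in>supp_h. h n * (cnj (h m) * L2_inner (transl (A *v k + n) f) (transl (A *v l + m) f)))"
    unfolding transl_refine
    by (subst L2_inner_sum_left[OF sq sq_int_sum[OF sq]], rule sum.cong[OF refl],
        subst L2_inner_sum_right[OF sq sq])
       (simp add: L2_inner_cmult_left L2_inner_cmult_right L2_inner_dil_dil sq_int_transl f sum_distrib_left)
  also have "\<dots> = (\<Sum>n\<in>supp_h. h n * cnj (h (n + A *v (k - l))))"
  proof (rule sum.cong[OF refl])
    fix n
    have "A *v k + n = A *v l + m \<longleftrightarrow> m = n + A *v (k - l)" for m
      by (auto simp: matrix_vector_mult_diff_distrib algebra_simps)
    then have "(\<Sum>m\<in>supp_h. h n * (cnj (h m) * L2_inner (transl (A *v k + n) f) (transl (A *v l + m) f)))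
      = (\<Sum>m\<in>supp_h. if m = n + A *v (k - l) then h n * cnj (h m) else 0)"
      by (intro sum.cong) (auto simp: on)
    also have "\<dots> = h n * cnj (h (n + A *v (k - l)))"
      by (simp add: h_outside)
    finally show "(\<Sum>m\<in>supp_h. h n * (cnj (h m) * L2_inner (transl (A *v k + n) f) (transl (A *v l + m) f)))
      = h n * cnj (h (n + A *v (k - l)))" .
  qed
  also have "\<dots> = (if A *v (k - l) = 0 then 1 else 0)"
    by (rule orth_sum) (simp add: latt_def)
  also have "A *v (k - l) = 0 \<longleftrightarrow> k = l"
    using A_inject[of k l] by (simp add: matrix_vector_mult_diff_distrib)
  finally show ?thesis .
qed

lemma cascade_orthonormal:
  "L2_inner (transl k (cascade n)) (transl l (cascade n)) = (if k = l then 1 else 0)"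
proof (induction n arbitrary: k l)
  case 0
  show ?case
  proof (cases "k = l")
    case True
    have "L2_norm (cascade 0) = 1"
      unfolding L2_norm_def cascade_0
      by (subst Bochner_Integration.integral_cong[OF refl, where g="indicator ucube"])
         (auto simp: indicator_def measure_def)
    then show ?thesis
      using True by (simp add: L2_inner_self L2_norm_transl sq_int_cascade)
  next
    case False
    have z: "transl k (cascade 0) t * cnj (transl l (cascade 0) t) = 0" for t :: "real^'d"
    proof (rule ccontr)
      assume "transl k (cascade 0) t * cnj (transl l (cascade 0) t) \<noteq> 0"
      then have "t + rvec (- k) \<in> ucube" "t + rvec (- l) \<in> ucube"
        by (auto simp: transl_def cascade_0 rvec_uminus indicator_def split: if_splits)
      then have "- k = - l" unfolding ucube_translate_iff by simp
      then show False using False by simp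
    qed
    show ?thesis using False by (simp only: L2_inner_def z) simp
  qed
next
  case (Suc n)
  show ?case unfolding cascade_Suc
    by (rule refine_orthonormal[OF sq_int_cascade Suc])
qed

lemma L2_norm_cascade: "L2_norm (cascade n) = 1"
proof -
  have "complex_of_real ((L2_norm (cascade n))\<^sup>2) = complex_of_real (1\<^sup>2)"
    using cascade_orthonormal[of 0 n 0] by (simp add: L2_inner_self)
  then show ?thesis by (simp only: of_real_eq_iff power2_eq_iff_nonneg L2_norm_nonneg zero_le_one)
qed

lemma integral_dil_transl:
  assumes "integrable lborel f"
  shows "(LINT t|lborel. dil A (transl n f) t) = (LINT t|lborel. f t) / of_real (sqrt 2)"
proof -
  have [measurable]: "f \<in> borel_measurable borel" using borel_measurable_integrable[OF assms] by simp
  have "(LINT t|lborel. dil A (transl n f) t) = of_real (sqrt 2) * (LINT t|lborel. transl n f (R *v t))"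
    unfolding dil_def by (rule integral_mult_right_zero)
  also have "\<dots> = of_real (sqrt 2) * ((1/2) *\<^sub>R (LINT t|lborel. f t))"
    using integral_dilate(1)[of "transl n f"] integral_lborel_translate(1)[of f "- rvec n"]
    by (simp add: transl_eq_shift)
  also have "\<dots> = (LINT t|lborel. f t) / of_real (sqrt 2)"
  proof -
    have "complex_of_real (sqrt 2) * of_real (sqrt 2) = 2" by (simp flip: of_real_mult)
    then show ?thesis by (simp add: scaleR_conv_of_real field_simps)
  qed
  finally show ?thesis .
qed

text \<open>Each dilated translate contributes the factor 1 / sqrt 2, and the filter coefficients
  sum to sqrt 2.\<close>

lemma integral_refine:
  assumes "integrable lborel f"
  shows "(LINT t|lborel. refine f t) = (LINT t|lborel. f t)"
proof -
  have "(LINT t|lborel. refine f t) = (\<Sum>n\<in>supp_h. LINT t|lborel. h n * dil A (transl n f) t)"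
    unfolding refine_def using assms
    by (intro Bochner_Integration.integral_sum integrable_mult_right integrable_dil integrable_transl)
  also have "\<dots> = (\<Sum>n\<in>supp_h. h n * ((LINT t|lborel. f t) / of_real (sqrt 2)))"
    by (simp add: integral_dil_transl[OF assms])
  also have "\<dots> = (\<Sum>n\<in>supp_h. h n) * ((LINT t|lborel. f t) / of_real (sqrt 2))"
    by (simp only: sum_distrib_right)
  finally show ?thesis by (simp add: h_sum)
qed

lemma integral_cascade: "(LINT t|lborel. cascade n t) = 1"
proof (induction n)
  case 0
  have "(LINT t|lborel. indicator (ucube::(real^'d) set) t :: complex)
      = (LINT t|lborel. of_real (indicator (ucube::(real^'d) set) t))"
    by (simp only: of_real_indicator)
  also have "\<dots> = of_real (LINT t|lborel. indicator (ucube::(real^'d) set) t)"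
    by (rule integral_complex_of_real)
  also have "\<dots> = 1" by (simp add: measure_def)
  finally show ?case by (simp only: cascade_0)
qed (simp add: cascade_Suc integral_refine integrable_cascade)

text \<open>The invariant bounds all the \<open>Ri\<close>-iterates of a support point because \<open>Ri\<close> itself
  need not be a contraction.\<close>

lemma cascade_support:
  obtains \<kappa> where "0 < \<kappa>" "real CARD('d) \<le> \<kappa>" "\<And>n t. \<kappa> < norm t \<Longrightarrow> cascade n t = 0"
proof -
  obtain C r where C: "0 \<le> C" "0 < r" "r < 1"
    "\<And>j x. norm ((((*v) Ri) ^^ j) x) \<le> C * r ^ j * norm x" using Ri_decay by blast
  define M where "M = (\<Sum>k\<in>supp_h. norm (rvec k))"
  \<comment> \<open>The fixed point of the recursion \<open>S * r + C * M = S\<close>: one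
    refinement step adds a filter shift of norm at most \<open>M\<close>, contracted by the
    iterates.\<close>
  define S where "S = C * M / (1 - r)"
  have M: "norm (rvec k) \<le> M" if "k \<in> supp_h" for k
    unfolding M_def by (rule member_le_sum) (use that in auto)
  have M0: "0 \<le> M" unfolding M_def by (intro sum_nonneg) auto
  have S: "S * r + C * M = S" using C by (simp add: S_def field_simps)
  have "cascade n t \<noteq> 0 \<Longrightarrow> norm ((((*v) Ri) ^^ j) t) \<le> S * r ^ j + C * real CARD('d)" for n t j
  proof (induction n arbitrary: t j)
    case 0
    then have "t \<in> ucube" by (auto simp: cascade_0 indicator_def split: if_splits)
    have "norm ((((*v) Ri) ^^ j) t) \<le> C * r ^ j * norm t" by (rule C)
    also have "\<dots> \<le> C * 1 * real CARD('d)"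
      using C norm_ucube_le[OF \<open>t \<in> ucube\<close>] by (intro mult_mono mult_left_mono power_le_one) auto
    finally show ?case using C M0 by (simp add: S_def add_increasing)
  next
    case (Suc n)
    then have "\<exists>k\<in>supp_h. h k * dil A (transl k (cascade n)) t \<noteq> 0"
      unfolding cascade_Suc refine_def by (meson sum.neutral)
    then obtain k where k: "k \<in> supp_h" "cascade n (R *v t - rvec k) \<noteq> 0"
      by (auto simp: dil_def transl_def)
    define s where "s = R *v t - rvec k"
    have "t = Ri *v (s + rvec k)" by (simp add: s_def)
    then have "(((*v) Ri) ^^ j) t = (((*v) Ri) ^^ Suc j) (s + rvec k)"
      by (simp add: funpow_swap1)
    then have "norm ((((*v) Ri) ^^ j) t) \<le> norm ((((*v) Ri) ^^ Suc j) s) + norm ((((*v) Ri) ^^ Suc j) (rvec k))"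
      by (simp only: funpow_matrix_add norm_triangle_ineq)
    also have "\<dots> \<le> (S * r ^ Suc j + C * real CARD('d)) + C * r ^ Suc j * M"
    proof (rule add_mono)
      show "norm ((((*v) Ri) ^^ Suc j) s) \<le> S * r ^ Suc j + C * real CARD('d)"
        using Suc.IH k(2) unfolding s_def by blast
      show "norm ((((*v) Ri) ^^ Suc j) (rvec k)) \<le> C * r ^ Suc j * M"
        using C(4)[of "Suc j" "rvec k"] mult_left_mono[OF M[OF k(1)], of "C * r ^ Suc j"] C(1,2) by auto
    qed
    also have "\<dots> \<le> (S * r ^ Suc j + C * real CARD('d)) + C * r ^ j * M"
      using C M0 by (intro add_left_mono mult_right_mono mult_left_mono) (auto intro: mult_left_le_one_le)
    also have "\<dots> = (S * r + C * M) * r ^ j + C * real CARD('d)" by (simp add: algebra_simps)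
    finally show ?case by (simp only: S)
  qed
  from this[of _ _ 0] have "cascade n t = 0" if "max (S + C * real CARD('d)) (real CARD('d) + 1) < norm t" for n t
    using that by fastforce
  moreover have "0 < max (S + C * real CARD('d)) (real CARD('d) + 1)" "real CARD('d) \<le> max (S + C * real CARD('d)) (real CARD('d) + 1)"
    by (auto simp: less_max_iff_disj)
  ultimately show ?thesis using that by blast
qed

section \<open>The cascade on the Fourier side\<close>

abbreviation "Bi \<equiv> matrix_inv (transpose (rmat A))"

lemma fourier1_dil_transl:
  assumes f: "integrable lborel f"
  shows "fourier1 (dil A (transl n f)) \<xi> = cis (- (rvec n \<bullet> (Bi *v \<xi>))) * fourier1 f (Bi *v \<xi>) / of_real (sqrt 2)"
proof -
  have [measurable]: "f \<in> borel_measurable borel" using borel_measurable_integrable[OF f] by simp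
  define F where "F y = cis (- ((Bi *v \<xi>) \<bullet> y)) * f (y - rvec n)" for y
  have [measurable]: "F \<in> borel_measurable borel" unfolding F_def by measurable
  have "cis (- (\<xi> \<bullet> t)) * dil A (transl n f) t = of_real (sqrt 2) * F (R *v t)" for t
    by (simp add: F_def dil_def transl_def inner_transpose_inv)
  then have "(LINT t|lborel. cis (- (\<xi> \<bullet> t)) * dil A (transl n f) t) = of_real (sqrt 2) * (LINT t|lborel. F (R *v t))"
    by simp
  also have "\<dots> = of_real (sqrt 2) * ((1/2) *\<^sub>R (LINT t|lborel. F t))"
    by (simp only: integral_dilate(1)[OF \<open>F \<in> borel_measurable borel\<close>])
  also have "\<dots> = (LINT t|lborel. F t) / of_real (sqrt 2)"
  proof -
    have "complex_of_real (sqrt 2) * of_real (sqrt 2) = 2" by (simp flip: of_real_mult)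
    then show ?thesis by (simp add: scaleR_conv_of_real field_simps)
  qed
  also have "(LINT t|lborel. F t) = (LINT t|lborel. F (t + rvec n))"
    by (rule integral_lborel_translate(1)[symmetric]) measurable
  also have "\<dots> = (LINT t|lborel. cis (- (rvec n \<bullet> (Bi *v \<xi>))) * (cis (- ((Bi *v \<xi>) \<bullet> t)) * f t))"
    by (simp add: F_def inner_add_left inner_add_right cis_mult mult.assoc[symmetric] inner_commute add.commute)
  also have "\<dots> = cis (- (rvec n \<bullet> (Bi *v \<xi>))) * (LINT t|lborel. cis (- ((Bi *v \<xi>) \<bullet> t)) * f t)"
    by (rule integral_mult_right_zero)
  finally show ?thesis
    by (simp add: fourier1_def)
qed

lemma fourier1_refine:
  assumes f: "integrable lborel f"
  shows "fourier1 (refine f) \<xi> = mask0 h N0 (Bi *v \<xi>) * fourier1 f (Bi *v \<xi>)"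
proof -
  let ?c = "complex_of_real ((2*pi) powr (- real CARD('d) / 2))"
  have "fourier1 (refine f) \<xi> = ?c * (LINT t|lborel. (\<Sum>n\<in>supp_h. h n * (cis (- (\<xi> \<bullet> t)) * dil A (transl n f) t)))"
    by (simp add: fourier1_def refine_def sum_distrib_left mult_ac)
  also have "(LINT t|lborel. (\<Sum>n\<in>supp_h. h n * (cis (- (\<xi> \<bullet> t)) * dil A (transl n f) t)))
     = (\<Sum>n\<in>supp_h. LINT t|lborel. h n * (cis (- (\<xi> \<bullet> t)) * dil A (transl n f) t))"
    by (rule Bochner_Integration.integral_sum)
       (intro integrable_mult_right integrable_cis_mult integrable_dil integrable_transl f, measurable)
  also have "?c * \<dots> = (\<Sum>n\<in>supp_h. h n * fourier1 (dil A (transl n f)) \<xi>)"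
    by (simp add: fourier1_def sum_distrib_left mult_ac)
  also have "\<dots> = mask0 h N0 (Bi *v \<xi>) * fourier1 f (Bi *v \<xi>)"
    unfolding mask0_def supp_h_def[symmetric] fourier1_dil_transl[OF f] sum_distrib_left sum_distrib_right
    by (intro sum.cong refl) simp
  finally show ?thesis .
qed

lemma fourier1_cascade:
  "fourier1 (cascade n) \<xi>
    = (\<Prod>j<n. mask0 h N0 ((((*v) Bi) ^^ Suc j) \<xi>)) * fourier1 (indicator ucube) ((((*v) Bi) ^^ n) \<xi>)"
proof (induction n arbitrary: \<xi>)
  case (Suc n)
  have sw: "(((*v) Bi) ^^ j) (Bi *v \<xi>) = (((*v) Bi) ^^ Suc j) \<xi>" for j
    by (simp add: funpow_swap1)
  show ?case
    unfolding cascade_Suc fourier1_refine[OF integrable_cascade] Suc sw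
    by (subst prod.lessThan_Suc_shift) (simp add: mult.assoc)
qed (simp add: cascade_0)

text \<open>The mask equals 1 at the origin because the coefficients sum to sqrt 2; termwise |cis x
  - 1| \<le> |x| does the rest.\<close>

lemma mask0_lipschitz:
  obtains L where "0 \<le> L" "\<And>t. cmod (mask0 h N0 t - 1) \<le> L * norm t"
proof
  define L where "L = (\<Sum>n\<in>supp_h. cmod (h n) * norm (rvec n)) / sqrt 2"
  show "0 \<le> L" unfolding L_def by (intro divide_nonneg_nonneg sum_nonneg) auto
  fix t
  have m: "mask0 h N0 t - 1 = (\<Sum>n\<in>supp_h. h n * (cis (- (rvec n \<bullet> t)) - 1)) / of_real (sqrt 2)"
  proof -
    have "(\<Sum>n\<in>supp_h. h n * (cis (- (rvec n \<bullet> t)) - 1)) = (\<Sum>n\<in>supp_h. h n * cis (- (rvec n \<bullet> t))) - of_real (sqrt 2)"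
      by (simp add: right_diff_distrib sum_subtractf h_sum)
    then show ?thesis
      unfolding mask0_def supp_h_def[symmetric] by (simp add: diff_divide_distrib)
  qed
  have c1: "cmod (cis x - 1) \<le> \<bar>x\<bar>" for x
    using iexp_approx1[of x 0] by (simp add: cis_conv_exp)
  have "cmod (\<Sum>n\<in>supp_h. h n * (cis (- (rvec n \<bullet> t)) - 1)) \<le> (\<Sum>n\<in>supp_h. cmod (h n) * norm (rvec n) * norm t)"
  proof (rule sum_norm_le)
    fix n
    have "cmod (cis (- (rvec n \<bullet> t)) - 1) \<le> norm (rvec n) * norm t"
      using c1[of "- (rvec n \<bullet> t)"] Cauchy_Schwarz_ineq2[of "rvec n" t] by simp
    then show "cmod (h n * (cis (- (rvec n \<bullet> t)) - 1)) \<le> cmod (h n) * norm (rvec n) * norm t"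
      by (simp add: norm_mult mult.assoc mult_left_mono)
  qed
  then show "cmod (mask0 h N0 t - 1) \<le> L * norm t"
    unfolding m L_def by (simp add: norm_divide sum_distrib_right divide_right_mono)
qed

text \<open>Along the iterates of \<open>Bi\<close> the mask differs from 1 by at most a geometric
  sequence, so the product converges absolutely. The remaining factor tends to the transform of the
  cube at 0, which is the normalizing constant in \<open>gfun\<close>.\<close>

lemma fourier1_cascade_tendsto: "(\<lambda>n. fourier1 (cascade n) \<xi>) \<longlonglongrightarrow> gfun A h N0 \<xi>"
proof -
  obtain C r where C: "0 \<le> C" "0 < r" "r < 1"
    "\<And>j x. norm ((((*v) Bi) ^^ j) x) \<le> C * r ^ j * norm x"
    using transpose_inv_decay by blast
  obtain L where L: "0 \<le> L" "\<And>t. cmod (mask0 h N0 t - 1) \<le> L * norm t" using mask0_lipschitz by blast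
  let ?m = "\<lambda>j. mask0 h N0 ((((*v) Bi) ^^ Suc j) \<xi>)"
  have "summable (\<lambda>j. norm (?m j - 1))"
  proof (rule summable_comparison_test')
    show "summable (\<lambda>j. (L * C * norm \<xi> * r) * r ^ j)"
      using C by (intro summable_mult summable_geometric) auto
    fix j
    have "norm (?m j - 1) \<le> L * norm ((((*v) Bi) ^^ Suc j) \<xi>)" by (rule L)
    also have "\<dots> \<le> L * (C * r ^ Suc j * norm \<xi>)" by (intro mult_left_mono C L)
    finally show "norm (norm (?m j - 1)) \<le> (L * C * norm \<xi> * r) * r ^ j" by (simp add: mult_ac)
  qed
  then have "convergent_prod ?m"
    by (intro abs_convergent_prod_imp_convergent_prod summable_imp_abs_convergent_prod)
  then have p: "(\<lambda>n. \<Prod>j<n. ?m j) \<longlonglongrightarrow> prodinf ?m"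
    using convergent_prod_LIMSEQ LIMSEQ_lessThan_iff_atMost[of "\<lambda>A. prod ?m A"] by blast
  have z: "(\<lambda>n. (((*v) Bi) ^^ n) \<xi>) \<longlonglongrightarrow> 0"
  proof (rule Lim_null_comparison)
    show "\<forall>\<^sub>F n in sequentially. norm ((((*v) Bi) ^^ n) \<xi>) \<le> C * norm \<xi> * r ^ n"
      using C(4)[of _ \<xi>] by (auto intro!: always_eventually simp: mult_ac)
    show "(\<lambda>n. C * norm \<xi> * r ^ n) \<longlonglongrightarrow> 0"
      using C by (intro tendsto_mult_right_zero LIMSEQ_power_zero) auto
  qed
  have "(\<lambda>n. LINT t|lborel. cis (- ((((*v) Bi) ^^ n) \<xi> \<bullet> t)) * indicator ucube t)
      \<longlonglongrightarrow> (LINT t|lborel. cis (- (0 \<bullet> t)) * indicator (ucube::(real^'d) set) t)"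
  proof (rule integral_dominated_convergence)
    show "integrable lborel (indicator (ucube::(real^'d) set) :: _ \<Rightarrow> real)"
      by (intro integrable_real_indicator) auto
    show "AE t in lborel. (\<lambda>n. cis (- ((((*v) Bi) ^^ n) \<xi> \<bullet> t)) * indicator ucube t)
        \<longlonglongrightarrow> cis (- (0 \<bullet> t)) * indicator ucube t"
      by (intro AE_I2 tendsto_intros z)
  qed (auto simp: norm_mult indicator_def)
  also have "(LINT t|lborel. cis (- (0 \<bullet> t)) * indicator (ucube::(real^'d) set) t) = 1"
    using integral_cascade[of 0] by (simp add: cascade_0)
  finally have f: "(\<lambda>n. fourier1 (indicator ucube) ((((*v) Bi) ^^ n) \<xi>))
      \<longlonglongrightarrow> complex_of_real ((2*pi) powr (- real CARD('d) / 2)) * 1"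
    unfolding fourier1_def by (intro tendsto_mult tendsto_const)
  from tendsto_mult[OF p f] show ?thesis
    unfolding fourier1_cascade gfun_def by (simp add: mult.commute)
qed

text \<open>Unit L2 norm on a common ball bounds the L1 norm independently of \<open>n\<close>. This
  bounds the transforms uniformly and provides the constant \<open>W\<close> in
  \<open>energy_dil_inv_ge\<close>.\<close>

lemma integral_norm_cascade_le:
  assumes \<kappa>: "\<And>t. \<kappa> < norm t \<Longrightarrow> cascade n t = 0"
  shows "(LINT t|lborel. cmod (cascade n t)) \<le> L2_norm (indicator (cball 0 \<kappa>) :: real^'d \<Rightarrow> complex)"
proof -
  let ?k = "indicator (cball 0 \<kappa>) :: real^'d \<Rightarrow> complex"
  have "?k \<in> borel_measurable borel" by (rule borel_measurable_indicator) simp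
  then have sk: "sq_int ?k" by (rule sq_int_bounded_support[of _ 1 \<kappa>]) (auto simp: indicator_def)
  have "(LINT t|lborel. cmod (cascade n t)) = (LINT t|lborel. cmod (cascade n t) * cmod (?k t))"
  proof (rule Bochner_Integration.integral_cong[OF refl])
    fix t show "cmod (cascade n t) = cmod (cascade n t) * cmod (?k t)"
      using \<kappa>[of t] by (cases "norm t \<le> \<kappa>") auto
  qed
  also have "\<dots> \<le> L2_norm (cascade n) * L2_norm ?k"
    by (rule L2_Cauchy_Schwarz_norm[OF sq_int_cascade sk])
  finally show ?thesis by (simp add: L2_norm_cascade)
qed

lemma cascade_fourier1_bounded: obtains B where "\<And>n \<xi>. cmod (fourier1 (cascade n) \<xi>) \<le> B"
proof -
  obtain \<kappa> where \<kappa>: "\<And>n t. \<kappa> < norm t \<Longrightarrow> cascade n t = 0" using cascade_support by blast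
  have "cmod (fourier1 (cascade n) \<xi>) \<le> (2*pi) powr (- real CARD('d) / 2)
      * L2_norm (indicator (cball 0 \<kappa>) :: real^'d \<Rightarrow> complex)" for n \<xi>
    using integral_norm_cascade_le[OF \<kappa>]
    by (intro order_trans[OF fourier1_bound[OF integrable_cascade]] mult_left_mono) auto
  with that show ?thesis by blast
qed

lemma cascade_weak_limit:
  assumes "fourier_L2 \<phi> (gfun A h N0)" "sq_int f"
  shows "(\<lambda>n. L2_inner f (cascade n)) \<longlonglongrightarrow> L2_inner f \<phi>"
proof -
  obtain B where B: "\<And>n \<xi>. cmod (fourier1 (cascade n) \<xi>) \<le> B" using cascade_fourier1_bounded by blast
  show ?thesis
    by (rule L2_weak_limit_of_fourier1_limit[OF integrable_cascade sq_int_cascade _ fourier1_cascade_tendsto B assms, of 1])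
       (simp add: L2_norm_cascade)
qed

end

subsection \<open>Perfect reconstruction\<close>

lemma dotz_diff: "dotz q (a - b) = dotz q a - dotz q b"
  by (simp add: dotz_def right_diff_distrib sum_subtractf)

lemma minus_one_powi: "(-1 :: complex) powi n = (if even n then 1 else -1)"
  by (auto simp: power_int_minus_left)

text \<open>For nonnegative terms any exhausting sequence of finite sets determines the
  unconditional sum. The intervals are half open to match the telescoping in
  \<open>wavelet_Parseval\<close>.\<close>

lemma has_sum_nonneg_int:
  fixes M :: "int \<Rightarrow> real"
  assumes nn: "\<And>n. 0 \<le> M n" and lim: "(\<lambda>J. \<Sum>n\<in>{- int J..<int J}. M n) \<longlonglongrightarrow> S"
  shows "(M has_sum S) UNIV"
proof -
  have mono: "incseq (\<lambda>J. \<Sum>n\<in>{- int J..<int J}. M n)"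
    by (intro incseq_SucI sum_mono2) (auto simp: nn)
  have part: "(\<Sum>n\<in>{- int J..<int J}. M n) \<le> S" for J
    using incseq_le[OF mono lim] .
  have fin: "sum M F \<le> S" if F: "finite F" for F
  proof -
    obtain J :: nat where "\<And>n. n \<in> F \<Longrightarrow> \<bar>n\<bar> < int J"
    proof
      fix n assume "n \<in> F"
      then have "\<bar>n\<bar> \<le> Max (insert 0 (abs ` F))" using F by (intro Max_ge) auto
      then show "\<bar>n\<bar> < int (nat (Max (insert 0 (abs ` F))) + 1)" by linarith
    qed
    then have "F \<subseteq> {- int J..<int J}" by force
    then have "sum M F \<le> (\<Sum>n\<in>{- int J..<int J}. M n)" by (intro sum_mono2) (auto simp: nn)
    then show ?thesis using part order_trans by blast
  qed
  have summ: "M summable_on UNIV"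
    by (rule nonneg_bdd_above_summable_on) (auto simp: nn intro!: bdd_aboveI2[where M=S] fin)
  have "infsum M UNIV \<le> S" by (rule infsum_le_finite_sums[OF summ]) (use fin in auto)
  moreover have "S \<le> infsum M UNIV"
    by (rule LIMSEQ_le_const2[OF lim]) (auto intro!: exI[of _ 0] finite_sum_le_infsum[OF summ] simp: nn)
  ultimately show ?thesis using has_sum_infsum[OF summ] by simp
qed

lemma has_sum_sum:
  fixes f :: "'i \<Rightarrow> 'a \<Rightarrow> complex"
  assumes "\<And>i. i \<in> I \<Longrightarrow> (f i has_sum s i) X"
  shows "((\<lambda>x. \<Sum>i\<in>I. f i x) has_sum (\<Sum>i\<in>I. s i)) X"
  using assms by (induction I rule: infinite_finite_induct) (auto intro: has_sum_add)

locale wavelet_filter = scaling_filter A lA h N0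
  for A :: "int^'d^'d" and lA h N0 +
  fixes qA :: "int^'d"
  assumes qeven: "\<forall>k\<in>latt A. even (dotz qA k)"
    and qodd: "\<forall>k\<in>latt A. odd (dotz qA (lA + k))"
    and cond1: "\<forall>m\<in>latt A. \<forall>n. UNIV = ((\<lambda>k. n - k) ` latt A) \<union> ((\<lambda>k. lA - m - n + k) ` latt A)
                 \<and> ((\<lambda>k. n - k) ` latt A) \<inter> ((\<lambda>k. lA - m - n + k) ` latt A) = {}"
    and cond2: "\<forall>m\<in>(\<lambda>k. lA + k) ` latt A. \<forall>n. (\<lambda>k. n - k) ` latt A = (\<lambda>k. lA - m - n + k) ` latt A"
begin

lemma odd_dotz_iff: "odd (dotz qA m) \<longleftrightarrow> m \<notin> latt A"
proof (cases "m \<in> latt A")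
  case False
  then have "m \<in> (\<lambda>k. lA + k) ` latt A" using UNIV_I[of m] by (subst (asm) part) simp
  with False qodd show ?thesis by auto
qed (use qeven in auto)

definition sgn_q :: "int^'d \<Rightarrow> complex" where
  "sgn_q k = (-1) powi (dotz qA k)"

text \<open>The two exponents differ by \<open>dotz qA m\<close>, whose parity tells the coset of
  \<open>m\<close>.\<close>

lemma sgn_q_mult: "sgn_q (lA - p) * sgn_q (lA - (p + m)) = (if m \<in> latt A then 1 else -1)"
proof -
  have "dotz qA (lA - (p + m)) = dotz qA (lA - p) - dotz qA m"
    by (simp add: dotz_diff[symmetric] algebra_simps)
  then show ?thesis
    using odd_dotz_iff[of m] by (auto simp: sgn_q_def minus_one_powi)
qed

lemma cnj_sgn_q [simp]: "cnj (sgn_q k) = sgn_q k"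
  by (simp add: sgn_q_def minus_one_powi)

text \<open>A finite range for the correlation index \<open>m\<close> that does not depend on
  \<open>p\<close>, so that the sums over \<open>p\<close> and \<open>m\<close> can be
  exchanged.\<close>

definition diffs :: "(int^'d) set" where
  "diffs = (\<lambda>(x, y). x - y) ` (supp_h \<times> supp_h)"

lemma finite_diffs [simp]: "finite diffs"
  by (simp add: diffs_def)

lemma zero_in_diffs: "0 \<in> diffs"
  unfolding diffs_def by (rule image_eqI[where x="(0, 0)"]) (auto simp: supp_h_def)

text \<open>Substitutes x = p + m; the remaining \<open>m\<close> contribute nothing because
  \<open>h (p + m)\<close> vanishes there.\<close>

lemma sum_diffs:
  assumes "p \<in> supp_h"
  shows "(\<Sum>x\<in>supp_h. h x * X (x - p)) = (\<Sum>m\<in>diffs. h (p + m) * X m)"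
proof -
  have "(\<Sum>x\<in>supp_h. h x * X (x - p)) = (\<Sum>m\<in>(\<lambda>x. x - p) ` supp_h. h (p + m) * X m)"
    by (subst sum.reindex) (auto simp: inj_on_def)
  also have "\<dots> = (\<Sum>m\<in>diffs. h (p + m) * X m)"
  proof (rule sum.mono_neutral_left)
    show "(\<lambda>x. x - p) ` supp_h \<subseteq> diffs" using assms by (auto simp: diffs_def)
    show "\<forall>m\<in>diffs - (\<lambda>x. x - p) ` supp_h. h (p + m) * X m = 0"
    proof
      fix m assume "m \<in> diffs - (\<lambda>x. x - p) ` supp_h"
      then have "p + m \<notin> supp_h" by (auto simp: image_iff algebra_simps)
      then show "h (p + m) * X m = 0" by (simp add: h_outside)
    qed
  qed simp
  finally show ?thesis .
qed

text \<open>This and \<open>highpass\<close> are the two analysis filters: applied to the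
  coefficients of \<open>dil_inv A f\<close> they give the pairings of \<open>f\<close> with
  translates of \<phi> and of the wavelet (\<open>coef_refinement\<close>,
  \<open>coef_wavelet\<close>).\<close>

definition lowpass :: "(int^'d \<Rightarrow> complex) \<Rightarrow> int^'d \<Rightarrow> complex" where
  "lowpass c l = (\<Sum>n\<in>supp_h. cnj (h n) * c (A *v l + n))"

definition highpass :: "(int^'d \<Rightarrow> complex) \<Rightarrow> int^'d \<Rightarrow> complex" where
  "highpass c l = (\<Sum>n\<in>supp_h. sgn_q (lA - n) * h n * c (A *v l + (lA - n)))"

lemma lowpass_sq:
  "lowpass c l * cnj (lowpass c l)
    = (\<Sum>p\<in>supp_h. \<Sum>m\<in>diffs. cnj (h p) * h (p + m) * (c (A *v l + p) * cnj (c (A *v l + p + m))))"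
proof -
  have "lowpass c l * cnj (lowpass c l)
    = (\<Sum>p\<in>supp_h. \<Sum>x\<in>supp_h. (cnj (h p) * c (A *v l + p)) * cnj (cnj (h x) * c (A *v l + x)))"
    unfolding lowpass_def cnj_sum by (rule sum_product)
  also have "\<dots> = (\<Sum>p\<in>supp_h. cnj (h p) * (\<Sum>x\<in>supp_h. h x * (c (A *v l + p) * cnj (c (A *v l + p + (x - p))))))"
    unfolding sum_distrib_left by (intro sum.cong refl) (simp add: mult_ac)
  also have "\<dots> = (\<Sum>p\<in>supp_h. cnj (h p) * (\<Sum>m\<in>diffs. h (p + m) * (c (A *v l + p) * cnj (c (A *v l + p + m)))))"
    by (intro sum.cong refl arg_cong2[where f="(*)"] sum_diffs)
  finally show ?thesis by (simp add: sum_distrib_left mult.assoc)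
qed

text \<open>Expanding the conjugated factor first yields the same weights
  \<open>cnj (h p) * h (p + m)\<close> as in \<open>lowpass_sq\<close>. What differs is the sign
  from \<open>sgn_q_mult\<close> and the reflected index \<open>lA - p - m\<close>.\<close>

lemma highpass_sq:
  "highpass c l * cnj (highpass c l)
    = (\<Sum>p\<in>supp_h. \<Sum>m\<in>diffs. cnj (h p) * h (p + m) * (if m \<in> latt A then 1 else -1) *
        (c (A *v l + (lA - p - m)) * cnj (c (A *v l + (lA - p - m) + m))))"
proof -
  have "highpass c l * cnj (highpass c l)
    = (\<Sum>p\<in>supp_h. \<Sum>x\<in>supp_h. (cnj (sgn_q (lA - p) * h p * c (A *v l + (lA - p)))) * (sgn_q (lA - x) * h x * c (A *v l + (lA - x))))"
    unfolding highpass_def cnj_sum by (subst mult.commute) (rule sum_product)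
  also have "\<dots> = (\<Sum>p\<in>supp_h. cnj (h p) * (\<Sum>x\<in>supp_h. h x * (sgn_q (lA - p) * sgn_q (lA - (p + (x - p))) *
      (c (A *v l + (lA - p - (x - p))) * cnj (c (A *v l + (lA - p)))))))"
    unfolding sum_distrib_left by (intro sum.cong refl) (simp add: mult_ac)
  also have "\<dots> = (\<Sum>p\<in>supp_h. cnj (h p) * (\<Sum>m\<in>diffs. h (p + m) * (sgn_q (lA - p) * sgn_q (lA - (p + m)) *
      (c (A *v l + (lA - p - m)) * cnj (c (A *v l + (lA - p)))))))"
    by (intro sum.cong refl arg_cong2[where f="(*)"] sum_diffs)
  also have "\<dots> = (\<Sum>p\<in>supp_h. \<Sum>m\<in>diffs. cnj (h p) * h (p + m) * (if m \<in> latt A then 1 else -1) *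
        (c (A *v l + (lA - p - m)) * cnj (c (A *v l + (lA - p - m) + m))))"
    unfolding sgn_q_mult sum_distrib_left by (intro sum.cong refl) (simp add: algebra_simps)
  finally show ?thesis .
qed

text \<open>Perfect reconstruction. The coefficient of \<open>c n * cnj (c (n + m))\<close> is \<open>\<Sum>p. cnj (h p) * h (p + m)\<close>
  over all \<open>p\<close> if \<open>m \<in> latt A\<close>, and cancels otherwise.\<close>

lemma filter_bank_energy:
  assumes c: "(\<lambda>n. (cmod (c n))\<^sup>2) summable_on UNIV"
  shows "((\<lambda>l. (cmod (lowpass c l))\<^sup>2 + (cmod (highpass c l))\<^sup>2) has_sum (\<Sum>\<^sub>\<infinity>n. (cmod (c n))\<^sup>2)) UNIV"
proof -
  define G where "G m n = c n * cnj (c (n + m))" for m n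
  have shift: "(\<lambda>n. (cmod (c (n + m)))\<^sup>2) summable_on UNIV" for m
    using c summable_on_reindex_bij_witness[of UNIV "\<lambda>n. n - m" "\<lambda>n. n + m" UNIV "\<lambda>n. (cmod (c n))\<^sup>2" "\<lambda>n. (cmod (c (n + m)))\<^sup>2"]
    by simp
  have Gabs: "(\<lambda>n. norm (G m n)) summable_on UNIV" for m
  proof (rule Infinite_Sum.abs_summable_on_comparison_test)
    show "(\<lambda>n. norm ((cmod (c n))\<^sup>2 + (cmod (c (n + m)))\<^sup>2)) summable_on UNIV"
      using summable_on_add[OF c shift] by simp
    fix n
    have "2 * (cmod (c n) * cmod (c (n + m))) \<le> (cmod (c n))\<^sup>2 + (cmod (c (n + m)))\<^sup>2"
      using sum_squares_bound[of "cmod (c n)" "cmod (c (n + m))"] by simp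
    moreover have "0 \<le> cmod (c n) * cmod (c (n + m))" by simp
    ultimately show "norm (G m n) \<le> norm ((cmod (c n))\<^sup>2 + (cmod (c (n + m)))\<^sup>2)"
      unfolding G_def norm_mult complex_mod_cnj real_norm_def by linarith
  qed
  have Gs: "G m summable_on S" for m S
    using summable_on_subset_banach[OF Infinite_Sum.abs_summable_summable[OF Gabs] subset_UNIV] .
  have Gl: "((\<lambda>l. G m (A *v l + x)) has_sum infsum (G m) (range (\<lambda>l. A *v l + x))) UNIV" for m x
  proof -
    have inj: "inj (\<lambda>l. A *v l + x)" by (auto simp: inj_on_def)
    show ?thesis
      using has_sum_infsum[OF Gs, of m "range (\<lambda>l. A *v l + x)"] has_sum_reindex[OF inj, of "G m"]
      by (simp add: o_def)
  qed
  have rng1: "range (\<lambda>l. A *v l + p) = (\<lambda>k. p - k) ` latt A" for p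
  proof -
    have "p - k \<in> range (\<lambda>l. A *v l + p)" if "k \<in> latt A" for k
      using latt_uminus[OF that] by (auto simp: latt_def image_iff)
    moreover have "A *v l + p \<in> (\<lambda>k. p - k) ` latt A" for l
      using latt_uminus[of "A *v l" A] by (intro image_eqI[where x="- (A *v l)"]) (auto simp: latt_def)
    ultimately show ?thesis by blast
  qed
  have rng2: "range (\<lambda>l. A *v l + (lA - p - m)) = (\<lambda>k. lA - m - p + k) ` latt A" for p m
    by (auto simp: latt_def image_iff algebra_simps)
  define H where "H m p = cnj (h p) * h (p + m) * (infsum (G m) (range (\<lambda>l. A *v l + p))
      + (if m \<in> latt A then 1 else -1) * infsum (G m) (range (\<lambda>l. A *v l + (lA - p - m))))" for m p
  have "complex_of_real ((cmod (lowpass c l))\<^sup>2 + (cmod (highpass c l))\<^sup>2)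
     = (\<Sum>p\<in>supp_h. \<Sum>m\<in>diffs. cnj (h p) * h (p + m) * (G m (A *v l + p)
       + (if m \<in> latt A then 1 else -1) * G m (A *v l + (lA - p - m))))" for l
  proof -
    have "complex_of_real ((cmod (lowpass c l))\<^sup>2 + (cmod (highpass c l))\<^sup>2)
        = lowpass c l * cnj (lowpass c l) + highpass c l * cnj (highpass c l)"
      by (simp only: of_real_add complex_norm_square)
    then show ?thesis
      unfolding lowpass_sq highpass_sq sum.distrib[symmetric] G_def
      by (simp only: distrib_left mult.assoc)
  qed
  moreover have "((\<lambda>l. \<Sum>p\<in>supp_h. \<Sum>m\<in>diffs. cnj (h p) * h (p + m) * (G m (A *v l + p)
       + (if m \<in> latt A then 1 else -1) * G m (A *v l + (lA - p - m))))
      has_sum (\<Sum>p\<in>supp_h. \<Sum>m\<in>diffs. H m p)) UNIV"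
    unfolding H_def by (intro has_sum_sum has_sum_cmult_right has_sum_add Gl)
  ultimately have hs: "((\<lambda>l. complex_of_real ((cmod (lowpass c l))\<^sup>2 + (cmod (highpass c l))\<^sup>2))
      has_sum (\<Sum>p\<in>supp_h. \<Sum>m\<in>diffs. H m p)) UNIV"
    by simp
  \<comment> \<open>For \<open>m\<close> in the lattice, \<open>cond1\<close> makes the two index
    progressions partition everything, so their sums join. For other \<open>m\<close>,
    \<open>cond2\<close> makes them equal, and the opposite signs cancel.\<close>
  have Heq: "(\<Sum>p\<in>supp_h. H m p) = (if m = 0 then infsum (G 0) UNIV else 0)" for m
  proof (cases "m \<in> latt A")
    case True
    have "H m p = cnj (h p * cnj (h (p + m))) * infsum (G m) UNIV" for p
    proof -
      note c1 = bspec[OF cond1 True, THEN spec, of p]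
      have "infsum (G m) (range (\<lambda>l. A *v l + p)) + infsum (G m) (range (\<lambda>l. A *v l + (lA - p - m)))
        = infsum (G m) (range (\<lambda>l. A *v l + p) \<union> range (\<lambda>l. A *v l + (lA - p - m)))"
        unfolding rng2 unfolding rng1 by (intro infsum_Un_disjoint[symmetric] Gs conjunct2[OF c1])
      also have "range (\<lambda>l. A *v l + p) \<union> range (\<lambda>l. A *v l + (lA - p - m)) = UNIV"
        unfolding rng2 unfolding rng1 by (rule conjunct1[OF c1, symmetric])
      finally show ?thesis using True by (simp add: H_def)
    qed
    then have "(\<Sum>p\<in>supp_h. H m p) = cnj (\<Sum>p\<in>supp_h. h p * cnj (h (p + m))) * infsum (G m) UNIV"
      by (simp add: sum_distrib_right)
    then show ?thesis by (simp only: orth_sum[OF True]) simp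
  next
    case False
    then have "m \<in> (\<lambda>k. lA + k) ` latt A" using UNIV_I[of m] by (subst (asm) part) simp
    then have "range (\<lambda>l. A *v l + p) = range (\<lambda>l. A *v l + (lA - p - m))" for p
      unfolding rng2 unfolding rng1 by (rule bspec[OF cond2, THEN spec])
    then have "H m p = 0" for p using False by (simp add: H_def)
    moreover have "m \<noteq> 0" using False latt_zero by auto
    ultimately show ?thesis by simp
  qed
  have "(\<Sum>p\<in>supp_h. \<Sum>m\<in>diffs. H m p) = (\<Sum>m\<in>diffs. \<Sum>p\<in>supp_h. H m p)" by (rule sum.swap)
  also have "\<dots> = infsum (G 0) UNIV"
    unfolding Heq using zero_in_diffs by simp
  also have "\<dots> = (\<Sum>\<^sub>\<infinity>n. complex_of_real ((cmod (c n))\<^sup>2))"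
    unfolding G_def by (simp add: complex_norm_square del: of_real_power)
  also have "\<dots> = complex_of_real (\<Sum>\<^sub>\<infinity>n. (cmod (c n))\<^sup>2)"
    by (rule infsumI) (rule has_sum_of_real[OF has_sum_infsum[OF c]])
  finally show ?thesis using hs by (simp only: has_sum_of_real_iff)
qed

end

subsection \<open>Energy of the approximation coefficients\<close>

lemma sum_le_nn_integral_count_space:
  fixes f :: "'a \<Rightarrow> ennreal"
  assumes "finite F"
  shows "sum f F \<le> (\<integral>\<^sup>+x. f x \<partial>count_space UNIV)"
proof -
  have "sum f F = (\<integral>\<^sup>+x. f x * indicator F x \<partial>count_space UNIV)"
    using assms by (subst nn_integral_count_space'[of F]) (auto simp: indicator_def)
  also have "\<dots> \<le> (\<integral>\<^sup>+x. f x \<partial>count_space UNIV)"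
    by (intro nn_integral_mono) (auto simp: indicator_def)
  finally show ?thesis .
qed

context dilation_lattice
begin

lemma funpow_dil_inv: "(dil_inv A ^^ J) f t = f ((((*v) Ri) ^^ J) t) / of_real (sqrt 2 ^ J)"
  by (induction J arbitrary: t) (simp_all add: dil_inv_def funpow_swap1[of "(*v) Ri"])

lemma funpow_dil: "(dil A ^^ J) f t = of_real (sqrt 2 ^ J) * f ((((*v) R) ^^ J) t)"
  by (induction J arbitrary: t) (simp_all add: dil_def funpow_swap1[of "(*v) R"])

lemma sq_int_dil_pow: "sq_int f \<Longrightarrow> sq_int (dil_pow A n f)"
proof -
  assume f: "sq_int f"
  have "sq_int ((dil A ^^ j) f)" "sq_int ((dil_inv A ^^ j) f)" for j
    using f by (induction j) (auto intro: sq_int_dil sq_int_dil_inv)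
  then show ?thesis by (simp add: dil_pow_def)
qed

lemma L2_norm_dil_pow:
  assumes f: "sq_int f"
  shows "L2_norm (dil_pow A n f) = L2_norm f"
proof -
  have "sq_int ((dil A ^^ j) f) \<and> L2_norm ((dil A ^^ j) f) = L2_norm f" for j
    by (induction j) (auto simp: f L2_norm_dil intro: sq_int_dil)
  moreover have "sq_int ((dil_inv A ^^ j) f) \<and> L2_norm ((dil_inv A ^^ j) f) = L2_norm f" for j
    by (induction j) (auto simp: f L2_norm_dil_inv intro: sq_int_dil_inv)
  ultimately show ?thesis by (simp add: dil_pow_def)
qed

lemma dil_pow_diff: "dil_pow A n (\<lambda>t. f t - g t) = (\<lambda>t. dil_pow A n f t - dil_pow A n g t)"
  by (auto simp: dil_pow_def fun_eq_iff funpow_dil funpow_dil_inv right_diff_distrib diff_divide_distrib)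

lemma L2_inner_dil_pow:
  assumes f: "sq_int f" and g: "sq_int g"
  shows "L2_inner f (dil_pow A n g) = L2_inner (dil_pow A (- n) f) g"
proof -
  have 1: "sq_int f' \<Longrightarrow> L2_inner f' ((dil A ^^ j) g) = L2_inner ((dil_inv A ^^ j) f') g" for j f'
  proof (induction j arbitrary: f')
    case (Suc j)
    have "sq_int ((dil A ^^ j) g)" using sq_int_dil_pow[OF g, of "int j"] by (simp add: dil_pow_def)
    then have "L2_inner f' ((dil A ^^ Suc j) g) = L2_inner (dil_inv A f') ((dil A ^^ j) g)"
      by (simp add: L2_inner_dil Suc.prems)
    also have "\<dots> = L2_inner ((dil_inv A ^^ j) (dil_inv A f')) g"
      by (rule Suc.IH[OF sq_int_dil_inv[OF Suc.prems]])
    finally show ?case by (simp add: funpow_swap1)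
  qed simp
  have 2: "sq_int f' \<Longrightarrow> L2_inner f' ((dil_inv A ^^ j) g) = L2_inner ((dil A ^^ j) f') g" for j f'
  proof (induction j arbitrary: f')
    case (Suc j)
    have "sq_int ((dil_inv A ^^ j) g)"
      using sq_int_dil_pow[OF g, of "- int j"] by (cases "j = 0") (auto simp: dil_pow_def g)
    then have "L2_inner f' ((dil_inv A ^^ Suc j) g) = L2_inner (dil A f') ((dil_inv A ^^ j) g)"
      by (simp add: L2_inner_dil_inv Suc.prems)
    also have "\<dots> = L2_inner ((dil A ^^ j) (dil A f')) g"
      by (rule Suc.IH[OF sq_int_dil[OF Suc.prems]])
    finally show ?case by (simp add: funpow_swap1)
  qed simp
  show ?thesis
    using 1[OF f] 2[OF f] by (cases "n = 0") (auto simp: dil_pow_def)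
qed

lemma dil_inv_dil_pow: "dil_inv A (dil_pow A (- n) f) = dil_pow A (- (n + 1)) f"
proof (cases n rule: int_cases)
  case (nonneg j)
  have "nat (1 + int j) = Suc j" by simp
  then show ?thesis using nonneg by (cases "j = 0") (auto simp: dil_pow_def)
next
  case (neg j)
  have "nat (int j + 1) = Suc j" by simp
  then show ?thesis using neg by (simp add: dil_pow_def)
qed

end

locale refinable_function = wavelet_filter A lA h N0 qA
  for A :: "int^'d^'d" and lA h N0 qA +
  fixes \<phi> :: "real^'d \<Rightarrow> complex"
  assumes phi: "fourier_L2 \<phi> (gfun A h N0)"
begin

lemma sq_int_phi: "sq_int \<phi>"
  using phi by (simp add: fourier_L2_def)

definition coef :: "(real^'d \<Rightarrow> complex) \<Rightarrow> int^'d \<Rightarrow> complex" where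
  "coef f l = L2_inner f (transl l \<phi>)"

lemma coef_tendsto:
  assumes "sq_int f"
  shows "(\<lambda>n. L2_inner f (transl l (cascade n))) \<longlonglongrightarrow> coef f l"
  using cascade_weak_limit[OF phi sq_int_transl[OF assms, of "- l"]]
  by (simp add: coef_def L2_inner_transl assms sq_int_cascade sq_int_phi)

lemma coef_diff: "sq_int f \<Longrightarrow> sq_int g \<Longrightarrow> coef (\<lambda>t. f t - g t) l = coef f l - coef g l"
  unfolding coef_def by (intro L2_inner_diff_left sq_int_transl sq_int_phi)

text \<open>The refinement equation in tested form: the identity between consecutive cascade
  functions is passed to the weak limit, which commutes with the finite filter sum.\<close>

lemma coef_refinement:
  assumes f: "sq_int f"
  shows "coef f l = lowpass (coef (dil_inv A f)) l"
proof (rule LIMSEQ_unique)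
  show "(\<lambda>n. L2_inner f (transl l (cascade (Suc n)))) \<longlonglongrightarrow> coef f l"
    by (rule LIMSEQ_Suc[OF coef_tendsto[OF f]])
  have "L2_inner f (transl l (cascade (Suc n)))
      = (\<Sum>k\<in>supp_h. cnj (h k) * L2_inner (dil_inv A f) (transl (A *v l + k) (cascade n)))" for n
    unfolding cascade_Suc transl_refine
    by (subst L2_inner_sum_right)
       (auto intro!: sq_int_cmult sq_int_dil sq_int_transl sq_int_cascade f
             simp: L2_inner_cmult_right L2_inner_dil sq_int_transl sq_int_cascade f)
  then show "(\<lambda>n. L2_inner f (transl l (cascade (Suc n)))) \<longlonglongrightarrow> lowpass (coef (dil_inv A f)) l"
    unfolding lowpass_def by (simp only:) (intro tendsto_intros coef_tendsto sq_int_dil_inv f)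
qed

text \<open>Each cascade function satisfies Bessel's inequality by orthonormality, and the
  inequality, unlike orthonormality, is inherited by weak limits.\<close>

lemma coef_Bessel_finite:
  assumes f: "sq_int f" and F: "finite F"
  shows "(\<Sum>l\<in>F. (cmod (coef f l))\<^sup>2) \<le> (L2_norm f)\<^sup>2"
proof (rule LIMSEQ_le_const2)
  show "(\<lambda>n. \<Sum>l\<in>F. (cmod (L2_inner f (transl l (cascade n))))\<^sup>2) \<longlonglongrightarrow> (\<Sum>l\<in>F. (cmod (coef f l))\<^sup>2)"
    by (intro tendsto_intros coef_tendsto f)
  show "\<exists>N. \<forall>n\<ge>N. (\<Sum>l\<in>F. (cmod (L2_inner f (transl l (cascade n))))\<^sup>2) \<le> (L2_norm f)\<^sup>2"
    by (intro exI allI impI L2_Bessel_finite f F sq_int_transl sq_int_cascade cascade_orthonormal)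
qed

text \<open>The functional E of the overview. A divergent infinite sum would be 0, so its upper and
  lower bounds rely on \<open>coef_summable\<close>.\<close>

definition energy :: "(real^'d \<Rightarrow> complex) \<Rightarrow> real" where
  "energy f = (\<Sum>\<^sub>\<infinity>l. (cmod (coef f l))\<^sup>2)"

lemma coef_summable:
  assumes "sq_int f" shows "(\<lambda>l. (cmod (coef f l))\<^sup>2) summable_on UNIV"
  by (rule nonneg_bdd_above_summable_on)
     (auto intro!: bdd_aboveI2[where M="(L2_norm f)\<^sup>2"] coef_Bessel_finite assms)

lemma energy_nonneg: "0 \<le> energy f"
  unfolding energy_def by (intro infsum_nonneg) auto

lemma finite_sum_le_energy:
  assumes "sq_int f" "finite F" shows "(\<Sum>l\<in>F. (cmod (coef f l))\<^sup>2) \<le> energy f"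
  unfolding energy_def by (rule finite_sum_le_infsum[OF coef_summable]) (use assms in auto)

lemma energy_leI:
  assumes "sq_int f" "\<And>F. finite F \<Longrightarrow> (\<Sum>l\<in>F. (cmod (coef f l))\<^sup>2) \<le> b"
  shows "energy f \<le> b"
  unfolding energy_def by (rule infsum_le_finite_sums[OF coef_summable]) (use assms in auto)

lemma energy_le: "sq_int f \<Longrightarrow> energy f \<le> (L2_norm f)\<^sup>2"
  by (intro energy_leI coef_Bessel_finite)

text \<open>Minkowski's inequality for square sums together with Bessel. It makes the square root of
  the energy 1-Lipschitz in the L2 norm, which is what the density arguments need.\<close>

lemma sqrt_energy_triangle:
  assumes f: "sq_int f" and g: "sq_int g"
  shows "sqrt (energy f) \<le> sqrt (energy g) + L2_norm (\<lambda>t. f t - g t)"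
proof -
  have "energy f \<le> (sqrt (energy g) + L2_norm (\<lambda>t. f t - g t))\<^sup>2"
  proof (rule energy_leI[OF f])
    fix F :: "(int^'d) set" assume F: "finite F"
    have "L2_set (\<lambda>l. cmod (coef f l)) F \<le> L2_set (\<lambda>l. cmod (coef g l) + cmod (coef (\<lambda>t. f t - g t) l)) F"
    proof (rule L2_set_mono)
      fix l
      show "cmod (coef f l) \<le> cmod (coef g l) + cmod (coef (\<lambda>t. f t - g t) l)"
        using norm_triangle_sub[of "coef f l" "coef g l"] by (simp add: coef_diff f g)
    qed simp
    also have "\<dots> \<le> L2_set (\<lambda>l. cmod (coef g l)) F + L2_set (\<lambda>l. cmod (coef (\<lambda>t. f t - g t) l)) F"
      by (rule L2_set_triangle_ineq)
    also have "\<dots> \<le> sqrt (energy g) + sqrt ((L2_norm (\<lambda>t. f t - g t))\<^sup>2)"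
      unfolding L2_set_def
      by (intro add_mono real_sqrt_le_mono finite_sum_le_energy coef_Bessel_finite g F sq_int_diff f)
    finally have "L2_set (\<lambda>l. cmod (coef f l)) F \<le> sqrt (energy g) + L2_norm (\<lambda>t. f t - g t)" by simp
    then have "(L2_set (\<lambda>l. cmod (coef f l)) F)\<^sup>2 \<le> (sqrt (energy g) + L2_norm (\<lambda>t. f t - g t))\<^sup>2"
      by (rule power_mono) simp
    then show "(\<Sum>l\<in>F. (cmod (coef f l))\<^sup>2) \<le> (sqrt (energy g) + L2_norm (\<lambda>t. f t - g t))\<^sup>2"
      by (simp add: L2_set_def sum_nonneg)
  qed
  then have "sqrt (energy f) \<le> sqrt ((sqrt (energy g) + L2_norm (\<lambda>t. f t - g t))\<^sup>2)"
    by (rule real_sqrt_le_mono)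
  then show ?thesis by (simp add: energy_nonneg)
qed

definition wavelet :: "real^'d \<Rightarrow> complex" where
  "wavelet t = (\<Sum>\<^sub>\<infinity>k. (-1) powi (dotz qA k) * cnj (h (lA - k)) * dil A (transl k \<phi>) t)"

text \<open>The substitution k = lA - n makes the sum finite and gives it the indexing of
  \<open>highpass\<close>.\<close>

lemma wavelet_eq: "wavelet t = (\<Sum>n\<in>supp_h. sgn_q (lA - n) * cnj (h n) * dil A (transl (lA - n) \<phi>) t)"
proof -
  let ?w = "\<lambda>k. sgn_q k * cnj (h (lA - k)) * dil A (transl k \<phi>) t"
  have inj: "inj_on (\<lambda>n. lA - n) supp_h" by (auto simp: inj_on_def)
  have "wavelet t = infsum ?w ((\<lambda>n. lA - n) ` supp_h)"
    unfolding wavelet_def sgn_q_def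
  proof (rule infsum_cong_neutral)
    fix k assume "k \<in> UNIV - (\<lambda>n. lA - n) ` supp_h"
    then have "lA - k \<notin> supp_h" by (auto simp: image_iff algebra_simps)
    then show "(- 1) powi dotz qA k * cnj (h (lA - k)) * dil A (transl k \<phi>) t = 0" by (simp add: h_outside)
  qed auto
  also have "\<dots> = sum ?w ((\<lambda>n. lA - n) ` supp_h)" by simp
  also have "\<dots> = (\<Sum>n\<in>supp_h. ?w (lA - n))" by (simp add: sum.reindex[OF inj])
  finally show ?thesis by simp
qed

lemma sq_int_wavelet: "sq_int wavelet"
  unfolding wavelet_eq[abs_def] by (intro sq_int_sum sq_int_cmult sq_int_dil sq_int_transl sq_int_phi)

lemma coef_wavelet:
  assumes f: "sq_int f"
  shows "L2_inner f (transl l wavelet) = highpass (coef (dil_inv A f)) l"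
proof -
  have "transl l wavelet = (\<lambda>t. \<Sum>n\<in>supp_h. sgn_q (lA - n) * cnj (h n) * dil A (transl (A *v l + (lA - n)) \<phi>) t)"
  proof
    fix t
    have "transl l wavelet t = (\<Sum>n\<in>supp_h. sgn_q (lA - n) * cnj (h n) * transl l (dil A (transl (lA - n) \<phi>)) t)"
      by (simp add: transl_def wavelet_eq)
    then show "transl l wavelet t = (\<Sum>n\<in>supp_h. sgn_q (lA - n) * cnj (h n) * dil A (transl (A *v l + (lA - n)) \<phi>) t)"
      by (simp add: transl_dil transl_transl)
  qed
  then show ?thesis
    unfolding highpass_def coef_def
    by (simp only:, subst L2_inner_sum_right)
       (auto intro!: sq_int_cmult sq_int_dil sq_int_transl sq_int_phi f
             simp: L2_inner_cmult_right L2_inner_dil sq_int_transl sq_int_phi f)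
qed

text \<open>Perfect reconstruction minus the low-pass energy: one term of the later telescoping
  sum.\<close>

lemma wavelet_energy_step:
  assumes f: "sq_int f"
  shows "((\<lambda>l. (cmod (L2_inner f (transl l wavelet)))\<^sup>2) has_sum (energy (dil_inv A f) - energy f)) UNIV"
proof -
  have "((\<lambda>l. ((cmod (coef f l))\<^sup>2 + (cmod (L2_inner f (transl l wavelet)))\<^sup>2) + (-1) * (cmod (coef f l))\<^sup>2)
      has_sum (energy (dil_inv A f) + (-1) * energy f)) UNIV"
  proof (intro has_sum_add has_sum_cmult_right)
    show "((\<lambda>l. (cmod (coef f l))\<^sup>2 + (cmod (L2_inner f (transl l wavelet)))\<^sup>2) has_sum energy (dil_inv A f)) UNIV"
      unfolding coef_refinement[OF f] coef_wavelet[OF f] energy_def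
      by (rule filter_bank_energy[OF coef_summable[OF sq_int_dil_inv[OF f]]])
    show "((\<lambda>l. (cmod (coef f l))\<^sup>2) has_sum energy f) UNIV"
      unfolding energy_def by (rule has_sum_infsum[OF coef_summable[OF f]])
  qed
  then show ?thesis by simp
qed

end

subsection \<open>Limits of the energies\<close>

lemma ucube_diff_iff: "t - rvec l \<in> ucube \<longleftrightarrow> l = (\<chi> j. \<lfloor>t$j\<rfloor>)"
proof -
  have "t - rvec l \<in> ucube \<longleftrightarrow> - l = (\<chi> j. - \<lfloor>t$j\<rfloor>)"
    using ucube_translate_iff[of t "- l"] by (simp add: rvec_uminus)
  then show ?thesis by (simp add: vec_eq_iff)
qed

lemma sum_indicator_ucube:
  fixes f :: "int^'d \<Rightarrow> 'a::semiring_1"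
  assumes "finite S"
  shows "(\<Sum>l\<in>S. f l * indicator ucube (t - rvec l))
    = (if (\<chi> j. \<lfloor>t$j\<rfloor>) \<in> S then f (\<chi> j. \<lfloor>t$j\<rfloor>) else 0)"
proof -
  have "(\<Sum>l\<in>S. f l * indicator ucube (t - rvec l)) = (\<Sum>l\<in>S. if l = (\<chi> j. \<lfloor>t$j\<rfloor>) then f l else 0)"
    by (intro sum.cong refl) (simp add: indicator_def ucube_diff_iff)
  then show ?thesis using assms by simp
qed

lemma indicator_ucube_translate:
  fixes l :: "int^'d"
  shows "integrable lborel (\<lambda>t. indicator ucube (t - rvec l) :: real)"
    and "(LINT t|lborel. indicator ucube (t - rvec l) :: real) = 1"
proof -
  have "integrable lborel (indicator (ucube :: (real^'d) set) :: _ \<Rightarrow> real)"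
    by (intro integrable_real_indicator) auto
  then show "integrable lborel (\<lambda>t. indicator ucube (t - rvec l) :: real)"
    using integral_lborel_translate(2)[of "indicator ucube :: real^'d \<Rightarrow> real" "- rvec l"] by simp
  show "(LINT t|lborel. indicator ucube (t - rvec l) :: real) = 1"
    using integral_lborel_translate(1)[of "indicator ucube :: real^'d \<Rightarrow> real" "- rvec l"]
    by (simp add: measure_def)
qed

context refinable_function
begin

text \<open>The dilated function lives in a ball shrinking to the origin. By Cauchy-Schwarz its
  energy is at most its squared norm times the integral over that ball of the periodized |\<phi>|^2.
  That function is integrable over a unit cell, so the integral tends to 0.\<close>

lemma energy_dil_tendsto_0:
  assumes e: "sq_int e" and supp: "\<And>x. \<rho> < norm x \<Longrightarrow> e x = 0"
  shows "(\<lambda>J. energy ((dil A ^^ J) e)) \<longlonglongrightarrow> 0"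
proof -
  let ?q = "\<lambda>l t. ennreal ((cmod (\<phi> (t - rvec l)))\<^sup>2)"
  let ?n = "\<lambda>t. ennreal ((cmod (\<phi> t))\<^sup>2)"
  obtain C r where C: "0 \<le> C" "0 < r" "r < 1"
    "\<And>j x. norm ((((*v) Ri) ^^ j) x) \<le> C * r ^ j * norm x" using Ri_decay by blast
  have [measurable]: "\<phi> \<in> borel_measurable borel" by (rule sq_int_measurable[OF sq_int_phi])
  \<comment> \<open>The radius of the ball that contains the support after \<open>J\<close>
    dilations; nothing forces \<rho> to be nonnegative, hence the maximum.\<close>
  define \<delta> where "\<delta> J = C * r ^ J * max \<rho> 0" for J
  have \<delta>lim: "\<delta> \<longlonglongrightarrow> 0"
    unfolding \<delta>_def using C by (intro tendsto_mult_left_zero tendsto_mult_right_zero LIMSEQ_power_zero) auto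
  define P where "P t = (\<integral>\<^sup>+l. ?q l t \<partial>count_space UNIV)" for t
  \<comment> \<open>Shifting by one half in every coordinate centres the unit cell at the origin, so
    it contains the ball of radius 1/4.\<close>
  define \<eta> :: "real^'d" where "\<eta> = (\<chi> i. 1/2)"
  define w where "w t = indicator ucube (t + \<eta>) * P t" for t
  \<comment> \<open>Capping the radius at 1/4 makes \<open>w\<close> dominate for every
    \<open>J\<close>; once \<open>\<delta> J\<close> is at most 1/4 the cap has no effect.\<close>
  define u where "u J t = indicator (cball 0 (min (\<delta> J) (1/4))) t * P t" for J and t :: "real^'d"
  have [measurable]: "P \<in> borel_measurable borel"
  proof -
    have "(\<lambda>t. \<integral>\<^sup>+l. (\<lambda>(t, l). ?q l t) (t, l) \<partial>count_space UNIV) \<in> borel_measurable borel"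
      by (rule sigma_finite_measure.borel_measurable_nn_integral_fst[OF sigma_finite_measure_count_space])
         (rule measurable_pair_swap[where f="\<lambda>(l, t). ?q l t", simplified],
          rule measurable_pair_measure_countable1, auto)
    then show ?thesis unfolding P_def by simp
  qed
  have [measurable]: "u J \<in> borel_measurable borel" for J
    unfolding u_def by (intro borel_measurable_times_ennreal borel_measurable_indicator) simp_all
  have [measurable]: "w \<in> borel_measurable borel"
    unfolding w_def by measurable
  have w_int: "(\<integral>\<^sup>+t. w t \<partial>lborel) = ennreal ((L2_norm \<phi>)\<^sup>2)"
  proof -
    have "(\<integral>\<^sup>+t. w t \<partial>lborel)
        = (\<integral>\<^sup>+t. (\<integral>\<^sup>+l. indicator ucube (t + \<eta>) * ?q l t \<partial>count_space UNIV) \<partial>lborel)"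
      unfolding w_def P_def by (simp add: nn_integral_cmult)
    also have "\<dots> = (\<integral>\<^sup>+l. (\<integral>\<^sup>+t. indicator ucube (t + \<eta>) * ?q l t \<partial>lborel) \<partial>count_space UNIV)"
      by (rule nn_integral_count_space_swap[symmetric]) measurable
    also have "\<dots> = (\<integral>\<^sup>+l. (\<integral>\<^sup>+t. ?n t * indicator ucube ((t + \<eta>) + rvec l) \<partial>lborel) \<partial>count_space UNIV)"
    proof (rule nn_integral_cong)
      fix l :: "int^'d"
      show "(\<integral>\<^sup>+t. indicator ucube (t + \<eta>) * ?q l t \<partial>lborel)
        = (\<integral>\<^sup>+t. ?n t * indicator ucube ((t + \<eta>) + rvec l) \<partial>lborel)"
        by (subst nn_integral_lborel_translate[where c="rvec l", symmetric]) (auto simp: algebra_simps)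
    qed
    also have "\<dots> = (\<integral>\<^sup>+t. (\<integral>\<^sup>+l. ?n t * indicator ucube ((t + \<eta>) + rvec l) \<partial>count_space UNIV) \<partial>lborel)"
      by (rule nn_integral_count_space_swap) measurable
    also have "\<dots> = (\<integral>\<^sup>+t. ?n t \<partial>lborel)"
    proof (rule nn_integral_cong)
      fix t
      have "(\<integral>\<^sup>+l. ?n t * indicator ucube ((t + \<eta>) + rvec l) \<partial>count_space UNIV)
        = (\<integral>\<^sup>+l. (if l = (\<chi> j. - \<lfloor>(t + \<eta>)$j\<rfloor>) then ?n t else 0) \<partial>count_space UNIV)"
        by (intro nn_integral_cong) (simp add: indicator_def ucube_translate_iff)
      then show "(\<integral>\<^sup>+l. ?n t * indicator ucube ((t + \<eta>) + rvec l) \<partial>count_space UNIV)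
        = ?n t"
        by (simp only: nn_integral_count_singleton)
    qed
    also have "\<dots> = ennreal ((L2_norm \<phi>)\<^sup>2)"
      unfolding L2_norm_sq by (rule nn_integral_eq_integral[OF sq_int_integrable_norm2[OF sq_int_phi]]) simp
    finally show ?thesis .
  qed
  have u_le: "u J t \<le> w t" for J t
  proof (cases "norm t \<le> 1/4")
    case True
    have "\<bar>t$i\<bar> \<le> 1/4" for i using component_le_norm_cart[of t i] True by linarith
    then have "t + \<eta> \<in> ucube" by (auto simp: ucube_def \<eta>_def abs_le_iff)
        (smt (verit) field_sum_of_halves)+
    then show ?thesis by (auto simp: u_def w_def indicator_def)
  qed (auto simp: u_def)
  have "(\<lambda>J. \<integral>\<^sup>+t. u J t \<partial>lborel) \<longlonglongrightarrow> (\<integral>\<^sup>+t. 0 \<partial>(lborel :: (real^'d) measure))"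
  proof (rule nn_integral_dominated_convergence)
    show "AE t in lborel. u J t \<le> w t" for J using u_le by simp
    show "(\<integral>\<^sup>+t. w t \<partial>lborel) < \<infinity>" by (simp add: w_int)
    \<comment> \<open>Every point other than the origin eventually leaves the shrinking balls, and
      the origin is a null set.\<close>
    show "AE t in lborel. (\<lambda>J. u J t) \<longlonglongrightarrow> 0"
      using AE_lborel_singleton[of "0::real^'d"]
    proof eventually_elim
      case (elim t)
      then have "\<forall>\<^sub>F J in sequentially. \<delta> J < norm t"
        by (intro order_tendstoD(2)[OF \<delta>lim]) simp
      then have "\<forall>\<^sub>F J in sequentially. u J t = 0"
        by eventually_elim (auto simp: u_def)
      then show ?case by (rule tendsto_eventually)
    qed
  qed simp_all
  then have ulim: "(\<lambda>J. \<integral>\<^sup>+t. u J t \<partial>lborel) \<longlonglongrightarrow> 0" by simp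
  have ufin: "(\<integral>\<^sup>+t. u J t \<partial>lborel) < \<infinity>" for J
    using nn_integral_mono[of lborel "u J" w] u_le w_int by (simp add: le_less_trans)
  have bound: "energy ((dil A ^^ J) e) \<le> (L2_norm e)\<^sup>2 * enn2real (\<integral>\<^sup>+t. u J t \<partial>lborel)" if "\<delta> J \<le> 1/4" for J
  proof -
    define E where "E = (dil A ^^ J) e"
    have E: "sq_int E" "L2_norm E = L2_norm e"
      using sq_int_dil_pow[OF e, of "int J"] L2_norm_dil_pow[OF e, of "int J"]
      by (simp_all add: E_def dil_pow_def)
    let ?B = "cball (0::real^'d) (\<delta> J)"
    have [measurable]: "?B \<in> sets borel" by simp
    have Esupp: "E t = 0" if "t \<notin> ?B" for t
    proof (rule ccontr)
      assume "E t \<noteq> 0"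
      then have y: "norm ((((*v) R) ^^ J) t) \<le> \<rho>"
        using supp[of "(((*v) R) ^^ J) t"] by (force simp: E_def funpow_dil)
      have "(((*v) Ri) ^^ J) ((((*v) R) ^^ J) t) = t"
        by (induction J) (simp_all add: funpow_swap1[of "(*v) Ri"])
      then have "norm t \<le> C * r ^ J * norm ((((*v) R) ^^ J) t)"
        using C(4)[of J "(((*v) R) ^^ J) t"] by simp
      also have "\<dots> \<le> C * r ^ J * max \<rho> 0" using y C(1,2) by (intro mult_left_mono) auto
      finally have "norm t \<le> C * r ^ J * max \<rho> 0" .
      then show False using that by (simp add: \<delta>_def)
    qed
    have cl: "ennreal ((cmod (coef E l))\<^sup>2)
        \<le> ennreal ((L2_norm e)\<^sup>2) * (\<integral>\<^sup>+t. indicator ?B t * ?q l t \<partial>lborel)" for l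
    proof -
      define p where "p t = transl l \<phi> t * indicator ?B t" for t
      have p: "sq_int p" unfolding p_def by (intro sq_int_mult_indicator sq_int_transl sq_int_phi) simp
      have "coef E l = L2_inner E p"
        unfolding coef_def L2_inner_def p_def
        by (intro Bochner_Integration.integral_cong refl) (auto simp: indicator_def Esupp)
      then have "(cmod (coef E l))\<^sup>2 \<le> (L2_norm e * L2_norm p)\<^sup>2"
        using L2_Cauchy_Schwarz[OF E(1) p] E(2) by (intro power_mono) auto
      then have "ennreal ((cmod (coef E l))\<^sup>2) \<le> ennreal ((L2_norm e)\<^sup>2) * ennreal ((L2_norm p)\<^sup>2)"
        by (simp add: power_mult_distrib ennreal_mult[symmetric] ennreal_leI)
      also have "ennreal ((L2_norm p)\<^sup>2) = (\<integral>\<^sup>+t. ennreal ((cmod (p t))\<^sup>2) \<partial>lborel)"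
        unfolding L2_norm_sq by (rule nn_integral_eq_integral[symmetric, OF sq_int_integrable_norm2[OF p]]) simp
      also have "\<dots> = (\<integral>\<^sup>+t. indicator ?B t * ?q l t \<partial>lborel)"
        by (intro nn_integral_cong) (auto simp: p_def transl_def indicator_def)
      finally show ?thesis .
    qed
    have "energy E \<le> (L2_norm e)\<^sup>2 * enn2real (\<integral>\<^sup>+t. u J t \<partial>lborel)"
    proof (rule energy_leI[OF E(1)])
      fix F :: "(int^'d) set" assume F: "finite F"
      have "ennreal (\<Sum>l\<in>F. (cmod (coef E l))\<^sup>2) = (\<Sum>l\<in>F. ennreal ((cmod (coef E l))\<^sup>2))"
        by simp
      also have "\<dots> \<le> (\<Sum>l\<in>F. ennreal ((L2_norm e)\<^sup>2) * (\<integral>\<^sup>+t. indicator ?B t * ?q l t \<partial>lborel))"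
        by (intro sum_mono cl)
      also have "\<dots> = ennreal ((L2_norm e)\<^sup>2) * (\<Sum>l\<in>F. (\<integral>\<^sup>+t. indicator ?B t * ?q l t \<partial>lborel))"
        by (simp only: sum_distrib_left)
      also have "\<dots> \<le> ennreal ((L2_norm e)\<^sup>2) * (\<integral>\<^sup>+l. (\<integral>\<^sup>+t. indicator ?B t * ?q l t \<partial>lborel) \<partial>count_space UNIV)"
        by (intro mult_left_mono sum_le_nn_integral_count_space F) simp
      also have "(\<integral>\<^sup>+l. (\<integral>\<^sup>+t. indicator ?B t * ?q l t \<partial>lborel) \<partial>count_space UNIV)
          = (\<integral>\<^sup>+t. (\<integral>\<^sup>+l. indicator ?B t * ?q l t \<partial>count_space UNIV) \<partial>lborel)"
        by (rule nn_integral_count_space_swap) measurable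
      also have "\<dots> = (\<integral>\<^sup>+t. u J t \<partial>lborel)"
        using that by (simp add: u_def P_def nn_integral_cmult min_absorb1)
      also have "\<dots> = ennreal (enn2real (\<integral>\<^sup>+t. u J t \<partial>lborel))"
        using ufin[of J] by simp
      finally have "ennreal (\<Sum>l\<in>F. (cmod (coef E l))\<^sup>2) \<le> ennreal ((L2_norm e)\<^sup>2 * enn2real (\<integral>\<^sup>+t. u J t \<partial>lborel))"
        by (simp only: ennreal_mult zero_le_power2 enn2real_nonneg)
      then show "(\<Sum>l\<in>F. (cmod (coef E l))\<^sup>2) \<le> (L2_norm e)\<^sup>2 * enn2real (\<integral>\<^sup>+t. u J t \<partial>lborel)"
        by (subst (asm) ennreal_le_iff) (auto intro: mult_nonneg_nonneg)
    qed
    then show ?thesis by (simp only: E_def)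
  qed
  have "(\<lambda>J. enn2real (\<integral>\<^sup>+t. u J t \<partial>lborel)) \<longlonglongrightarrow> 0"
    by (rule tendsto_enn2real) (use ulim in simp_all)
  then have lim: "(\<lambda>J. (L2_norm e)\<^sup>2 * enn2real (\<integral>\<^sup>+t. u J t \<partial>lborel)) \<longlonglongrightarrow> 0"
    by (rule tendsto_mult_right_zero)
  have "\<forall>\<^sub>F J in sequentially. \<delta> J < 1/4" by (intro order_tendstoD(2)[OF \<delta>lim]) simp
  then have "\<forall>\<^sub>F J in sequentially. norm (energy ((dil A ^^ J) e)) \<le> (L2_norm e)\<^sup>2 * enn2real (\<integral>\<^sup>+t. u J t \<partial>lborel)"
    by eventually_elim (use bound energy_nonneg in auto)
  then show ?thesis by (rule Lim_null_comparison[OF _ lim])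
qed

text \<open>The stretched function \<open>g\<close> varies slowly, so on each lattice cube it is
  close to the corresponding coefficient. It is therefore L2-close to the step function with these
  coefficients as values, whose squared norm is a partial sum of the energy.\<close>

lemma energy_dil_inv_ge:
  assumes cont: "continuous_on UNIV e" and supp: "\<And>x. \<rho> < norm x \<Longrightarrow> e x = 0" and "0 < \<epsilon>"
  shows "\<forall>\<^sub>F J in sequentially. L2_norm e - \<epsilon> \<le> sqrt (energy ((dil_inv A ^^ J) e))"
proof -
  have e: "sq_int e" by (rule continuous_compact_support_sq_int[OF cont supp])
  obtain C r where C: "0 \<le> C" "0 < r" "r < 1"
    "\<And>j x. norm ((((*v) Ri) ^^ j) x) \<le> C * r ^ j * norm x" using Ri_decay by blast
  obtain \<kappa> where \<kappa>: "0 < \<kappa>" "real CARD('d) \<le> \<kappa>" "\<And>n t. \<kappa> < norm t \<Longrightarrow> cascade n t = 0"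
    using cascade_support by blast
  \<comment> \<open>\<open>W\<close> bounds the L1 norms of all cascade functions. \<open>V\<close>
    is the volume of a ball that contains the images under the \<open>J\<close>-th iterate of
    \<open>Ri\<close> of all cubes needed. \<omega> is fitted so that the final error \<omega> W
    sqrt V is at most \<epsilon>.\<close>
  define W where "W = L2_norm (indicator (cball 0 \<kappa>) :: real^'d \<Rightarrow> complex)"
  define \<iota> where "\<iota> = (indicator (cball 0 (\<rho> + 2 * C * \<kappa>)) :: real^'d \<Rightarrow> complex)"
  define V where "V = (L2_norm \<iota>)\<^sup>2"
  define \<omega> where "\<omega> = \<epsilon> / (W * sqrt V + 1)"
  have W: "0 \<le> W" and V: "0 \<le> V" by (auto simp: W_def V_def)
  have WV: "0 \<le> W * sqrt V" using W V by simp
  then have "0 < W * sqrt V + 1" by linarith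
  moreover from this WV have "\<epsilon> * ((W * sqrt V) / (W * sqrt V + 1)) \<le> \<epsilon> * 1"
    using \<open>0 < \<epsilon>\<close> by (intro mult_left_mono) auto
  ultimately have \<omega>: "0 < \<omega>" "\<omega> * W * sqrt V \<le> \<epsilon>"
    using \<open>0 < \<epsilon>\<close> by (simp_all add: \<omega>_def mult.assoc)
  have "\<iota> \<in> borel_measurable borel" unfolding \<iota>_def by (rule borel_measurable_indicator) simp
  then have \<iota>: "sq_int \<iota>"
    by (rule sq_int_bounded_support[of _ 1 "\<rho> + 2 * C * \<kappa>"]) (auto simp: \<iota>_def indicator_def)
  obtain \<delta> where \<delta>: "0 < \<delta>" "\<And>x y. norm (x - y) < \<delta> \<Longrightarrow> norm (e x - e y) \<le> \<omega>"
    by (rule continuous_compact_support_uniform[of e \<rho> \<omega>]) (use cont supp \<omega>(1) in auto)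
  have "(\<lambda>J. C * r ^ J * (2 * \<kappa>)) \<longlonglongrightarrow> 0"
    using C by (intro tendsto_mult_left_zero tendsto_mult_right_zero LIMSEQ_power_zero) auto
  then have "\<forall>\<^sub>F J in sequentially. C * r ^ J * (2 * \<kappa>) < \<delta>"
    by (rule order_tendstoD) (rule \<delta>(1))
  then show ?thesis
  proof eventually_elim
    case (elim J)
    define c where "c = sqrt 2 ^ J"
    have c: "0 < c" "c\<^sup>2 = 2 ^ J" by (simp_all add: c_def power_mult[symmetric] power_even_eq)
        (simp add: c_def power_mult[symmetric] mult.commute[of J] power_mult)
    define g where "g = (dil_inv A ^^ J) e"
    have sq_norm: "sq_int ((dil_inv A ^^ J) f) \<and> L2_norm ((dil_inv A ^^ J) f) = L2_norm f" if "sq_int f" for f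
      using sq_int_dil_pow[OF that, of "- int J"] L2_norm_dil_pow[OF that, of "- int J"] that
      by (cases "J = 0") (auto simp: dil_pow_def)
    have g: "sq_int g" "L2_norm g = L2_norm e" using sq_norm[OF e] by (auto simp: g_def)
    have g_eq: "g t = e ((((*v) Ri) ^^ J) t) / of_real c" for t
      by (simp add: g_def funpow_dil_inv c_def)
    have decay: "norm ((((*v) Ri) ^^ J) x) \<le> C * norm x" for x
      using C(4)[of J x] mult_right_mono[OF mult_left_mono[OF power_le_one[of r J] C(1)], of "norm x"] C(2,3)
      by simp
    have g_diff: "cmod (g t - g x) \<le> \<omega> / c" if "norm (t - x) \<le> 2 * \<kappa>" for t x
    proof -
      have "norm ((((*v) Ri) ^^ J) t - (((*v) Ri) ^^ J) x) \<le> C * r ^ J * norm (t - x)"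
        using C(4)[of J "t - x"] by (simp only: funpow_matrix_diff)
      also have "\<dots> \<le> C * r ^ J * (2 * \<kappa>)" using that C(1,2) by (intro mult_left_mono) auto
      also note elim
      finally have "cmod (e ((((*v) Ri) ^^ J) t) - e ((((*v) Ri) ^^ J) x)) \<le> \<omega>" by (rule \<delta>(2))
      moreover have "g t - g x = (e ((((*v) Ri) ^^ J) t) - e ((((*v) Ri) ^^ J) x)) / of_real c"
        by (simp add: g_eq diff_divide_distrib)
      ultimately show ?thesis using c(1) by (simp add: norm_divide divide_right_mono)
    qed
    \<comment> \<open>Since the cascade functions have integral 1, \<open>g x\<close> can be
      subtracted under the integral. A point of their support ball, shifted by \<open>l\<close>, is
      within 2 \<kappa> of \<open>x\<close> because \<kappa> also bounds the norms in the cube. The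
      estimate is uniform in \<open>n\<close> and survives the limit.\<close>
    have coef_close: "cmod (coef g l - g x) \<le> \<omega> / c * W" if x: "x - rvec l \<in> ucube" for l x
    proof (rule LIMSEQ_le_const2)
      show "(\<lambda>n. cmod (L2_inner g (transl l (cascade n)) - g x)) \<longlonglongrightarrow> cmod (coef g l - g x)"
        by (intro tendsto_intros coef_tendsto g)
      have "cmod (L2_inner g (transl l (cascade n)) - g x) \<le> \<omega> / c * W" for n
      proof -
        let ?u = "cascade n"
        have su: "sq_int ?u" and iu: "integrable lborel ?u" by (rule sq_int_cascade, rule integrable_cascade)
        have i1: "integrable lborel (\<lambda>t. transl (- l) g t * cnj (?u t))"
          by (intro integrable_L2_inner sq_int_transl g su)
        have i2: "integrable lborel (\<lambda>t. g x * cnj (?u t))" using integrable_cnj[OF iu] by simp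
        have "(LINT t|lborel. g x * cnj (?u t)) = g x"
          using integral_cascade[of n] by simp
        then have "L2_inner g (transl l ?u) - g x = (LINT t|lborel. transl (- l) g t * cnj (?u t) - g x * cnj (?u t))"
          using L2_inner_transl[OF g(1) su, of l] i1 i2 by (simp add: L2_inner_def)
        also have "cmod \<dots> \<le> (LINT t|lborel. cmod (transl (- l) g t * cnj (?u t) - g x * cnj (?u t)))"
          by (rule integral_norm_bound)
        also have "\<dots> \<le> (LINT t|lborel. \<omega> / c * cmod (?u t))"
        proof (rule integral_mono)
          show "integrable lborel (\<lambda>t. cmod (transl (- l) g t * cnj (?u t) - g x * cnj (?u t)))"
            using i1 i2 by (intro integrable_norm Bochner_Integration.integrable_diff)
          show "integrable lborel (\<lambda>t. \<omega> / c * cmod (?u t))" using iu by simp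
          fix t
          show "cmod (transl (- l) g t * cnj (?u t) - g x * cnj (?u t)) \<le> \<omega> / c * cmod (?u t)"
          proof (cases "norm t \<le> \<kappa>")
            case True
            have "norm ((t + rvec l) - x) \<le> norm t + norm (x - rvec l)"
              using norm_triangle_ineq4[of t "x - rvec l"] by (simp add: algebra_simps)
            also have "\<dots> \<le> 2 * \<kappa>" using True norm_ucube_le[OF x] \<kappa>(2) by simp
            finally have "cmod (g (t + rvec l) - g x) \<le> \<omega> / c" by (rule g_diff)
            moreover have "transl (- l) g t * cnj (?u t) - g x * cnj (?u t) = (g (t + rvec l) - g x) * cnj (?u t)"
              by (simp add: transl_def rvec_uminus left_diff_distrib)
            ultimately show ?thesis
              using mult_right_mono[of _ "\<omega> / c" "cmod (?u t)"] by (simp only: norm_mult complex_mod_cnj norm_ge_zero)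
          next
            case False
            then show ?thesis using \<kappa>(3)[of t n] by simp
          qed
        qed
        also have "\<dots> = \<omega> / c * (LINT t|lborel. cmod (?u t))" by (rule integral_mult_right_zero)
        also have "\<dots> \<le> \<omega> / c * W"
          unfolding W_def using \<omega>(1) c(1) by (intro mult_left_mono integral_norm_cascade_le \<kappa>(3)) auto
        finally show ?thesis .
      qed
      then show "\<exists>N. \<forall>n\<ge>N. cmod (L2_inner g (transl l (cascade n)) - g x) \<le> \<omega> / c * W" by blast
    qed
    \<comment> \<open>Contains every lattice point whose cube meets the support of
      \<open>g\<close>.\<close>
    define S where "S = {l. norm ((((*v) Ri) ^^ J) (rvec l)) \<le> \<rho> + C * \<kappa>}"
    have ucube_decay: "norm ((((*v) Ri) ^^ J) x - (((*v) Ri) ^^ J) (rvec l)) \<le> C * \<kappa>" if "x - rvec l \<in> ucube" for x l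
      using decay[of "x - rvec l"] mult_left_mono[OF order_trans[OF norm_ucube_le[OF that] \<kappa>(2)] C(1)]
      by (simp add: funpow_matrix_diff)
    have g_zero: "g x = 0" if "x - rvec l \<in> ucube" "l \<notin> S" for x l
    proof -
      have "norm ((((*v) Ri) ^^ J) (rvec l)) \<le> norm ((((*v) Ri) ^^ J) x) + C * \<kappa>"
        using ucube_decay[OF that(1)] norm_triangle_ineq3[of "(((*v) Ri) ^^ J) x" "(((*v) Ri) ^^ J) (rvec l)"] by linarith
      then have "\<rho> < norm ((((*v) Ri) ^^ J) x)" using that(2) by (simp add: S_def)
      then show ?thesis by (simp add: g_eq supp)
    qed
    \<comment> \<open>The disjoint unit cubes indexed by \<open>F\<close> lie where the squared
      modulus of the stretched indicator \<open>I\<close> is 2^(-J), and the integral of that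
      squared modulus is \<open>V\<close>.\<close>
    have cardF: "real (card F) \<le> 2 ^ J * V" if F: "finite F" "F \<subseteq> S" for F
    proof -
      define I where "I = (dil_inv A ^^ J) \<iota>"
      have I: "sq_int I" "L2_norm I = L2_norm \<iota>" using sq_norm[OF \<iota>] by (auto simp: I_def)
      have "real (card F) / 2 ^ J = (LINT t|lborel. (\<Sum>l\<in>F. 1 / 2 ^ J * indicator ucube (t - rvec l)))"
        by (subst Bochner_Integration.integral_sum) (auto simp: indicator_ucube_translate)
      also have "\<dots> \<le> (LINT t|lborel. (cmod (I t))\<^sup>2)"
      proof (rule integral_mono)
        show "integrable lborel (\<lambda>t. \<Sum>l\<in>F. 1 / 2 ^ J * indicator ucube (t - rvec l) :: real)"
          by (intro Bochner_Integration.integrable_sum integrable_mult_right indicator_ucube_translate)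
        show "integrable lborel (\<lambda>t. (cmod (I t))\<^sup>2)" by (rule sq_int_integrable_norm2[OF I(1)])
        fix t :: "real^'d"
        define m where "m = (\<chi> j. \<lfloor>t$j\<rfloor>)"
        have mt: "t - rvec m \<in> ucube" by (simp add: ucube_diff_iff m_def)
        show "(\<Sum>l\<in>F. 1 / 2 ^ J * indicator ucube (t - rvec l)) \<le> (cmod (I t))\<^sup>2"
        proof (cases "m \<in> F")
          case True
          then have "norm ((((*v) Ri) ^^ J) (rvec m)) \<le> \<rho> + C * \<kappa>" using F by (auto simp: S_def)
          then have "norm ((((*v) Ri) ^^ J) t) \<le> \<rho> + 2 * C * \<kappa>"
            using ucube_decay[OF mt] norm_triangle_ineq2[of "(((*v) Ri) ^^ J) t" "(((*v) Ri) ^^ J) (rvec m)"]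
            by linarith
          then have "(cmod (I t))\<^sup>2 = 1 / 2 ^ J"
            using c by (simp add: I_def funpow_dil_inv \<iota>_def c_def norm_divide power_divide norm_power)
          then show ?thesis using True unfolding sum_indicator_ucube[OF F(1)] by (simp add: m_def)
        next
          case False
          then show ?thesis unfolding sum_indicator_ucube[OF F(1)] by (simp add: m_def)
        qed
      qed
      also have "\<dots> = V" unfolding V_def I(2)[symmetric] L2_norm_sq ..
      finally show ?thesis by (simp add: field_simps)
    qed
    have finS: "finite S"
    proof (rule ccontr)
      assume "infinite S"
      obtain N :: nat where N: "2 ^ J * V < real N" using reals_Archimedean2 by blast
      obtain F where "finite F" "card F = N" "F \<subseteq> S"
        using infinite_arbitrarily_large[OF \<open>infinite S\<close>] by blast
      with cardF[of F] N show False by simp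
    qed
    \<comment> \<open>Its cubes are disjoint, so the squared norm is exactly the partial energy over
      \<open>S\<close>.\<close>
    define s where "s t = (\<Sum>l\<in>S. coef g l * indicator ucube (t - rvec l))" for t :: "real^'d"
    define m where "m t = (\<chi> j. \<lfloor>t$j\<rfloor>)" for t :: "real^'d"
    have mt: "t - rvec (m t) \<in> ucube" for t by (simp add: ucube_diff_iff m_def)
    have s_eq: "s t = (if m t \<in> S then coef g (m t) else 0)" for t
      unfolding s_def m_def by (rule sum_indicator_ucube[OF finS])
    have s2: "(cmod (s t))\<^sup>2 = (\<Sum>l\<in>S. (cmod (coef g l))\<^sup>2 * indicator ucube (t - rvec l))" for t
      unfolding sum_indicator_ucube[OF finS] s_eq by (simp add: m_def)
    have s: "sq_int s"
    proof -
      have "s \<in> borel_measurable borel" unfolding s_def by measurable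
      moreover have "integrable lborel (\<lambda>t. (cmod (s t))\<^sup>2)"
        unfolding s2 by (intro Bochner_Integration.integrable_sum integrable_mult_right indicator_ucube_translate)
      ultimately show ?thesis by (simp add: sq_int_def)
    qed
    have "(L2_norm s)\<^sup>2 = (\<Sum>l\<in>S. (cmod (coef g l))\<^sup>2)"
      unfolding L2_norm_sq s2
      by (subst Bochner_Integration.integral_sum) (auto simp: indicator_ucube_translate)
    also have "\<dots> \<le> energy g" by (rule finite_sum_le_energy[OF g(1) finS])
    finally have s_norm: "L2_norm s \<le> sqrt (energy g)" by (rule real_le_rsqrt)
    have "(L2_norm (\<lambda>t. g t - s t))\<^sup>2 \<le> (LINT t|lborel. (\<Sum>l\<in>S. (\<omega> / c * W)\<^sup>2 * indicator ucube (t - rvec l)))"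
      unfolding L2_norm_sq
    proof (rule integral_mono)
      show "integrable lborel (\<lambda>t. (cmod (g t - s t))\<^sup>2)"
        by (rule sq_int_integrable_norm2[OF sq_int_diff[OF g(1) s]])
      show "integrable lborel (\<lambda>t. \<Sum>l\<in>S. (\<omega> / c * W)\<^sup>2 * indicator ucube (t - rvec l))"
        by (intro Bochner_Integration.integrable_sum integrable_mult_right indicator_ucube_translate)
      fix t :: "real^'d"
      show "(cmod (g t - s t))\<^sup>2 \<le> (\<Sum>l\<in>S. (\<omega> / c * W)\<^sup>2 * indicator ucube (t - rvec l))"
      proof (cases "m t \<in> S")
        case True
        have "cmod (g t - s t) \<le> \<omega> / c * W"
          using coef_close[OF mt] True by (simp add: s_eq norm_minus_commute)
        then have "(cmod (g t - s t))\<^sup>2 \<le> (\<omega> / c * W)\<^sup>2" by (rule power_mono) simp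
        then show ?thesis using True unfolding sum_indicator_ucube[OF finS] by (simp add: m_def)
      next
        case False
        then have "g t - s t = 0" using g_zero[OF mt False] by (simp add: s_eq)
        then show ?thesis by (simp add: sum_nonneg)
      qed
    qed
    also have "\<dots> = (\<omega> / c * W)\<^sup>2 * real (card S)"
      by (subst Bochner_Integration.integral_sum) (auto simp: indicator_ucube_translate)
    \<comment> \<open>The number of cubes grows at most like c^2 = 2^J while the squared local error
      falls like 1 / c^2, so the powers of \<open>c\<close> cancel.\<close>
    also have "\<dots> \<le> (\<omega> / c * W)\<^sup>2 * (c\<^sup>2 * V)"
      unfolding c(2) using cardF[OF finS] by (intro mult_left_mono) auto
    also have "\<dots> = (\<omega> * W * sqrt V)\<^sup>2" using c(1) V by (simp add: power_mult_distrib power_divide)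
    finally have "L2_norm (\<lambda>t. g t - s t) \<le> \<omega> * W * sqrt V"
      using \<omega>(1) W V by (intro power2_le_imp_le[of "L2_norm (\<lambda>t. g t - s t)"]) auto
    then have "L2_norm (\<lambda>t. g t - s t) \<le> \<epsilon>" using \<omega>(2) by linarith
    then have "L2_norm e \<le> sqrt (energy g) + \<epsilon>"
      using L2_norm_triangle_diff[OF g(1) s] s_norm g(2) by linarith
    then show ?case by (simp add: g_def)
  qed
qed

text \<open>Bessel bounds the energy above. For the lower bound \<open>f\<close> is replaced by a
  continuous function of compact support; dilations are isometric, so the cost of the replacement is
  the same for every \<open>J\<close>.\<close>

lemma energy_tendsto_norm:
  assumes f: "sq_int f"
  shows "(\<lambda>J. energy (dil_pow A (- int J) f)) \<longlonglongrightarrow> (L2_norm f)\<^sup>2"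
proof -
  have sf: "sq_int (dil_pow A (- int J) f)" for J by (rule sq_int_dil_pow[OF f])
  have "(\<lambda>J. sqrt (energy (dil_pow A (- int J) f))) \<longlonglongrightarrow> L2_norm f"
  proof (rule LIMSEQ_I)
    fix \<epsilon> :: real assume "0 < \<epsilon>"
    obtain e \<rho> where e: "continuous_on UNIV e" "\<And>x. \<rho> < norm x \<Longrightarrow> e x = 0" "sq_int e"
      "L2_norm (\<lambda>x. f x - e x) < \<epsilon>/4"
      using L2_dense_continuous_compact_support[OF f, of "\<epsilon>/4"] \<open>0 < \<epsilon>\<close> by auto
    have "\<forall>\<^sub>F J in sequentially. L2_norm e - \<epsilon>/4 \<le> sqrt (energy ((dil_inv A ^^ J) e))"
      by (rule energy_dil_inv_ge[of e \<rho>]) (use e \<open>0 < \<epsilon>\<close> in auto)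
    then obtain J0 where J0: "\<And>J. J \<ge> J0 \<Longrightarrow> L2_norm e - \<epsilon>/4 \<le> sqrt (energy ((dil_inv A ^^ J) e))"
      by (auto simp: eventually_sequentially)
    have "norm (sqrt (energy (dil_pow A (- int J) f)) - L2_norm f) < \<epsilon>" if "J \<ge> J0" for J
    proof -
      have dp: "dil_pow A (- int J) e = (dil_inv A ^^ J) e" by (cases "J = 0") (auto simp: dil_pow_def)
      have "sqrt (energy (dil_pow A (- int J) e))
          \<le> sqrt (energy (dil_pow A (- int J) f)) + L2_norm (\<lambda>t. dil_pow A (- int J) e t - dil_pow A (- int J) f t)"
        by (rule sqrt_energy_triangle) (intro sq_int_dil_pow e f)+
      also have "L2_norm (\<lambda>t. dil_pow A (- int J) e t - dil_pow A (- int J) f t) = L2_norm (\<lambda>t. e t - f t)"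
        unfolding dil_pow_diff[symmetric] by (intro L2_norm_dil_pow sq_int_diff e f)
      also have "\<dots> = L2_norm (\<lambda>t. f t - e t)" by (rule L2_norm_minus_commute)
      finally have "L2_norm e - \<epsilon>/4 \<le> sqrt (energy (dil_pow A (- int J) f)) + \<epsilon>/4"
        using e(4) J0[OF that] dp by simp
      moreover have "L2_norm f \<le> L2_norm e + L2_norm (\<lambda>t. f t - e t)" by (rule L2_norm_triangle_diff[OF f e(3)])
      moreover have "sqrt (energy (dil_pow A (- int J) f)) \<le> sqrt ((L2_norm f)\<^sup>2)"
        using energy_le[OF sf, of J] by (intro real_sqrt_le_mono) (simp add: L2_norm_dil_pow f)
      moreover have "sqrt ((L2_norm f)\<^sup>2) = L2_norm f" by simp
      ultimately show ?thesis using e(4) \<open>0 < \<epsilon>\<close> unfolding real_norm_def by linarith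
    qed
    then show "\<exists>J0. \<forall>J\<ge>J0. norm (sqrt (energy (dil_pow A (- int J) f)) - L2_norm f) < \<epsilon>" by blast
  qed
  then have "(\<lambda>J. (sqrt (energy (dil_pow A (- int J) f)))\<^sup>2) \<longlonglongrightarrow> (L2_norm f)\<^sup>2" by (rule tendsto_power)
  then show ?thesis by (simp add: energy_nonneg)
qed

lemma energy_tendsto_zero:
  assumes f: "sq_int f"
  shows "(\<lambda>J. energy (dil_pow A (int J) f)) \<longlonglongrightarrow> 0"
proof -
  have sf: "sq_int (dil_pow A (int J) f)" for J by (rule sq_int_dil_pow[OF f])
  have "(\<lambda>J. sqrt (energy (dil_pow A (int J) f))) \<longlonglongrightarrow> 0"
  proof (rule LIMSEQ_I)
    fix \<epsilon> :: real assume "0 < \<epsilon>"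
    obtain e \<rho> where e: "continuous_on UNIV e" "\<And>x. \<rho> < norm x \<Longrightarrow> e x = 0" "sq_int e"
      "L2_norm (\<lambda>x. f x - e x) < \<epsilon>/2"
      using L2_dense_continuous_compact_support[OF f, of "\<epsilon>/2"] \<open>0 < \<epsilon>\<close> by auto
    have "(\<lambda>J. energy ((dil A ^^ J) e)) \<longlonglongrightarrow> 0"
      by (rule energy_dil_tendsto_0[of e \<rho>]) (use e in auto)
    then have "(\<lambda>J. sqrt (energy ((dil A ^^ J) e))) \<longlonglongrightarrow> sqrt 0" by (rule tendsto_real_sqrt)
    then have "\<forall>\<^sub>F J in sequentially. sqrt (energy ((dil A ^^ J) e)) < \<epsilon>/2"
      using \<open>0 < \<epsilon>\<close> by (intro order_tendstoD(2)) auto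
    then obtain J0 where J0: "\<And>J. J \<ge> J0 \<Longrightarrow> sqrt (energy ((dil A ^^ J) e)) < \<epsilon>/2"
      by (auto simp: eventually_sequentially)
    have "norm (sqrt (energy (dil_pow A (int J) f)) - 0) < \<epsilon>" if "J \<ge> J0" for J
    proof -
      have dp: "dil_pow A (int J) e = (dil A ^^ J) e" by (simp add: dil_pow_def)
      have "sqrt (energy (dil_pow A (int J) f))
          \<le> sqrt (energy (dil_pow A (int J) e)) + L2_norm (\<lambda>t. dil_pow A (int J) f t - dil_pow A (int J) e t)"
        by (rule sqrt_energy_triangle) (intro sq_int_dil_pow e f)+
      also have "L2_norm (\<lambda>t. dil_pow A (int J) f t - dil_pow A (int J) e t) = L2_norm (\<lambda>t. f t - e t)"
        unfolding dil_pow_diff[symmetric] by (intro L2_norm_dil_pow sq_int_diff e f)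
      finally show ?thesis using e(4) J0[OF that] dp by (simp add: energy_nonneg)
    qed
    then show "\<exists>J0. \<forall>J\<ge>J0. norm (sqrt (energy (dil_pow A (int J) f)) - 0) < \<epsilon>" by blast
  qed
  then have "(\<lambda>J. (sqrt (energy (dil_pow A (int J) f)))\<^sup>2) \<longlonglongrightarrow> 0\<^sup>2" by (rule tendsto_power)
  then show ?thesis by (simp add: energy_nonneg)
qed

section \<open>The Parseval identity by telescoping\<close>

lemma wavelet_Parseval:
  assumes f: "sq_int f"
  shows "((\<lambda>(n, l). (cmod (L2_inner f (dil_pow A n (transl l wavelet))))\<^sup>2) has_sum (L2_norm f)\<^sup>2)
    (UNIV :: (int \<times> (int^'d)) set)"
proof -
  define E where "E n = energy (dil_pow A (- n) f)" for n
  let ?c = "\<lambda>n l. (cmod (L2_inner f (dil_pow A n (transl l wavelet))))\<^sup>2"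
  \<comment> \<open>Moving the dilation onto \<open>f\<close> turns scale \<open>n\<close> into the
    energy step of \<open>dil_pow A (- n) f\<close>.\<close>
  have level: "((\<lambda>l. ?c n l) has_sum (E (n + 1) - E n)) UNIV" for n
    using wavelet_energy_step[OF sq_int_dil_pow[OF f], of "- n"]
    by (simp add: E_def dil_inv_dil_pow L2_inner_dil_pow f sq_int_transl sq_int_wavelet)
  \<comment> \<open>Each increment is a sum of squares. Nonnegativity upgrades the limit of
    symmetric partial sums to an unconditional sum.\<close>
  have nn: "0 \<le> E (n + 1) - E n" for n
    by (rule has_sum_nonneg[OF level]) simp
  have tele: "(\<Sum>n\<in>{- int J..<int J}. E (n + 1) - E n) = E (int J) - E (- int J)" for J
  proof (induction J)
    case (Suc J)
    have "{- int (Suc J)..<int (Suc J)} = insert (- int (Suc J)) (insert (int J) {- int J..<int J})"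
      by auto
    then show ?case using Suc by (simp add: add.commute)
  qed simp
  have "(\<lambda>J. E (int J) - E (- int J)) \<longlonglongrightarrow> (L2_norm f)\<^sup>2 - 0"
    unfolding E_def by (intro tendsto_diff energy_tendsto_norm f) (simp add: energy_tendsto_zero[OF f])
  then have lv: "((\<lambda>n. E (n + 1) - E n) has_sum (L2_norm f)\<^sup>2) UNIV"
    by (intro has_sum_nonneg_int nn) (simp add: tele)
  have "((\<lambda>(n, l). ?c n l) has_sum (L2_norm f)\<^sup>2) (UNIV \<times> UNIV)"
  proof (rule has_sum_SigmaI)
    show "((\<lambda>l. (case (n, l) of (n, l) \<Rightarrow> ?c n l)) has_sum (E (n + 1) - E n)) UNIV" for n
      using level by simp
    show "((\<lambda>n. E (n + 1) - E n) has_sum (L2_norm f)\<^sup>2) UNIV" by (rule lv)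
    show "(\<lambda>(n, l). ?c n l) summable_on UNIV \<times> UNIV"
      by (rule summable_on_SigmaI[where g="\<lambda>n. E (n + 1) - E n"])
         (use level lv in \<open>auto intro: has_sum_imp_summable\<close>)
  qed
  then show ?thesis by simp
qed

end

theorem theorem9p4:
  fixes A :: "int^'d^'d" and lA qA :: "int^'d" and h :: "int^'d \<Rightarrow> complex"
    and N0 :: nat and \<phi> :: "real^'d \<Rightarrow> complex"
  assumes expA: "expansive A"
    and detA: "\<bar>det A\<bar> = 2"
    and lat: "latt A = latt (transpose A)"
    and part: "UNIV = ((\<lambda>k. lA + k) ` latt A) \<union> latt A"
    and disj: "((\<lambda>k. lA + k) ` latt A) \<inter> latt A = {}"
    and qeven: "\<forall>k\<in>latt A. even (dotz qA k)"
    and qodd: "\<forall>k\<in>latt A. odd (dotz qA (lA + k))"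
    and cond1: "\<forall>m\<in>latt A. \<forall>n. UNIV = ((\<lambda>k. n - k) ` latt A) \<union> ((\<lambda>k. lA - m - n + k) ` latt A)
                 \<and> ((\<lambda>k. n - k) ` latt A) \<inter> ((\<lambda>k. lA - m - n + k) ` latt A) = {}"
    and cond2: "\<forall>m\<in>(\<lambda>k. lA + k) ` latt A. \<forall>n. (\<lambda>k. n - k) ` latt A = (\<lambda>k. lA - m - n + k) ` latt A"
    and orth: "\<forall>k\<in>latt A. (\<Sum>\<^sub>\<infinity>n. h n * cnj (h (n + k))) = (if k = 0 then 1 else 0)"
    and hsum: "(\<Sum>\<^sub>\<infinity>n. h n) = complex_of_real (sqrt 2)"
    and hsupp: "\<forall>n. n \<notin> {n::int^'d. \<forall>j. \<bar>n$j\<bar> \<le> int N0} \<longrightarrow> h n = 0"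
    and phi: "fourier_L2 \<phi> (gfun A h N0)"
  shows "\<forall>f. sq_int f \<longrightarrow>
     ((\<lambda>(n, l). (cmod (L2_inner f (dil_pow A n (transl l
         (\<lambda>t. \<Sum>\<^sub>\<infinity>k. (-1) powi (dotz qA k) * cnj (h (lA - k)) * dil A (transl k \<phi>) t)))))\<^sup>2)
      has_sum (L2_norm f)\<^sup>2) (UNIV :: (int \<times> (int^'d)) set)"
proof -
  interpret refinable_function A lA h N0 qA \<phi>
    by unfold_locales (fact expA part disj orth hsum hsupp qeven qodd cond1 cond2 phi)+
  show ?thesis
    using wavelet_Parseval unfolding wavelet_def[abs_def] by blast
qed

end
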